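(* Let $b:\mathbb{D}\to\mathbb{D}$ be analytic and a non-extreme point of the unit ball of $\mathcal{H}^\infty$, let $a$ be its Pythagorean mate, and let $\phi=b/a$. Let $p\in(2,\infty)$ and $\tilde p=\frac{2p}{p-2}$. The following two statements are equivalent: (i) $\mathcal{H}^p\subset\mathcal{H}(b)$; (ii) $\phi\in\mathcal{H}^{\tilde p}$.
   Context: $\mathbb{D}$ is the open unit disk, $\mathbb{T}$ the unit circle, $m$ the Lebesgue measure on $\mathbb{T}$ normalized by $m(\mathbb{T})=1$. $\mathcal{H}^p$ ($0<p<\infty$) is the Hardy space of analytic functions on $\mathbb{D}$ with $\|f\|_p^p:=\sup_{0<r<1}\int_{\mathbb{T}}|f(r\zeta)|^p\,dm(\zeta)<\infty$; $\mathcal{H}^\infty$ is the algebra of bounded analytic functions on $\mathbb{D}$. For analytic $b:\mathbb{D}\to\mathbb{D}$, the de Branges-Rovnyak space $\mathcal{H}(b)$ is the Hilbert space of analytic functions on $\mathbb{D}$ with reproducing kernel $k_b(\lambda,z)=\frac{1-\overline{b(\lambda)}b(z)}{1-\overline{\lambda}z}$. Always $\mathcal{H}(b)\subset\mathcal{H}^2$. The function $b$ is a non-extreme point of the unit ball of $\mathcal{H}^\infty$ if and only if $\int_{\mathbb{T}}\log(1-|b|)\,dm>-\infty$. In that case its Pythagorean mate is the unique outer function $a:\mathbb{D}\to\mathbb{D}$ with $a(0)>0$ and $|a|^2+|b|^2=1$ almost everywhere on $\mathbb{T}$ (in terms of boundary values; the case $a\equiv1$, when $b\equiv0$, is allowed).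 *)

theory Defs
  imports "HOL-Complex_Analysis.Complex_Analysis"
begin

text \<open>
  Functions on the open unit disk are represented by total functions \<open>complex \<Rightarrow> complex\<close> whose values
  off the disk are irrelevant: every notion below depends only on the values on the disk.
\<close>

abbreviation unit_disk :: "complex set"
  where "unit_disk \<equiv> ball 0 1"

text \<open>
  The space of this measure is the circle itself and not the whole plane, so that measurability of
  an integrand is a condition on the circle only.
\<close>

definition circle_measure :: "complex measure"
  where "circle_measure =
    distr (uniform_measure lborel {0..2 * pi}) (restrict_space borel (sphere 0 1)) cis"

lemma cis_measurable_circle:
  "cis \<in> uniform_measure lborel {0..2 * pi} \<rightarrow>\<^sub>M restrict_space borel (sphere 0 1)"
proof (rule measurable_restrict_space2)
  have "cis \<in> borel_measurable borel"
    by (intro borel_measurable_continuous_onI continuous_intros)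
  then show "cis \<in> uniform_measure lborel {0..2 * pi} \<rightarrow>\<^sub>M borel"
    by (simp add: measurable_def)
qed auto

lemma space_circle_measure: "space circle_measure = sphere 0 1"
  by (simp add: circle_measure_def space_restrict_space)

lemma emeasure_circle_measure: "emeasure circle_measure (sphere 0 1) = 1"
proof -
  have "cis -` sphere 0 1 \<inter> UNIV = UNIV"
    by auto
  moreover have "sphere 0 1 \<in> sets (restrict_space borel (sphere (0::complex) 1))"
    by (simp add: sets_restrict_space_iff)
  ultimately show ?thesis
    unfolding circle_measure_def
    by (subst emeasure_distr[OF cis_measurable_circle])
       (auto simp: emeasure_uniform_measure ennreal_divide_self)
qed

definition hardy :: "real \<Rightarrow> (complex \<Rightarrow> complex) set"
  where "hardy p = {f. f holomorphic_on unit_disk \<and>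
    (SUP r\<in>{0<..<1::real}.
       \<integral>\<^sup>+ \<zeta>. ennreal (norm (f (of_real r * \<zeta>)) powr p) \<partial>circle_measure) < \<infinity>}"

definition hardy_infty :: "(complex \<Rightarrow> complex) set"
  where "hardy_infty = {f. f holomorphic_on unit_disk \<and> bounded (f ` unit_disk)}"

definition hardy_infty_unit_ball :: "(complex \<Rightarrow> complex) set"
  where "hardy_infty_unit_ball = {f \<in> hardy_infty. \<forall>z\<in>unit_disk. norm (f z) \<le> 1}"

text \<open>
  The constant \<open>extreme_point_of\<close> does not apply here: functions have to be identified when they
  agree on the disk.
\<close>

definition extreme_in_unit_ball :: "(complex \<Rightarrow> complex) \<Rightarrow> bool"
  where "extreme_in_unit_ball b \<longleftrightarrow> b \<in> hardy_infty_unit_ball \<and>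
    (\<forall>f\<in>hardy_infty_unit_ball. \<forall>g\<in>hardy_infty_unit_ball. \<forall>t\<in>{0<..<1::real}.
       (\<forall>z\<in>unit_disk. b z = of_real (1 - t) * f z + of_real t * g z) \<longrightarrow>
       (\<forall>z\<in>unit_disk. f z = g z))"

definition nonextreme_in_unit_ball :: "(complex \<Rightarrow> complex) \<Rightarrow> bool"
  where "nonextreme_in_unit_ball b \<longleftrightarrow> b \<in> hardy_infty_unit_ball \<and> \<not> extreme_in_unit_ball b"

definition has_radial_limit :: "(complex \<Rightarrow> complex) \<Rightarrow> complex \<Rightarrow> complex \<Rightarrow> bool"
  where "has_radial_limit f \<zeta> l \<longleftrightarrow> ((\<lambda>r::real. f (of_real r * \<zeta>)) \<longlongrightarrow> l) (at_left 1)"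

definition outer :: "(complex \<Rightarrow> complex) \<Rightarrow> bool"
  where "outer f \<longleftrightarrow> (\<exists>c h. norm c = 1 \<and>
    h \<in> borel_measurable circle_measure \<and> (\<forall>\<zeta>\<in>sphere 0 1. 0 < h \<zeta>) \<and>
    integrable circle_measure (\<lambda>\<zeta>. ln (h \<zeta> :: real)) \<and>
    (\<forall>z\<in>unit_disk.
       f z = c * exp (LINT \<zeta>|circle_measure. (\<zeta> + z) / (\<zeta> - z) * of_real (ln (h \<zeta>)))))"

text \<open>
  The closed disk as codomain admits \<open>a \<equiv> 1\<close> (the mate of \<open>b \<equiv> 0\<close>); by the maximum principle and
  \<open>a 0 > 0\<close> this is the only case in which \<open>a\<close> leaves the open disk. The limits are required to
  exist as part of the almost-everywhere condition; for bounded analytic functions this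
  is Fatou's theorem.
\<close>

definition pythagorean_mate :: "(complex \<Rightarrow> complex) \<Rightarrow> (complex \<Rightarrow> complex) \<Rightarrow> bool"
  where "pythagorean_mate b a \<longleftrightarrow>
    a holomorphic_on unit_disk \<and> a ` unit_disk \<subseteq> cball 0 1 \<and> outer a \<and>
    a 0 \<in> \<real> \<and> 0 < Re (a 0) \<and>
    (AE \<zeta> in circle_measure. \<exists>\<alpha> \<beta>. has_radial_limit a \<zeta> \<alpha> \<and> has_radial_limit b \<zeta> \<beta> \<and>
       (norm \<alpha>)\<^sup>2 + (norm \<beta>)\<^sup>2 = 1)"

text \<open>
  A reproducing kernel Hilbert space of functions on \<open>X\<close>, with kernel functions \<open>K x\<close> and an inner
  product that is linear in the first argument. Since functions count as equal when they
  agree on \<open>X\<close>, the carrier \<open>H\<close> is closed under changing values off \<open>X\<close> (which makes it unique), and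
  definiteness is stated modulo values off \<open>X\<close>.
\<close>

locale rkhs =
  fixes X :: "'x set"
    and K :: "'x \<Rightarrow> 'x \<Rightarrow> complex"
    and H :: "('x \<Rightarrow> complex) set"
    and ip :: "('x \<Rightarrow> complex) \<Rightarrow> ('x \<Rightarrow> complex) \<Rightarrow> complex"
  assumes cong_mem: "f \<in> H \<Longrightarrow> (\<And>x. x \<in> X \<Longrightarrow> g x = f x) \<Longrightarrow> g \<in> H"
    and zero_mem: "(\<lambda>x. 0) \<in> H"
    and add_mem: "f \<in> H \<Longrightarrow> g \<in> H \<Longrightarrow> (\<lambda>x. f x + g x) \<in> H"
    and scale_mem: "f \<in> H \<Longrightarrow> (\<lambda>x. c * f x) \<in> H"
    and ip_add: "f \<in> H \<Longrightarrow> g \<in> H \<Longrightarrow> h \<in> H \<Longrightarrow> ip (\<lambda>x. f x + g x) h = ip f h + ip g h"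
    and ip_scale: "f \<in> H \<Longrightarrow> g \<in> H \<Longrightarrow> ip (\<lambda>x. c * f x) g = c * ip f g"
    and ip_commute: "f \<in> H \<Longrightarrow> g \<in> H \<Longrightarrow> ip g f = cnj (ip f g)"
    and ip_nonneg: "f \<in> H \<Longrightarrow> 0 \<le> Re (ip f f)"
    and ip_eq_0_iff: "f \<in> H \<Longrightarrow> ip f f = 0 \<longleftrightarrow> (\<forall>x\<in>X. f x = 0)"
    and complete: "(\<And>n::nat. F n \<in> H) \<Longrightarrow>
      (\<And>e. 0 < e \<Longrightarrow> \<exists>N. \<forall>m\<ge>N. \<forall>n\<ge>N.
         sqrt (Re (ip (\<lambda>x. F m x - F n x) (\<lambda>x. F m x - F n x))) < e) \<Longrightarrow>
      \<exists>f\<in>H. (\<lambda>n. sqrt (Re (ip (\<lambda>x. F n x - f x) (\<lambda>x. F n x - f x)))) \<longlonglongrightarrow> 0"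
    and kernel_mem: "x \<in> X \<Longrightarrow> K x \<in> H"
    and reproducing: "f \<in> H \<Longrightarrow> x \<in> X \<Longrightarrow> f x = ip f (K x)"

definition dBR_kernel :: "(complex \<Rightarrow> complex) \<Rightarrow> complex \<Rightarrow> complex \<Rightarrow> complex"
  where "dBR_kernel b w z = (1 - cnj (b w) * b z) / (1 - cnj w * z)"

definition dBR_space :: "(complex \<Rightarrow> complex) \<Rightarrow> (complex \<Rightarrow> complex) set"
  where "dBR_space b = (THE H. (\<forall>f\<in>H. f holomorphic_on unit_disk) \<and>
    (\<exists>ip. rkhs unit_disk (dBR_kernel b) H ip))"

end

theory Submission imports Defs begin

text \<open>
  Write \<open>\<phi> = b / a\<close> and let \<open>\<langle>f, g\<rangle>\<close> be the inner product of the Hardy space \<open>H2\<close>, the sum of the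
  products of Taylor coefficients.  The proof rests on a description of \<open>\<H>(b)\<close> by duality: a function
  \<open>f\<close> of \<open>H2\<close> lies in \<open>\<H>(b)\<close> exactly when \<open>\<bar>\<langle>f, b u\<rangle>\<bar> \<le> C \<parallel>a u\<parallel>\<close> for a constant \<open>C\<close> and all bounded
  analytic \<open>u\<close> (\<open>dBR_space_memI\<close>, \<open>dBR_space_memD\<close>).  Since \<open>b u = \<phi> (a u)\<close>, this says that the Toeplitz
  operator with symbol \<open>cnj \<phi>\<close> sends \<open>f\<close> into \<open>H2\<close>.  The description comes from the explicit model of
  \<open>\<H>(b)\<close> as the space of all \<open>f\<close> that have a companion \<open>g\<close> in \<open>H2\<close> with \<open>\<langle>f, b u\<rangle> = \<langle>g, a u\<rangle>\<close> for all \<open>u\<close>,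
  with the squared norm \<open>\<parallel>f\<parallel>\<^sup>2 + \<parallel>g\<parallel>\<^sup>2\<close>.  That the model has the right kernel is the identity
  \<open>\<bar>a\<bar>\<^sup>2 + \<bar>b\<bar>\<^sup>2 = 1\<close> on the circle (\<open>pythagorean_isometry\<close>); that the companion is unique is the outerness
  of \<open>a\<close>; and a reproducing kernel determines its space (\<open>rkhs_unique\<close>).

  If \<open>\<phi>\<close> lies in the Hardy space with exponent \<open>q = 2 p / (p - 2)\<close>, then \<open>1/p + 1/q = 1/2\<close>, and the
  inequalities of Young and Cauchy-Schwarz on each circle around the origin bound \<open>\<langle>f, \<phi> (a u)\<rangle>\<close> by a
  multiple of \<open>\<parallel>a u\<parallel>\<close> for every \<open>f\<close> of exponent \<open>p\<close> (\<open>hardy_subset_dBR_space\<close>).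

  Conversely, suppose that \<open>\<H>(b)\<close> contains all functions of exponent \<open>p\<close>.  By uniform boundedness one
  constant \<open>C\<close> serves the whole unit ball (\<open>H2_uniform_boundedness\<close>).  An outer function has bounded
  analytic approximate inverses (\<open>outer_approximants\<close>), so \<open>a u\<close> can be replaced by any polynomial \<open>G\<close>,
  which gives \<open>\<bar>\<langle>F, \<phi> G\<rangle>\<bar> \<le> C \<parallel>F\<parallel>\<^sub>p \<parallel>G\<parallel>\<^sub>2\<close> for all polynomials \<open>F\<close> and \<open>G\<close> (\<open>toeplitz_form_bound\<close>).
  Two symmetries of this form finish the proof.  Rotating \<open>F\<close> and \<open>G\<close> together rotates \<open>\<phi>\<close>, and an average
  over rotations with the Poisson kernel replaces \<open>\<phi>\<close> by its dilation \<open>\<phi>\<^sub>r\<close>, with the same constant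
  (\<open>dilated_form_bound\<close>).  Now the form is the integral of \<open>F cnj (\<phi>\<^sub>r G)\<close> over the circle, and multiplying
  both \<open>F\<close> and \<open>G\<close> by a power of the variable leaves it unchanged; so the bound extends from
  polynomials to trigonometric polynomials and from there to continuous functions
  (\<open>continuous_form_bound\<close>).  Among those, \<open>F\<close> and \<open>G\<close> can be chosen pointwise such that the integrand is
  \<open>\<bar>\<phi>\<^sub>r\<bar>\<^sup>q\<close>, and the bound becomes an estimate of the mean of \<open>\<bar>\<phi>\<^sub>r\<bar>\<^sup>q\<close> that is independent of \<open>r\<close>
  (\<open>powr_mean_bound_if_form_bound\<close>).
\<close>

section \<open>Inner product spaces of functions and uniqueness of the reproducing kernel space\<close>

text \<open>
  The inner product may be degenerate, because functions are identified when they agree on the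
  disk or on the circle only.  The locale is used for reproducing kernel spaces, for Taylor
  coefficients and for continuous functions on the circle.
\<close>

locale semi_inner =
  fixes H :: "('x \<Rightarrow> complex) set"
    and ip :: "('x \<Rightarrow> complex) \<Rightarrow> ('x \<Rightarrow> complex) \<Rightarrow> complex"
  assumes add_mem: "f \<in> H \<Longrightarrow> g \<in> H \<Longrightarrow> (\<lambda>x. f x + g x) \<in> H"
    and scale_mem: "f \<in> H \<Longrightarrow> (\<lambda>x. c * f x) \<in> H"
    and ip_add: "f \<in> H \<Longrightarrow> g \<in> H \<Longrightarrow> h \<in> H \<Longrightarrow> ip (\<lambda>x. f x + g x) h = ip f h + ip g h"
    and ip_scale: "f \<in> H \<Longrightarrow> g \<in> H \<Longrightarrow> ip (\<lambda>x. c * f x) g = c * ip f g"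
    and ip_commute: "f \<in> H \<Longrightarrow> g \<in> H \<Longrightarrow> ip g f = cnj (ip f g)"
    and ip_nonneg: "f \<in> H \<Longrightarrow> 0 \<le> Re (ip f f)"
begin

definition nrm :: "('x \<Rightarrow> complex) \<Rightarrow> real"
  where "nrm f = sqrt (Re (ip f f))"

lemma diff_mem: "f \<in> H \<Longrightarrow> g \<in> H \<Longrightarrow> (\<lambda>x. f x - g x) \<in> H"
  using add_mem[OF _ scale_mem[of g "-1"], of f] by simp

lemma ip_add_right: "f \<in> H \<Longrightarrow> g \<in> H \<Longrightarrow> h \<in> H \<Longrightarrow> ip h (\<lambda>x. f x + g x) = ip h f + ip h g"
  using ip_add[of f g h] ip_commute[of "\<lambda>x. f x + g x" h] ip_commute[of f h] ip_commute[of g h]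
    add_mem[of f g] by simp

lemma ip_scale_right: "f \<in> H \<Longrightarrow> g \<in> H \<Longrightarrow> ip g (\<lambda>x. c * f x) = cnj c * ip g f"
  using ip_scale[of f g c] ip_commute[of "\<lambda>x. c * f x" g] ip_commute[of f g] scale_mem[of f c]
  by simp

lemma ip_diff: "f \<in> H \<Longrightarrow> g \<in> H \<Longrightarrow> h \<in> H \<Longrightarrow> ip (\<lambda>x. f x - g x) h = ip f h - ip g h"
  using ip_add[of f "\<lambda>x. (-1) * g x" h] ip_scale[of g h "-1"] scale_mem[of g "-1"] by simp

lemma ip_diff_right: "f \<in> H \<Longrightarrow> g \<in> H \<Longrightarrow> h \<in> H \<Longrightarrow> ip h (\<lambda>x. f x - g x) = ip h f - ip h g"
  using ip_diff[of f g h] ip_commute[of "\<lambda>x. f x - g x" h] ip_commute[of f h] ip_commute[of g h]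
    diff_mem[of f g] by simp

lemma ip_self_real: "f \<in> H \<Longrightarrow> ip f f = of_real (Re (ip f f))"
  using ip_commute[of f f] by (metis complex_cnj_cancel_iff Reals_cnj_iff of_real_Re)

lemma nrm_nonneg: "f \<in> H \<Longrightarrow> 0 \<le> nrm f"
  by (simp add: nrm_def ip_nonneg)

lemma nrm_sq: "f \<in> H \<Longrightarrow> (nrm f)\<^sup>2 = Re (ip f f)"
  by (simp add: nrm_def ip_nonneg)

lemma nrm_sq_of_real: "f \<in> H \<Longrightarrow> of_real ((nrm f)\<^sup>2) = ip f f"
  using ip_self_real nrm_sq by simp

lemma nrm_scale:
  assumes "f \<in> H" shows "nrm (\<lambda>x. c * f x) = cmod c * nrm f"
proof -
  have "ip (\<lambda>x. c * f x) (\<lambda>x. c * f x) = (c * cnj c) * ip f f"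
    using assms by (simp add: ip_scale ip_scale_right scale_mem)
  also have "\<dots> = of_real ((cmod c)\<^sup>2 * (nrm f)\<^sup>2)"
    by (simp add: complex_norm_square[symmetric] nrm_sq_of_real[OF assms, symmetric])
  finally show ?thesis
    unfolding nrm_def[of "\<lambda>x. c * f x"]
    using nrm_nonneg[OF assms] by (simp add: real_sqrt_mult)
qed

lemma nrm_sq_add:
  assumes "f \<in> H" "g \<in> H"
  shows "(nrm (\<lambda>x. f x + g x))\<^sup>2 = (nrm f)\<^sup>2 + 2 * Re (ip f g) + (nrm g)\<^sup>2"
  using assms ip_commute[of f g]
  by (simp add: nrm_sq add_mem ip_add ip_add_right)

lemma nrm_sq_diff:
  assumes "f \<in> H" "g \<in> H"
  shows "(nrm (\<lambda>x. f x - g x))\<^sup>2 = (nrm f)\<^sup>2 - 2 * Re (ip f g) + (nrm g)\<^sup>2"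
  using assms ip_commute[of f g]
  by (simp add: nrm_sq diff_mem ip_diff ip_diff_right)

text \<open>
  A quadratic form in two real variables is nonnegative.  Where one of the two seminorms
  vanishes, a large multiple of the corresponding vector shows that the inner product is zero.
\<close>

lemma Cauchy_Schwarz:
  assumes f: "f \<in> H" and g: "g \<in> H"
  shows "cmod (ip f g) \<le> nrm f * nrm g"
proof -
  define c where "c = cmod (ip f g)"
  obtain e where e: "cmod e = 1" "e * ip f g = of_real c"
  proof (cases "ip f g = 0")
    case True then show ?thesis using that[of 1] by (simp add: c_def)
  next
    case False
    then show ?thesis
      using that[of "cnj (ip f g) / of_real c"]
      by (simp add: c_def norm_divide complex_norm_square[symmetric] power2_eq_square mult.commute)
  qed
  define h where "h = (\<lambda>x. e * f x)"
  have h: "h \<in> H" unfolding h_def using f by (rule scale_mem)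
  have hg: "ip h g = of_real c" unfolding h_def using e f g by (simp add: ip_scale)
  have nh: "nrm h = nrm f" unfolding h_def using e f by (simp add: nrm_scale)
  have q: "0 \<le> s\<^sup>2 * (nrm f)\<^sup>2 - 2 * s * t * c + t\<^sup>2 * (nrm g)\<^sup>2" for s t :: real
  proof -
    have "0 \<le> (nrm (\<lambda>x. (of_real s * h x) - (of_real t * g x)))\<^sup>2" by simp
    also have "\<dots> = (nrm (\<lambda>x. of_real s * h x))\<^sup>2
        - 2 * Re (ip (\<lambda>x. of_real s * h x) (\<lambda>x. of_real t * g x)) + (nrm (\<lambda>x. of_real t * g x))\<^sup>2"
      by (rule nrm_sq_diff) (use h g scale_mem in auto)
    also have "\<dots> = s\<^sup>2 * (nrm f)\<^sup>2 - 2 * s * t * c + t\<^sup>2 * (nrm g)\<^sup>2"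
      using h g by (simp add: ip_scale ip_scale_right scale_mem nrm_scale hg nh power_mult_distrib)
    finally show ?thesis .
  qed
  have nf: "nrm f \<ge> 0" and ng: "nrm g \<ge> 0" using f g nrm_nonneg by auto
  show ?thesis
  proof (cases "nrm f = 0 \<or> nrm g = 0")
    case False
    then have pos: "0 < nrm f * nrm g" using nf ng by (simp add: less_le)
    have "2 * (nrm f * nrm g) * c \<le> 2 * (nrm f * nrm g) * (nrm f * nrm g)"
      using q[of "nrm g" "nrm f"] by (simp add: power2_eq_square algebra_simps)
    then have "(nrm f * nrm g) * c \<le> (nrm f * nrm g) * (nrm f * nrm g)" by simp
    then show ?thesis using pos unfolding c_def by (rule mult_left_le_imp_le)
  next
    case True
    have c0: "c \<ge> 0" by (simp add: c_def)
    have "c \<le> 0"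
    proof (rule ccontr)
      assume "\<not> c \<le> 0"
      then have cp: "c > 0" by simp
      from True show False
      proof
        assume z: "nrm f = 0"
        have "0 \<le> - 2 * ((nrm g)\<^sup>2 + 1) + (nrm g)\<^sup>2"
          using q[of "((nrm g)\<^sup>2 + 1) / c" 1] z cp by simp
        then show False by (smt (verit) zero_le_power2)
      next
        assume z: "nrm g = 0"
        have "0 \<le> (nrm f)\<^sup>2 - 2 * ((nrm f)\<^sup>2 + 1)"
          using q[of 1 "((nrm f)\<^sup>2 + 1) / c"] z cp by simp
        then show False by (smt (verit) zero_le_power2)
      qed
    qed
    then show ?thesis using nf ng c0 unfolding c_def by simp
  qed
qed

lemma nrm_triangle:
  assumes f: "f \<in> H" and g: "g \<in> H"
  shows "nrm (\<lambda>x. f x + g x) \<le> nrm f + nrm g"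
proof -
  have "(nrm (\<lambda>x. f x + g x))\<^sup>2 \<le> (nrm f + nrm g)\<^sup>2"
    using Cauchy_Schwarz[OF f g] complex_Re_le_cmod[of "ip f g"]
    by (simp add: nrm_sq_add[OF f g] power2_sum)
  then show ?thesis
    by (rule power2_le_imp_le) (use f g nrm_nonneg in auto)
qed

lemma parallelogram:
  assumes f: "f \<in> H" and g: "g \<in> H"
  shows "(nrm (\<lambda>x. f x + g x))\<^sup>2 + (nrm (\<lambda>x. f x - g x))\<^sup>2 = 2 * (nrm f)\<^sup>2 + 2 * (nrm g)\<^sup>2"
  by (simp add: nrm_sq_add[OF f g] nrm_sq_diff[OF f g])

end

text \<open>
  Finite linear combinations of kernel functions are given by lists of coefficients and points,
  so that adding two of them is appending lists.
\<close>

definition kernel_comb :: "('x \<Rightarrow> 'x \<Rightarrow> complex) \<Rightarrow> (complex \<times> 'x) list \<Rightarrow> 'x \<Rightarrow> complex"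
  where "kernel_comb K xs z = (\<Sum>(c, w)\<leftarrow>xs. c * K w z)"

text \<open>
  This is the inner product of \<open>f\<close> with \<open>kernel_comb K xs\<close> whenever \<open>f\<close> lies in the space.  It makes
  sense for every function \<open>f\<close> and involves neither the space nor its inner product.
\<close>

definition dual_comb :: "('x \<Rightarrow> complex) \<Rightarrow> (complex \<times> 'x) list \<Rightarrow> complex"
  where "dual_comb f xs = (\<Sum>(c, w)\<leftarrow>xs. cnj c * f w)"

lemma kernel_comb_simps:
  "kernel_comb K [] = (\<lambda>z. 0)"
  "kernel_comb K ((c, w) # xs) = (\<lambda>z. c * K w z + kernel_comb K xs z)"
  "kernel_comb K (xs @ ys) = (\<lambda>z. kernel_comb K xs z + kernel_comb K ys z)"
  "kernel_comb K (map (\<lambda>(c, w). (t * c, w)) xs) = (\<lambda>z. t * kernel_comb K xs z)"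
  by (auto simp: kernel_comb_def fun_eq_iff sum_list_const_mult[symmetric] o_def case_prod_beta mult.assoc)

lemma dual_comb_simps:
  "dual_comb f [] = 0"
  "dual_comb f ((c, w) # xs) = cnj c * f w + dual_comb f xs"
  "dual_comb f (xs @ ys) = dual_comb f xs + dual_comb f ys"
  "dual_comb f (map (\<lambda>(c, w). (t * c, w)) xs) = cnj t * dual_comb f xs"
  by (auto simp: dual_comb_def sum_list_const_mult[symmetric] o_def case_prod_beta mult.assoc)

definition combs :: "'x set \<Rightarrow> (complex \<times> 'x) list set"
  where "combs X = {xs. snd ` set xs \<subseteq> X}"

lemma combs_simps [simp]:
  "[] \<in> combs X" "(c, w) # xs \<in> combs X \<longleftrightarrow> w \<in> X \<and> xs \<in> combs X"
  "xs @ ys \<in> combs X \<longleftrightarrow> xs \<in> combs X \<and> ys \<in> combs X"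
  "map (\<lambda>(c, w). (t * c, w)) xs \<in> combs X \<longleftrightarrow> xs \<in> combs X"
  by (auto simp: combs_def image_subset_iff)

context rkhs
begin

sublocale semi_inner H ip
  by unfold_locales (fact add_mem scale_mem ip_add ip_scale ip_commute ip_nonneg)+

lemma kernel_comb_mem: "xs \<in> combs X \<Longrightarrow> kernel_comb K xs \<in> H"
proof (induction xs)
  case Nil show ?case by (simp add: kernel_comb_simps zero_mem)
next
  case (Cons a xs)
  then show ?case by (cases a) (simp add: kernel_comb_simps add_mem scale_mem kernel_mem)
qed

lemma ip_zero_right: assumes "f \<in> H" shows "ip f (\<lambda>x. 0) = 0"
  using ip_scale_right[OF zero_mem assms, of 0] by simp

lemma ip_kernel_comb: "f \<in> H \<Longrightarrow> xs \<in> combs X \<Longrightarrow> ip f (kernel_comb K xs) = dual_comb f xs"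
proof (induction xs)
  case Nil then show ?case by (simp add: kernel_comb_simps dual_comb_simps ip_zero_right)
next
  case (Cons a xs)
  then show ?case
    by (cases a) (simp add: kernel_comb_simps dual_comb_simps ip_add_right scale_mem kernel_mem
          kernel_comb_mem ip_scale_right reproducing[symmetric])
qed

lemma nrm_kernel_comb:
  "xs \<in> combs X \<Longrightarrow> (nrm (kernel_comb K xs))\<^sup>2 = Re (dual_comb (kernel_comb K xs) xs)"
  by (simp add: nrm_sq kernel_comb_mem ip_kernel_comb)

text \<open>
  The Riesz representation theorem for the functional that \<open>f\<close> induces on kernel combinations.
  The functional \<open>J = \<parallel>k\<parallel>\<^sup>2 - 2 Re (dual value)\<close> is bounded below on combinations \<open>k\<close>.  By the
  parallelogram law a minimising sequence is Cauchy, and its limit \<open>g\<close> satisfies \<open>g x = f x\<close> because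
  the first variation of \<open>J\<close> in the direction of the kernel at \<open>x\<close> vanishes.
\<close>

lemma mem_if_dual_bounded:
  assumes bd: "\<And>xs. xs \<in> combs X \<Longrightarrow> cmod (dual_comb f xs) \<le> C * nrm (kernel_comb K xs)"
  shows "f \<in> H"
proof -
  define J where "J xs = (nrm (kernel_comb K xs))\<^sup>2 - 2 * Re (dual_comb f xs)" for xs
  have Jlow: "- C\<^sup>2 \<le> J xs" if "xs \<in> combs X" for xs
  proof -
    have "Re (dual_comb f xs) \<le> C * nrm (kernel_comb K xs)"
      using bd[OF that] complex_Re_le_cmod order_trans by blast
    moreover have "0 \<le> (nrm (kernel_comb K xs) - C)\<^sup>2" by simp
    ultimately show ?thesis unfolding J_def by (simp add: power2_diff algebra_simps)
  qed
  define d where "d = Inf (J ` combs X)"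
  have bdd: "bdd_below (J ` combs X)" using Jlow by (auto intro!: bdd_belowI2)
  have ne: "J ` combs X \<noteq> {}" using combs_simps(1) by blast
  have dle: "d \<le> J xs" if "xs \<in> combs X" for xs
    unfolding d_def using bdd that by (auto intro: cInf_lower)
  have "\<exists>xs\<in>combs X. J xs < d + 1 / real (Suc n)" for n
    using cInf_lessD[OF ne, of "d + 1 / real (Suc n)"] unfolding d_def by auto
  then obtain xs where xs: "\<And>n. xs n \<in> combs X" "\<And>n. J (xs n) < d + 1 / real (Suc n)" by metis
  define G where "G n = kernel_comb K (xs n)" for n
  have GH: "G n \<in> H" for n unfolding G_def by (rule kernel_comb_mem) (rule xs)
  have cauchy: "(nrm (\<lambda>x. G m x - G n x))\<^sup>2 \<le> 2 / real (Suc m) + 2 / real (Suc n)" for m n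
  proof -
    \<comment> \<open>The midpoint of the two combinations competes in the minimisation.\<close>
    let ?ys = "map (\<lambda>(c, w). ((1/2) * c, w)) (xs m @ xs n)"
    have ys: "?ys \<in> combs X" using xs(1) combs_simps(3,4) by blast
    have k: "kernel_comb K ?ys = (\<lambda>x. (1/2) * (G m x + G n x))"
      by (simp only: kernel_comb_simps G_def)
    have "J ?ys = (nrm (\<lambda>x. (1/2) * (G m x + G n x)))\<^sup>2 - 2 * Re (dual_comb f ?ys)"
      unfolding J_def k by simp
    also have "nrm (\<lambda>x. (1/2) * (G m x + G n x)) = (1/2) * nrm (\<lambda>x. G m x + G n x)"
      using nrm_scale[OF add_mem[OF GH[of m] GH[of n]], of "1/2"] by simp
    also have "((1/2) * nrm (\<lambda>x. G m x + G n x))\<^sup>2 - 2 * Re (dual_comb f ?ys)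
      = (1/4) * (nrm (\<lambda>x. G m x + G n x))\<^sup>2 - Re (dual_comb f (xs m)) - Re (dual_comb f (xs n))"
      unfolding dual_comb_simps(3,4) by (simp add: power_divide field_simps)
    finally have "4 * J ?ys = (nrm (\<lambda>x. G m x + G n x))\<^sup>2
        - 4 * Re (dual_comb f (xs m)) - 4 * Re (dual_comb f (xs n))" by simp
    then have "(nrm (\<lambda>x. G m x - G n x))\<^sup>2 = 2 * J (xs m) + 2 * J (xs n) - 4 * J ?ys"
      using parallelogram[OF GH[of m] GH[of n]] unfolding J_def G_def by simp
    then show ?thesis using dle[OF ys] xs(2)[of m] xs(2)[of n] by simp
  qed
  have "\<exists>g\<in>H. (\<lambda>n. nrm (\<lambda>x. G n x - g x)) \<longlonglongrightarrow> 0"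
    unfolding nrm_def
  proof (rule complete[OF GH])
    fix e :: real assume "0 < e"
    then obtain N where N: "4 / real (Suc N) < e\<^sup>2"
      using reals_Archimedean[of "e\<^sup>2 / 4"] by (auto simp: field_simps)
    have "nrm (\<lambda>x. G m x - G n x) < e" if "m \<ge> N" "n \<ge> N" for m n
    proof -
      have "2 / real (Suc m) \<le> 2 / real (Suc N)" "2 / real (Suc n) \<le> 2 / real (Suc N)"
        using that by (auto intro!: divide_left_mono)
      then have "(nrm (\<lambda>x. G m x - G n x))\<^sup>2 < e\<^sup>2" using cauchy[of m n] N by simp
      then show ?thesis using \<open>0 < e\<close> by (simp add: power_less_imp_less_base)
    qed
    then show "\<exists>N. \<forall>m\<ge>N. \<forall>n\<ge>N. sqrt (Re (ip (\<lambda>x. G m x - G n x) (\<lambda>x. G m x - G n x))) < e"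
      unfolding nrm_def by blast
  qed
  then obtain g where g: "g \<in> H" and lim: "(\<lambda>n. nrm (\<lambda>x. G n x - g x)) \<longlonglongrightarrow> 0" by blast
  have pt: "(\<lambda>n. G n x) \<longlonglongrightarrow> g x" if x: "x \<in> X" for x
  proof (rule LIM_zero_cancel, rule tendsto_norm_zero_cancel, rule tendsto_sandwich[of "\<lambda>n. 0"])
    have "cmod (G n x - g x) \<le> nrm (\<lambda>x. G n x - g x) * nrm (K x)" for n
      using reproducing[OF diff_mem[OF GH g] x, of n]
        Cauchy_Schwarz[OF diff_mem[OF GH g] kernel_mem[OF x], of n] by simp
    then show "\<forall>\<^sub>F n in sequentially. cmod (G n x - g x) \<le> nrm (\<lambda>x. G n x - g x) * nrm (K x)" by simp
    show "(\<lambda>n. nrm (\<lambda>x. G n x - g x) * nrm (K x)) \<longlonglongrightarrow> 0"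
      using tendsto_mult_right[OF lim, of "nrm (K x)"] by simp
  qed auto
  have "g x = f x" if x: "x \<in> X" for x
  proof -
    have var: "0 \<le> 2 * Re (cnj t * (g x - f x)) + (cmod t)\<^sup>2 * (nrm (K x))\<^sup>2" for t
    proof (rule LIMSEQ_le[of "\<lambda>n. 0"])
      show "(\<lambda>n. 1 / real (Suc n) + (2 * Re (cnj t * (G n x - f x)) + (cmod t)\<^sup>2 * (nrm (K x))\<^sup>2))
        \<longlonglongrightarrow> 2 * Re (cnj t * (g x - f x)) + (cmod t)\<^sup>2 * (nrm (K x))\<^sup>2"
      proof -
        have "(\<lambda>n. 1 / real (Suc n)) \<longlonglongrightarrow> 0" by (rule LIMSEQ_Suc[OF lim_1_over_n])
        moreover have "(\<lambda>n. 2 * Re (cnj t * (G n x - f x)) + (cmod t)\<^sup>2 * (nrm (K x))\<^sup>2)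
            \<longlonglongrightarrow> 2 * Re (cnj t * (g x - f x)) + (cmod t)\<^sup>2 * (nrm (K x))\<^sup>2"
          by (intro tendsto_intros pt x)
        ultimately show ?thesis using tendsto_add by fastforce
      qed
      have "0 \<le> 1 / real (Suc n) + (2 * Re (cnj t * (G n x - f x)) + (cmod t)\<^sup>2 * (nrm (K x))\<^sup>2)" for n
      proof -
        let ?ys = "(t, x) # xs n"
        have "d \<le> J ?ys" using x xs(1) by (intro dle) simp
        also have "J ?ys = (nrm (\<lambda>z. G n z + t * K x z))\<^sup>2 - 2 * Re (cnj t * f x) - 2 * Re (dual_comb f (xs n))"
          unfolding J_def kernel_comb_simps dual_comb_simps G_def by (simp add: add.commute)
        also have "\<dots> = (nrm (G n))\<^sup>2 + 2 * Re (cnj t * G n x) + (cmod t)\<^sup>2 * (nrm (K x))\<^sup>2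
            - 2 * Re (cnj t * f x) - 2 * Re (dual_comb f (xs n))"
          using nrm_sq_add[OF GH[of n] scale_mem[OF kernel_mem[OF x], of t]] kernel_mem[OF x] GH[of n]
          by (simp add: ip_scale_right reproducing[OF GH x, symmetric] nrm_scale power_mult_distrib)
        also have "\<dots> = J (xs n) + 2 * Re (cnj t * (G n x - f x)) + (cmod t)\<^sup>2 * (nrm (K x))\<^sup>2"
          unfolding J_def G_def by (simp add: algebra_simps)
        finally show ?thesis using xs(2)[of n] by simp
      qed
      then show "\<exists>N. \<forall>n\<ge>N. 0 \<le> 1 / real (Suc n) + (2 * Re (cnj t * (G n x - f x)) + (cmod t)\<^sup>2 * (nrm (K x))\<^sup>2)"
        by blast
    qed simp
    define u where "u = g x - f x"
    define M where "M = (nrm (K x))\<^sup>2 + 1"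
    have M: "M > 0" "(nrm (K x))\<^sup>2 < 2 * M" by (auto simp: M_def intro: add_nonneg_pos add_pos_nonneg)
    \<comment> \<open>The variation is tested with a multiple of \<open>- u\<close> so small that its linear term outweighs the quadratic one.\<close>
    have "0 \<le> 2 * Re (cnj (- u / of_real M) * u) + (cmod (- u / of_real M))\<^sup>2 * (nrm (K x))\<^sup>2"
      using var[of "- u / of_real M"] unfolding u_def by simp
    also have "cnj (- u / of_real M) * u = - of_real ((cmod u)\<^sup>2 / M)"
      using complex_norm_square[of u] by (simp add: mult.commute)
    also have "(cmod (- u / of_real M))\<^sup>2 = (cmod u)\<^sup>2 / M\<^sup>2" using M by (simp add: norm_divide power_divide)
    finally have "2 * (cmod u)\<^sup>2 / M \<le> (cmod u)\<^sup>2 / M\<^sup>2 * (nrm (K x))\<^sup>2" by simp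
    then have "(cmod u)\<^sup>2 * (2 * M) \<le> (cmod u)\<^sup>2 * (nrm (K x))\<^sup>2"
      using M by (simp add: field_simps power2_eq_square)
    then have "(cmod u)\<^sup>2 \<le> 0" using M by (metis linorder_not_le mult_less_cancel_left_pos zero_less_power2 norm_eq_zero le_less)
    then show "g x = f x" by (simp add: u_def)
  qed
  then show ?thesis using cong_mem[OF g, of f] by simp
qed

text \<open>
  The right-hand side mentions only the kernel; hence the kernel determines the space.
\<close>

lemma mem_iff_dual_bounded:
  "f \<in> H \<longleftrightarrow> (\<exists>C. \<forall>xs\<in>combs X. cmod (dual_comb f xs)
      \<le> C * sqrt (Re (dual_comb (kernel_comb K xs) xs)))"
proof -
  have n: "sqrt (Re (dual_comb (kernel_comb K xs) xs)) = nrm (kernel_comb K xs)" if "xs \<in> combs X" for xs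
    using nrm_kernel_comb[OF that] nrm_nonneg[OF kernel_comb_mem[OF that]] by (metis real_sqrt_abs abs_of_nonneg)
  have "cmod (dual_comb f xs) \<le> nrm f * nrm (kernel_comb K xs)" if "f \<in> H" "xs \<in> combs X" for xs
    using Cauchy_Schwarz[OF that(1) kernel_comb_mem[OF that(2)]] that by (simp add: ip_kernel_comb)
  then show ?thesis using n mem_if_dual_bounded by (smt (verit, best) ball_cong)
qed

end

lemma rkhs_unique:
  assumes "rkhs X K H ip" "rkhs X K H' ip'"
  shows "H = H'"
  using rkhs.mem_iff_dual_bounded[OF assms(1)] rkhs.mem_iff_dual_bounded[OF assms(2)] by blast

section \<open>Integration over the circle and Taylor coefficients\<close>

interpretation circle: finite_measure circle_measure
  by standard (simp add: space_circle_measure emeasure_circle_measure)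

abbreviation circle_integral :: "(complex \<Rightarrow> 'a::{banach, second_countable_topology}) \<Rightarrow> 'a"
    (binder "CINT " 10)
  where "circle_integral F \<equiv> integral\<^sup>L circle_measure F"

lemma measure_circle [simp]: "measure circle_measure (sphere 0 1) = 1"
  by (simp add: measure_def emeasure_circle_measure)

lemma sets_circle_measure [measurable_cong]:
  "sets circle_measure = sets (restrict_space borel (sphere 0 1))"
  by (simp add: circle_measure_def)

lemma circle_measurable_if_continuous:
  fixes F :: "complex \<Rightarrow> 'b::topological_space"
  assumes "continuous_on (sphere 0 1) F"
  shows "F \<in> borel_measurable circle_measure"
  using borel_measurable_continuous_on_restrict[OF assms]
  by (simp cong: measurable_cong_sets add: sets_circle_measure)

lemma circle_integrable_if_bounded:
  fixes F :: "complex \<Rightarrow> 'b::{banach, second_countable_topology}"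
  assumes "F \<in> borel_measurable circle_measure" "\<And>\<zeta>. \<zeta> \<in> sphere 0 1 \<Longrightarrow> norm (F \<zeta>) \<le> B"
  shows "integrable circle_measure F"
  by (rule circle.integrable_const_bound[of _ B]) (use assms in \<open>auto simp: space_circle_measure\<close>)

lemma circle_integrable_if_continuous:
  fixes F :: "complex \<Rightarrow> 'b::{banach, second_countable_topology}"
  assumes "continuous_on (sphere 0 1) F"
  shows "integrable circle_measure F"
proof -
  have "bounded (F ` sphere 0 1)"
    using assms by (intro compact_imp_bounded compact_continuous_image) auto
  then obtain B where "\<forall>x\<in>F ` sphere 0 1. norm x \<le> B" unfolding bounded_iff by blast
  then show ?thesis
    by (intro circle_integrable_if_bounded[of _ B] circle_measurable_if_continuous assms) auto
qed

lemma circle_integral_parametrized: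
  fixes F :: "complex \<Rightarrow> complex"
  assumes F: "continuous_on (sphere 0 1) F"
  shows "((\<lambda>t. F (cis t)) has_integral of_real (2 * pi) * (CINT \<zeta>. F \<zeta>)) {0..2 * pi}"
proof -
  have meas: "(\<lambda>t. F (cis t)) \<in> borel_measurable borel"
    by (intro borel_measurable_continuous_onI continuous_on_compose2[OF F] continuous_intros) auto
  have "(CINT \<zeta>. F \<zeta>) = (LINT t|uniform_measure lborel {0..2 * pi}. F (cis t))"
    unfolding circle_measure_def
    using circle_measurable_if_continuous[OF F] cis_measurable_circle
    by (intro integral_distr) (simp_all add: circle_measure_def)
  also have "uniform_measure lborel {0..2 * pi} = density lborel (\<lambda>t. ennreal (indicator {0..2 * pi} t / (2 * pi)))"
    unfolding uniform_measure_def
    by (intro arg_cong2[where f = density] refl ext)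
       (auto simp: indicator_def divide_ennreal simp flip: ennreal_1)
  also have "(LINT t|\<dots>. F (cis t)) = (LINT t|lborel. (indicator {0..2 * pi} t / (2 * pi)) *\<^sub>R F (cis t))"
    using meas by (intro integral_density) auto
  also have "\<dots> = (1 / (2 * pi)) *\<^sub>R (LINT t|lborel. indicator {0..2 * pi} t *\<^sub>R F (cis t))"
    by (simp flip: integral_scaleR_right)
  also have "(LINT t|lborel. indicator {0..2 * pi} t *\<^sub>R F (cis t)) = integral {0..2 * pi} (\<lambda>t. F (cis t))"
  proof -
    have "set_integrable lborel {0..2 * pi} (\<lambda>t. F (cis t))"
      unfolding set_integrable_def
      by (rule borel_integrable_compact) (auto intro!: continuous_on_compose2[OF F] continuous_intros)
    then show ?thesis using set_borel_integral_eq_integral(2)[of "{0..2*pi}" "\<lambda>t. F (cis t)"]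
      by (simp add: set_lebesgue_integral_def)
  qed
  finally have "of_real (2 * pi) * (CINT \<zeta>. F \<zeta>) = integral {0..2 * pi} (\<lambda>t. F (cis t))"
    by (simp add: scaleR_conv_of_real)
  moreover have "(\<lambda>t. F (cis t)) integrable_on {0..2 * pi}"
    by (intro integrable_continuous_interval continuous_on_compose2[OF F] continuous_intros) auto
  ultimately show ?thesis by (simp add: has_integral_integral)
qed

text \<open>
  In the angle, both sides are integrals of one periodic function over intervals of length \<open>2 \<pi>\<close>.
\<close>

lemma circle_integral_rotation:
  fixes F :: "complex \<Rightarrow> complex"
  assumes F: "continuous_on (sphere 0 1) F" and \<eta>: "\<eta> \<in> sphere 0 1"
  shows "(CINT \<zeta>. F (\<zeta> * \<eta>)) = (CINT \<zeta>. F \<zeta>)"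
proof -
  obtain s where s: "0 \<le> s" "s < 2 * pi" "\<eta> = cis s"
    using complex_unimodular_polar[of \<eta>] \<eta> by (metis cis.ctr mem_sphere_0)
  define G where "G t = F (cis t)" for t
  have cG: "continuous_on A G" for A unfolding G_def
    by (intro continuous_on_compose2[OF F] continuous_intros) auto
  have iG: "G integrable_on {u..v}" for u v by (intro integrable_continuous_interval cG)
  have per: "G (t + 2 * pi) = G t" for t by (simp add: G_def cis.ctr)
  have Fr: "continuous_on (sphere 0 1) (\<lambda>\<zeta>. F (\<zeta> * \<eta>))"
    by (intro continuous_on_compose2[OF F] continuous_intros) (use \<eta> in \<open>auto simp: norm_mult\<close>)
  have "((\<lambda>t. F (cis t * \<eta>)) has_integral of_real (2 * pi) * (CINT \<zeta>. F (\<zeta> * \<eta>))) {0..2 * pi}"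
    by (rule circle_integral_parametrized[OF Fr])
  moreover have "(\<lambda>t. F (cis t * \<eta>)) = (\<lambda>t. G (t + s))" by (simp add: G_def s cis_mult)
  ultimately have 1: "of_real (2 * pi) * (CINT \<zeta>. F (\<zeta> * \<eta>)) = integral {0..2 * pi} (\<lambda>t. G (t + s))"
    by (simp add: integral_unique)
  have shift: "integral {u..v} (\<lambda>t. G (t + w)) = integral {u + w..v + w} G" for u v w
    using integral_shift_real_ivl[of "u+w" w "v+w" G] by simp
  have 2: "of_real (2 * pi) * (CINT \<zeta>. F \<zeta>) = integral {0..2 * pi} G"
    using circle_integral_parametrized[OF F] unfolding G_def by (simp add: integral_unique)
  have "integral {0..s} G + integral {s..2 * pi + s} G = integral {0..2 * pi + s} G"
    using s iG by (intro Henstock_Kurzweil_Integration.integral_combine) auto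
  moreover have "integral {0..2 * pi} G + integral {2 * pi..2 * pi + s} G = integral {0..2 * pi + s} G"
    using s iG by (intro Henstock_Kurzweil_Integration.integral_combine) auto
  moreover have "integral {2 * pi..2 * pi + s} G = integral {0..s} G"
    using shift[of 0 s "2 * pi"] per by (simp add: add.commute)
  ultimately have "integral {s..2 * pi + s} G = integral {0..2 * pi} G" by (metis add.commute add_left_cancel)
  then have "of_real (2 * pi) * (CINT \<zeta>. F (\<zeta> * \<eta>)) = of_real (2 * pi) * (CINT \<zeta>. F \<zeta>)"
    using 1 2 shift[of 0 "2 * pi" s] by simp
  then show ?thesis by simp
qed

text \<open>
  A rotation by the angle \<open>\<pi> / (n - m)\<close> multiplies the integrand by \<open>-1\<close>.
\<close>

lemma circle_orthogonality:
  "(CINT \<zeta>. \<zeta> ^ n * cnj (\<zeta> ^ m)) = (if n = m then 1 else 0)"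
proof (cases "n = m")
  case True
  have "(CINT \<zeta>. \<zeta> ^ n * cnj (\<zeta> ^ n)) = (CINT \<zeta>. 1)"
    by (intro Bochner_Integration.integral_cong refl)
       (simp add: space_circle_measure power_mult_distrib[symmetric] complex_norm_square[symmetric])
  then show ?thesis using True by (simp add: space_circle_measure)
next
  case False
  define \<theta> where "\<theta> = pi / (real n - real m)"
  define I where "I = (CINT \<zeta>. \<zeta> ^ n * cnj (\<zeta> ^ m))"
  have "(real n - real m) * \<theta> = pi" using False by (simp add: \<theta>_def)
  then have "real n * \<theta> + - (real m * \<theta>) = pi" by (simp add: left_diff_distrib)
  then have e: "cis \<theta> ^ n * cnj (cis \<theta> ^ m) = -1"
    by (simp add: Complex.DeMoivre cis_cnj cis_mult del: complex_cnj_power)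
  have "I = (CINT \<zeta>. (\<zeta> * cis \<theta>) ^ n * cnj ((\<zeta> * cis \<theta>) ^ m))"
    unfolding I_def by (rule circle_integral_rotation[symmetric]) (auto intro!: continuous_intros)
  also have "\<dots> = (CINT \<zeta>. (cis \<theta> ^ n * cnj (cis \<theta> ^ m)) * (\<zeta> ^ n * cnj (\<zeta> ^ m)))"
    by (simp add: power_mult_distrib mult_ac)
  also have "\<dots> = - I" unfolding e I_def by simp
  finally have "I = 0" by simp
  then show ?thesis using False by (simp add: I_def)
qed

definition coef :: "(complex \<Rightarrow> complex) \<Rightarrow> nat \<Rightarrow> complex"
  where "coef f n = (deriv ^^ n) f 0 / fact n"

text \<open>
  Power series with given coefficients; outside the disk of convergence the value is arbitrary.
\<close>

definition powser :: "(nat \<Rightarrow> complex) \<Rightarrow> complex \<Rightarrow> complex"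
  where "powser x z = (\<Sum>n. x n * z ^ n)"

lemma coef_sums:
  assumes "f holomorphic_on unit_disk" "z \<in> unit_disk"
  shows "(\<lambda>n. coef f n * z ^ n) sums f z"
  using holomorphic_power_series[of f 0 1 z] assms by (simp add: coef_def)

lemma summable_norm_if_sums_disk:
  fixes x :: "nat \<Rightarrow> complex"
  assumes x: "\<And>z. z \<in> unit_disk \<Longrightarrow> summable (\<lambda>n. x n * z ^ n)" and r: "0 \<le> r" "r < (1::real)"
  shows "summable (\<lambda>n. cmod (x n) * r ^ n)"
proof -
  obtain s where s: "r < s" "s < 1" using dense[OF r(2)] by blast
  have "summable (\<lambda>n. norm (x n * (of_real r) ^ n))"
    by (rule powser_insidea[OF x[of "of_real s"]]) (use r s in auto)
  then show ?thesis using r by (simp add: norm_mult norm_power)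
qed

text \<open>
  Both power series converge absolutely on the circle of radius \<open>r\<close>, so their partial sums are
  dominated by constants and orthogonality passes to the limit.  The coefficients \<open>x\<close> and \<open>y\<close> are
  not assumed to be Taylor coefficients; therefore the formula also yields their uniqueness.
\<close>

lemma parseval_sums:
  assumes f: "\<And>z. z \<in> unit_disk \<Longrightarrow> (\<lambda>n. x n * z ^ n) sums f z"
    and g: "\<And>z. z \<in> unit_disk \<Longrightarrow> (\<lambda>n. y n * z ^ n) sums g z"
    and r: "0 \<le> r" "r < 1"
  shows "(\<lambda>n. x n * cnj (y n) * of_real (r ^ (2 * n))) sums
    (CINT \<zeta>. f (of_real r * \<zeta>) * cnj (g (of_real r * \<zeta>)))"
proof -
  define S where "S N \<zeta> = (\<Sum>n<N. x n * (of_real r * \<zeta>) ^ n)" for N \<zeta>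
  define T where "T N \<zeta> = (\<Sum>n<N. y n * (of_real r * \<zeta>) ^ n)" for N \<zeta>
  define A where "A = (\<Sum>n. cmod (x n) * r ^ n)"
  define B where "B = (\<Sum>n. cmod (y n) * r ^ n)"
  have sx: "summable (\<lambda>n. cmod (x n) * r ^ n)"
    by (rule summable_norm_if_sums_disk) (use f r sums_summable in blast)+
  have sy: "summable (\<lambda>n. cmod (y n) * r ^ n)"
    by (rule summable_norm_if_sums_disk) (use g r sums_summable in blast)+
  have in_disk: "of_real r * \<zeta> \<in> unit_disk" if "\<zeta> \<in> sphere 0 1" for \<zeta>
    using that r by (simp add: norm_mult)
  have "norm (S N \<zeta>) \<le> A" if "\<zeta> \<in> sphere 0 1" for N \<zeta>
  proof -
    have "norm (S N \<zeta>) \<le> (\<Sum>n<N. cmod (x n) * r ^ n)"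
      unfolding S_def by (rule order_trans[OF norm_sum]) (use that r in \<open>simp add: norm_mult norm_power\<close>)
    also have "\<dots> \<le> A" unfolding A_def using sx r by (intro sum_le_suminf) auto
    finally show ?thesis .
  qed
  moreover have "norm (T N \<zeta>) \<le> B" if "\<zeta> \<in> sphere 0 1" for N \<zeta>
  proof -
    have "norm (T N \<zeta>) \<le> (\<Sum>n<N. cmod (y n) * r ^ n)"
      unfolding T_def by (rule order_trans[OF norm_sum]) (use that r in \<open>simp add: norm_mult norm_power\<close>)
    also have "\<dots> \<le> B" unfolding B_def using sy r by (intro sum_le_suminf) auto
    finally show ?thesis .
  qed
  moreover have A0: "0 \<le> A" unfolding A_def using r sx by (intro suminf_nonneg) auto
  ultimately have bd: "norm (S N \<zeta> * cnj (T N \<zeta>)) \<le> A * B" if "\<zeta> \<in> sphere 0 1" for N \<zeta>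
    using that by (simp add: norm_mult mult_mono)
  have contS: "continuous_on (sphere 0 1) (S N)" and contT: "continuous_on (sphere 0 1) (T N)" for N
    unfolding S_def T_def by (intro continuous_intros)+
  have limS: "(\<lambda>N. S N \<zeta>) \<longlonglongrightarrow> f (of_real r * \<zeta>)" and limT: "(\<lambda>N. T N \<zeta>) \<longlonglongrightarrow> g (of_real r * \<zeta>)"
    if "\<zeta> \<in> sphere 0 1" for \<zeta>
    using f[OF in_disk[OF that]] g[OF in_disk[OF that]] unfolding S_def T_def sums_def by auto
  have meas: "(\<lambda>\<zeta>. S N \<zeta> * cnj (T N \<zeta>)) \<in> borel_measurable circle_measure" for N
    by (intro circle_measurable_if_continuous continuous_intros contS contT)
  have pt: "(\<lambda>N. S N \<zeta> * cnj (T N \<zeta>)) \<longlonglongrightarrow> f (of_real r * \<zeta>) * cnj (g (of_real r * \<zeta>))"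
    if "\<zeta> \<in> sphere 0 1" for \<zeta>
    using that by (intro tendsto_intros limS limT)
  have "(\<lambda>N. CINT \<zeta>. S N \<zeta> * cnj (T N \<zeta>))
      \<longlonglongrightarrow> (CINT \<zeta>. f (of_real r * \<zeta>) * cnj (g (of_real r * \<zeta>)))"
  proof (rule integral_dominated_convergence[where w = "\<lambda>_. A * B"])
    show "(\<lambda>\<zeta>. f (of_real r * \<zeta>) * cnj (g (of_real r * \<zeta>))) \<in> borel_measurable circle_measure"
      by (rule borel_measurable_LIMSEQ_metric[of "\<lambda>N \<zeta>. S N \<zeta> * cnj (T N \<zeta>)"])
        (use meas pt in \<open>auto simp: space_circle_measure\<close>)
  qed (use meas bd pt in \<open>auto simp: space_circle_measure\<close>)
  moreover have "(CINT \<zeta>. S N \<zeta> * cnj (T N \<zeta>)) = (\<Sum>n<N. x n * cnj (y n) * of_real (r ^ (2 * n)))" for N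
  proof -
    have int: "integrable circle_measure (\<lambda>\<zeta>. c * (\<zeta> ^ n * cnj (\<zeta> ^ m)))" for c n m
      by (intro circle_integrable_if_continuous continuous_intros)
    have "(CINT \<zeta>. S N \<zeta> * cnj (T N \<zeta>)) = (CINT \<zeta>. (\<Sum>n<N. \<Sum>m<N.
        (x n * cnj (y m) * of_real (r ^ n * r ^ m)) * (\<zeta> ^ n * cnj (\<zeta> ^ m))))"
      unfolding S_def T_def cnj_sum sum_product
      by (intro Bochner_Integration.integral_cong refl sum.cong) (simp add: power_mult_distrib mult_ac)
    also have "\<dots> = (\<Sum>n<N. \<Sum>m<N. LINT \<zeta>|circle_measure.
        (x n * cnj (y m) * of_real (r ^ n * r ^ m)) * (\<zeta> ^ n * cnj (\<zeta> ^ m)))"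
      by (simp only: Bochner_Integration.integral_sum Bochner_Integration.integrable_sum int)
    also have "\<dots> = (\<Sum>n<N. \<Sum>m<N. (x n * cnj (y m) * of_real (r ^ n * r ^ m)) * (if n = m then 1 else 0))"
      by (simp only: Bochner_Integration.integral_mult_right_zero circle_orthogonality)
    also have "\<dots> = (\<Sum>n<N. x n * cnj (y n) * of_real (r ^ (2 * n)))"
      by (intro sum.cong refl) (simp add: if_distrib[where f = "\<lambda>c. _ * c"] sum.delta mult_2 power_add cong: if_cong)
    finally show ?thesis .
  qed
  ultimately show ?thesis unfolding sums_def by simp
qed

lemma monomial_sums: "(\<lambda>n. (if n = k then 1 else 0) * z ^ n) sums (z ^ k :: complex)"
  using sums_single[of k "\<lambda>n. z ^ n"] by (simp add: if_distrib[where f = "\<lambda>c. c * _"] cong: if_cong)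

text \<open>
  By Parseval's formula the coefficient \<open>x k\<close> is determined by the integral of \<open>f\<close> against the \<open>k\<close>-th
  power over the circle of radius \<open>1/2\<close>.
\<close>

lemma coef_unique:
  assumes x: "\<And>z. z \<in> unit_disk \<Longrightarrow> (\<lambda>n. x n * z ^ n) sums f z"
    and y: "\<And>z. z \<in> unit_disk \<Longrightarrow> (\<lambda>n. y n * z ^ n) sums f z"
  shows "x = y"
proof
  fix k
  define e :: "nat \<Rightarrow> complex" where "e n = (if n = k then 1 else 0 :: complex)" for n
  have e: "(\<lambda>n. e n * z ^ n) sums z ^ k" for z
    unfolding e_def by (rule monomial_sums)
  have "(\<lambda>n. w n * cnj (e n) * of_real ((1/2) ^ (2 * n))) sums (w k * of_real ((1/2) ^ (2 * k)))" for w
    using sums_single[of k "\<lambda>n. w n * of_real ((1/2) ^ (2 * n))"]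
    unfolding e_def by (rule sums_cong[THEN iffD1, rotated]) auto
  from sums_unique2[OF this parseval_sums[OF x e, of "1/2"]] sums_unique2[OF this parseval_sums[OF y e, of "1/2"]]
  have "x k * of_real ((1/2) ^ (2 * k)) = y k * of_real ((1/2) ^ (2 * k))" by simp
  then show "x k = y k" by simp
qed

lemma coef_eqI:
  assumes "\<And>z. z \<in> unit_disk \<Longrightarrow> (\<lambda>n. x n * z ^ n) sums f z"
  shows "coef f = x" "f holomorphic_on unit_disk"
proof -
  show "f holomorphic_on unit_disk"
    by (rule power_series_holomorphic[of 0 1 x]) (use assms in simp)
  then show "coef f = x" using assms coef_sums coef_unique by blast
qed

section \<open>The Hardy space of square-summable Taylor coefficients\<close>

lemma coef_cong:
  assumes "\<And>z. z \<in> unit_disk \<Longrightarrow> f z = g z"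
  shows "coef f = coef g"
proof
  fix n
  have "\<forall>\<^sub>F z in nhds 0. f z = g z"
    by (rule eventually_nhds_in_open[of unit_disk, THEN eventually_mono]) (use assms in auto)
  then show "coef f n = coef g n"
    unfolding coef_def by (subst higher_deriv_cong_ev[OF _ refl]) auto
qed

lemma coef_add:
  assumes "f holomorphic_on unit_disk" "g holomorphic_on unit_disk"
  shows "coef (\<lambda>z. f z + g z) = (\<lambda>n. coef f n + coef g n)"
  by (rule coef_eqI) (use assms in \<open>auto simp: distrib_right intro!: sums_add coef_sums\<close>)

lemma coef_scale:
  assumes "f holomorphic_on unit_disk"
  shows "coef (\<lambda>z. c * f z) = (\<lambda>n. c * coef f n)"
  by (rule coef_eqI) (use assms in \<open>auto simp: mult.assoc intro!: sums_mult coef_sums\<close>)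

text \<open>
  The Hardy space with exponent \<open>2\<close>, described by Taylor coefficients.
\<close>

definition H2 :: "(complex \<Rightarrow> complex) set"
  where "H2 = {f. f holomorphic_on unit_disk \<and> summable (\<lambda>n. (cmod (coef f n))\<^sup>2)}"

definition ip2 :: "(complex \<Rightarrow> complex) \<Rightarrow> (complex \<Rightarrow> complex) \<Rightarrow> complex"
  where "ip2 f g = (\<Sum>n. coef f n * cnj (coef g n))"

lemma summable_mult_if_summable_squares:
  fixes x y :: "nat \<Rightarrow> complex"
  assumes "summable (\<lambda>n. (cmod (x n))\<^sup>2)" "summable (\<lambda>n. (cmod (y n))\<^sup>2)"
  shows "summable (\<lambda>n. cmod (x n * cnj (y n)))"
proof (rule summable_comparison_test)
  have "cmod (x n * cnj (y n)) \<le> (cmod (x n))\<^sup>2 + (cmod (y n))\<^sup>2" for n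
    using sum_squares_bound[of "cmod (x n)" "cmod (y n)"]
      mult_nonneg_nonneg[OF norm_ge_zero norm_ge_zero, of "x n" "y n"] unfolding norm_mult complex_mod_cnj mult.assoc by linarith
  then show "\<exists>N. \<forall>n\<ge>N. norm (cmod (x n * cnj (y n))) \<le> (cmod (x n))\<^sup>2 + (cmod (y n))\<^sup>2" by simp
  show "summable (\<lambda>n. (cmod (x n))\<^sup>2 + (cmod (y n))\<^sup>2)" by (intro summable_add assms)
qed

lemma summable_ip2:
  assumes "f \<in> H2" "g \<in> H2"
  shows "summable (\<lambda>n. coef f n * cnj (coef g n))"
  using assms unfolding H2_def
  by (intro summable_norm_cancel[OF summable_mult_if_summable_squares]) auto

lemma holomorphic_if_H2: "f \<in> H2 \<Longrightarrow> f holomorphic_on unit_disk"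
  by (simp add: H2_def)

lemma H2_add:
  assumes "f \<in> H2" "g \<in> H2" shows "(\<lambda>z. f z + g z) \<in> H2"
proof -
  have "summable (\<lambda>n. (cmod (coef f n + coef g n))\<^sup>2)"
  proof (rule summable_comparison_test)
    have "(cmod (coef f n + coef g n))\<^sup>2 \<le> 2 * (cmod (coef f n))\<^sup>2 + 2 * (cmod (coef g n))\<^sup>2" for n
    proof -
      have "(cmod (coef f n + coef g n))\<^sup>2 \<le> (cmod (coef f n) + cmod (coef g n))\<^sup>2"
        by (intro power_mono norm_triangle_ineq) auto
      also have "\<dots> \<le> 2 * (cmod (coef f n))\<^sup>2 + 2 * (cmod (coef g n))\<^sup>2"
        using sum_squares_bound[of "cmod (coef f n)" "cmod (coef g n)"] by (simp add: power2_sum)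
      finally show ?thesis .
    qed
    then show "\<exists>N. \<forall>n\<ge>N. norm ((cmod (coef f n + coef g n))\<^sup>2) \<le> 2 * (cmod (coef f n))\<^sup>2 + 2 * (cmod (coef g n))\<^sup>2" by simp
    show "summable (\<lambda>n. 2 * (cmod (coef f n))\<^sup>2 + 2 * (cmod (coef g n))\<^sup>2)"
      using assms by (intro summable_add summable_mult) (auto simp: H2_def)
  qed
  then show ?thesis using assms by (auto simp: H2_def coef_add intro!: holomorphic_intros)
qed

lemma H2_scale: "f \<in> H2 \<Longrightarrow> (\<lambda>z. c * f z) \<in> H2"
  by (auto simp: H2_def coef_scale norm_mult power_mult_distrib intro!: holomorphic_intros summable_mult)

interpretation H2: semi_inner H2 ip2
proof
  fix f g h :: "complex \<Rightarrow> complex" and c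
  assume f: "f \<in> H2"
  show "(\<lambda>x. c * f x) \<in> H2" by (rule H2_scale[OF f])
  have "ip2 f f = (\<Sum>n. of_real ((cmod (coef f n))\<^sup>2))"
    unfolding ip2_def by (intro suminf_cong) (simp add: complex_norm_square[symmetric])
  also have "\<dots> = of_real (\<Sum>n. (cmod (coef f n))\<^sup>2)"
    using f by (intro suminf_of_real[symmetric]) (simp add: H2_def)
  finally show "0 \<le> Re (ip2 f f)" using f by (simp add: H2_def suminf_nonneg)
  assume g: "g \<in> H2"
  show "(\<lambda>x. f x + g x) \<in> H2" by (rule H2_add[OF f g])
  show "ip2 (\<lambda>x. c * f x) g = c * ip2 f g"
    unfolding ip2_def coef_scale[OF holomorphic_if_H2[OF f]]
    using suminf_mult[OF summable_ip2[OF f g], of c] by (simp add: mult.assoc)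
  show "ip2 g f = cnj (ip2 f g)"
    unfolding ip2_def using sums_cnj[THEN iffD2, OF summable_sums[OF summable_ip2[OF f g]]]
    by (simp add: sums_iff mult.commute)
  assume h: "h \<in> H2"
  show "ip2 (\<lambda>x. f x + g x) h = ip2 f h + ip2 g h"
    unfolding ip2_def coef_add[OF holomorphic_if_H2[OF f] holomorphic_if_H2[OF g]]
    using suminf_add[OF summable_ip2[OF f h] summable_ip2[OF g h]] by (simp add: distrib_right)
qed

lemma H2_nrm_sums:
  assumes "f \<in> H2"
  shows "(\<lambda>n. (cmod (coef f n))\<^sup>2) sums (H2.nrm f)\<^sup>2"
proof -
  have "ip2 f f = (\<Sum>n. of_real ((cmod (coef f n))\<^sup>2))"
    unfolding ip2_def by (intro suminf_cong) (simp add: complex_norm_square[symmetric])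
  also have "\<dots> = of_real (\<Sum>n. (cmod (coef f n))\<^sup>2)"
    using assms by (intro suminf_of_real[symmetric]) (simp add: H2_def)
  finally show ?thesis using assms by (simp add: H2.nrm_sq sums_iff H2_def)
qed

lemma H2_cong: "f \<in> H2 \<Longrightarrow> (\<And>z. z \<in> unit_disk \<Longrightarrow> g z = f z) \<Longrightarrow> g \<in> H2"
  using coef_cong[of g f] holomorphic_cong[of unit_disk unit_disk g f] by (auto simp: H2_def)

lemma ip2_cong:
  assumes "\<And>z. z \<in> unit_disk \<Longrightarrow> f z = f' z" "\<And>z. z \<in> unit_disk \<Longrightarrow> g z = g' z"
  shows "ip2 f g = ip2 f' g'"
  using coef_cong[of f f'] coef_cong[of g g'] assms by (simp add: ip2_def)

lemma sum_coef_le_nrm: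
  assumes "f \<in> H2" "finite A"
  shows "(\<Sum>n\<in>A. (cmod (coef f n))\<^sup>2) \<le> (H2.nrm f)\<^sup>2"
  unfolding sums_unique[OF H2_nrm_sums[OF assms(1)]]
  by (rule sum_le_suminf[OF sums_summable[OF H2_nrm_sums[OF assms(1)]] assms(2)]) simp

lemma coef_le_nrm:
  assumes "f \<in> H2" shows "cmod (coef f n) \<le> H2.nrm f"
proof -
  have "(cmod (coef f n))\<^sup>2 = (\<Sum>k\<in>{n}. (cmod (coef f k))\<^sup>2)" by simp
  also have "\<dots> \<le> (H2.nrm f)\<^sup>2"
    by (rule sum_coef_le_nrm[OF assms]) simp
  finally show ?thesis by (rule power2_le_imp_le) (rule H2.nrm_nonneg[OF assms])
qed

lemma powser_sums_if_bounded:
  assumes "\<And>n. cmod (x n) \<le> B" "z \<in> unit_disk"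
  shows "(\<lambda>n. x n * z ^ n) sums powser x z"
proof -
  have "summable (\<lambda>n. x n * z ^ n)"
  proof (rule summable_comparison_test)
    show "\<exists>N. \<forall>n\<ge>N. norm (x n * z ^ n) \<le> B * cmod z ^ n"
      using assms(1) by (auto simp: norm_mult norm_power intro!: mult_right_mono)
    show "summable (\<lambda>n. B * cmod z ^ n)"
      using assms(2) by (intro summable_mult summable_geometric) auto
  qed
  then show ?thesis unfolding powser_def by (rule summable_sums)
qed

lemma powser_H2:
  assumes "\<And>K. (\<Sum>n<K. (cmod (x n))\<^sup>2) \<le> B\<^sup>2" "0 \<le> B"
  shows "powser x \<in> H2" "coef (powser x) = x" "H2.nrm (powser x) \<le> B"
proof -
  have "cmod (x n) \<le> B" for n
  proof -
    have "(cmod (x n))\<^sup>2 = (\<Sum>k\<in>{n}. (cmod (x k))\<^sup>2)" by simp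
    also have "\<dots> \<le> (\<Sum>k<Suc n. (cmod (x k))\<^sup>2)" by (intro sum_mono2) auto
    finally show ?thesis using assms(1)[of "Suc n"] assms(2) by (meson order_trans power2_le_imp_le)
  qed
  note s = powser_sums_if_bounded[OF this]
  show c: "coef (powser x) = x" by (rule coef_eqI[OF s])
  have "summable (\<lambda>n. (cmod (x n))\<^sup>2)"
    by (rule summableI_nonneg_bounded[where x = "B\<^sup>2"]) (use assms in auto)
  then show H: "powser x \<in> H2" using coef_eqI(2)[OF s] by (simp add: H2_def c)
  have "(H2.nrm (powser x))\<^sup>2 \<le> B\<^sup>2"
    using H2_nrm_sums[OF H] assms(1) unfolding c sums_def
    by (intro LIMSEQ_le_const2) auto
  then show "H2.nrm (powser x) \<le> B" using assms(2) by (rule power2_le_imp_le)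
qed

lemma coef_polynomial:
  "coef (\<lambda>z. \<Sum>k<K. c k * z ^ k) = (\<lambda>k. if k < K then c k else 0)"
proof (rule coef_eqI)
  fix z :: complex
  show "(\<lambda>n. (if n < K then c n else 0) * z ^ n) sums (\<Sum>k<K. c k * z ^ k)"
    using sums_If_finite[of "\<lambda>n. n < K" "\<lambda>n. c n * z ^ n"]
    by (simp add: if_distrib[where f = "\<lambda>c. c * _"] lessThan_def cong: if_cong)
qed

lemma H2_polynomial: "(\<lambda>z. \<Sum>k<K. c k * z ^ k) \<in> H2"
proof -
  have "summable (\<lambda>n. (cmod (if n < K then c n else 0))\<^sup>2)"
    by (rule summable_finite[of "{..<K}"]) auto
  then show ?thesis by (auto simp: H2_def coef_polynomial intro!: holomorphic_intros)
qed

lemma coef_diff: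
  assumes "f \<in> H2" "g \<in> H2"
  shows "coef (\<lambda>z. f z - g z) n = coef f n - coef g n"
  using coef_add[of f "\<lambda>z. (-1) * g z"] coef_scale[of g "-1"] assms
  by (simp add: H2_def holomorphic_on_minus)

lemma H2_approx_polynomial:
  assumes g: "g \<in> H2"
  shows "(\<lambda>K. H2.nrm (\<lambda>z. g z - (\<Sum>k<K. coef g k * z ^ k))) \<longlonglongrightarrow> 0"
proof -
  define d where "d K = (\<lambda>z. g z - (\<Sum>k<K. coef g k * z ^ k))" for K
  have d: "d K \<in> H2" for K unfolding d_def by (intro H2.diff_mem g H2_polynomial)
  have cd: "coef (d K) = (\<lambda>k. if k < K then 0 else coef g k)" for K
    unfolding d_def fun_eq_iff coef_diff[OF g H2_polynomial] coef_polynomial by simp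
  have "(H2.nrm (d K))\<^sup>2 = (H2.nrm g)\<^sup>2 - (\<Sum>k<K. (cmod (coef g k))\<^sup>2)" for K
  proof -
    have "(\<lambda>k. (cmod (coef g k))\<^sup>2 - (if k < K then (cmod (coef g k))\<^sup>2 else 0)) sums
      ((H2.nrm g)\<^sup>2 - (\<Sum>k<K. (cmod (coef g k))\<^sup>2))"
      using sums_If_finite[of "\<lambda>n. n < K" "\<lambda>n. (cmod (coef g n))\<^sup>2"]
      by (intro sums_diff H2_nrm_sums g) (simp add: lessThan_def)
    then have "(\<lambda>k. (cmod (coef (d K) k))\<^sup>2) sums ((H2.nrm g)\<^sup>2 - (\<Sum>k<K. (cmod (coef g k))\<^sup>2))"
      unfolding cd by (rule sums_cong[THEN iffD1, rotated]) auto
    then show ?thesis using H2_nrm_sums[OF d, of K] sums_unique2 by blast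
  qed
  then have "(\<lambda>K. (H2.nrm (d K))\<^sup>2) \<longlonglongrightarrow> (H2.nrm g)\<^sup>2 - (H2.nrm g)\<^sup>2"
    by (simp only:) (intro tendsto_diff tendsto_const H2_nrm_sums[OF g, unfolded sums_def])
  then have "(\<lambda>K. sqrt ((H2.nrm (d K))\<^sup>2)) \<longlonglongrightarrow> sqrt 0" by (intro tendsto_real_sqrt) simp
  then show ?thesis using H2.nrm_nonneg[OF d] by (simp add: d_def)
qed

lemma ip2_polynomial: "ip2 f (\<lambda>z. \<Sum>k<K. c k * z ^ k) = (\<Sum>k<K. coef f k * cnj (c k))"
proof -
  have "(\<lambda>n. coef f n * cnj (if n < K then c n else 0)) sums (\<Sum>k<K. coef f k * cnj (c k))"
    using sums_If_finite[of "\<lambda>n. n < K" "\<lambda>n. coef f n * cnj (c n)"]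
    by (simp add: if_distrib[where f = cnj] if_distrib[where f = "\<lambda>c. _ * c"] lessThan_def cong: if_cong)
  then show ?thesis unfolding ip2_def coef_polynomial by (rule sums_unique[symmetric])
qed

text \<open>
  A bounded sequence whose Taylor coefficients converge is weakly convergent: the truncation of \<open>g\<close>
  at a high degree leaves a remainder of small norm, and for the truncated \<open>g\<close> only finitely many
  coefficients matter.
\<close>

lemma H2_weak_limit:
  assumes F: "\<And>n. F n \<in> H2" and B: "\<And>n. H2.nrm (F n) \<le> B"
    and lim: "\<And>k. (\<lambda>n. coef (F n) k) \<longlonglongrightarrow> x k"
  shows "powser x \<in> H2" "coef (powser x) = x" "H2.nrm (powser x) \<le> B"
    and "\<And>g. g \<in> H2 \<Longrightarrow> (\<lambda>n. ip2 (F n) g) \<longlonglongrightarrow> ip2 (powser x) g"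
proof -
  have B0: "0 \<le> B" using H2.nrm_nonneg[OF F] B order_trans by blast
  have "(\<Sum>k<K. (cmod (x k))\<^sup>2) \<le> B\<^sup>2" for K
  proof (rule LIMSEQ_le_const2)
    show "(\<lambda>n. \<Sum>k<K. (cmod (coef (F n) k))\<^sup>2) \<longlonglongrightarrow> (\<Sum>k<K. (cmod (x k))\<^sup>2)"
      by (intro tendsto_sum tendsto_power tendsto_norm lim)
    have "(H2.nrm (F n))\<^sup>2 \<le> B\<^sup>2" for n by (intro power_mono B H2.nrm_nonneg F)
    then show "\<exists>N. \<forall>n\<ge>N. (\<Sum>k<K. (cmod (coef (F n) k))\<^sup>2) \<le> B\<^sup>2"
      using order_trans[OF sum_coef_le_nrm[OF F finite_lessThan]] by blast
  qed
  note P = powser_H2[OF this B0]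
  show f: "powser x \<in> H2" and cf: "coef (powser x) = x" and nf: "H2.nrm (powser x) \<le> B" by (fact P)+
  fix g assume g: "g \<in> H2"
  define d where "d K = (\<lambda>z. g z - (\<Sum>k<K. coef g k * z ^ k))" for K
  have d: "d K \<in> H2" for K unfolding d_def by (intro H2.diff_mem g H2_polynomial)
  have split: "ip2 h g = (\<Sum>k<K. coef h k * cnj (coef g k)) + ip2 h (d K)" if "h \<in> H2" for h K
    using H2.ip_diff_right[OF g H2_polynomial that] by (simp add: d_def ip2_polynomial)
  show "(\<lambda>n. ip2 (F n) g) \<longlonglongrightarrow> ip2 (powser x) g"
  proof (rule LIMSEQ_I)
    fix e :: real assume e: "0 < e"
    have "\<forall>\<^sub>F K in sequentially. H2.nrm (d K) < e / (4 * (B + 1))"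
      unfolding d_def by (rule order_tendstoD(2)[OF H2_approx_polynomial[OF g]]) (use e B0 in simp)
    then obtain K where K: "H2.nrm (d K) < e / (4 * (B + 1))" by (auto dest: eventually_happens)
    have small: "cmod (ip2 h (d K)) < e / 4" if "h \<in> H2" "H2.nrm h \<le> B" for h
    proof -
      have "cmod (ip2 h (d K)) \<le> H2.nrm h * H2.nrm (d K)" by (rule H2.Cauchy_Schwarz[OF that(1) d])
      also have "\<dots> \<le> (B + 1) * H2.nrm (d K)"
        using that H2.nrm_nonneg[OF d] by (intro mult_right_mono) auto
      also have "\<dots> < (B + 1) * (e / (4 * (B + 1)))" using K B0 by (intro mult_strict_left_mono) auto
      also have "\<dots> = e / 4" using B0 by (simp add: field_simps)
      finally show ?thesis .
    qed
    have "(\<lambda>n. \<Sum>k<K. coef (F n) k * cnj (coef g k)) \<longlonglongrightarrow> (\<Sum>k<K. x k * cnj (coef g k))"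
      by (intro tendsto_sum tendsto_mult_right lim)
    then obtain N where N: "\<And>n. n \<ge> N \<Longrightarrow>
        cmod ((\<Sum>k<K. coef (F n) k * cnj (coef g k)) - (\<Sum>k<K. x k * cnj (coef g k))) < e / 4"
      using LIMSEQ_D[of "\<lambda>n. \<Sum>k<K. coef (F n) k * cnj (coef g k)" _ "e / 4"] e by fastforce
    have "cmod (ip2 (F n) g - ip2 (powser x) g) < e" if "n \<ge> N" for n
    proof -
      have "ip2 (F n) g - ip2 (powser x) g = ((\<Sum>k<K. coef (F n) k * cnj (coef g k))
          - (\<Sum>k<K. x k * cnj (coef g k))) + ip2 (F n) (d K) - ip2 (powser x) (d K)"
        using split[OF F, of n K] split[OF f, of K] by (simp add: cf)
      also have "cmod \<dots> < e / 4 + e / 4 + e / 4"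
        by (intro order_le_less_trans[OF norm_triangle_ineq4] add_strict_mono
              order_le_less_trans[OF norm_triangle_ineq] N that small F B f nf)
      finally show ?thesis using e by simp
    qed
    then show "\<exists>N. \<forall>n\<ge>N. cmod (ip2 (F n) g - ip2 (powser x) g) < e" by blast
  qed
qed

lemma H2_eq_coef:
  assumes "f \<in> H2" "g \<in> H2" "coef f = coef g" "z \<in> unit_disk"
  shows "f z = g z"
  using coef_sums[of f z] coef_sums[of g z] assms by (metis holomorphic_if_H2 sums_unique2)

text \<open>
  The limit is found coefficientwise.  That it is a limit in norm is the lower semicontinuity of the
  norm in the weak limit theorem, applied to the differences \<open>F m - F n\<close> with \<open>m\<close> fixed.
\<close>

lemma H2_complete:
  assumes F: "\<And>n. F n \<in> H2"
    and Cauchy: "\<And>e. 0 < e \<Longrightarrow> \<exists>N. \<forall>m\<ge>N. \<forall>n\<ge>N. H2.nrm (\<lambda>z. F m z - F n z) < e"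
  shows "\<exists>f\<in>H2. (\<lambda>n. H2.nrm (\<lambda>z. F n z - f z)) \<longlonglongrightarrow> 0"
proof -
  have "convergent (\<lambda>n. coef (F n) k)" for k
  proof -
    have "Cauchy (\<lambda>n. coef (F n) k)"
    proof (rule CauchyI)
      fix e :: real assume "0 < e"
      from Cauchy[OF this] obtain N where N: "\<forall>m\<ge>N. \<forall>n\<ge>N. H2.nrm (\<lambda>z. F m z - F n z) < e" by blast
      have "cmod (coef (F m) k - coef (F n) k) \<le> H2.nrm (\<lambda>z. F m z - F n z)" for m n
        using coef_le_nrm[OF H2.diff_mem[OF F F]] by (simp add: coef_diff F)
      then show "\<exists>N. \<forall>m\<ge>N. \<forall>n\<ge>N. cmod (coef (F m) k - coef (F n) k) < e" using N
        by (meson order_le_less_trans)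
    qed
    then show ?thesis by (simp add: Cauchy_convergent_iff)
  qed
  then obtain x where x: "\<And>k. (\<lambda>n. coef (F n) k) \<longlonglongrightarrow> x k" unfolding convergent_def by metis
  have key: "\<exists>f. f \<in> H2 \<and> coef f = x \<and> H2.nrm (\<lambda>z. F m z - f z) \<le> e"
    if N: "\<forall>m\<ge>N. \<forall>n\<ge>N. H2.nrm (\<lambda>z. F m z - F n z) < e" and m: "m \<ge> N" for m N e
  proof -
    let ?x = "\<lambda>k. coef (F m) k - x k"
    have l: "(\<lambda>n. coef (\<lambda>z. F m z - F (n + N) z) k) \<longlonglongrightarrow> ?x k" for k
      unfolding coef_diff[OF F F] by (intro tendsto_intros LIMSEQ_ignore_initial_segment x)
    have b: "H2.nrm (\<lambda>z. F m z - F (n + N) z) \<le> e" for n using N m by (simp add: less_imp_le)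
    note W = H2_weak_limit(1-3)[of "\<lambda>n z. F m z - F (n + N) z", OF H2.diff_mem[OF F F] b l]
    have "(\<lambda>z. F m z - powser ?x z) \<in> H2" by (rule H2.diff_mem[OF F W(1)])
    moreover have "coef (\<lambda>z. F m z - powser ?x z) = x" by (simp add: fun_eq_iff coef_diff[OF F W(1)] W(2))
    moreover have "H2.nrm (\<lambda>z. F m z - (F m z - powser ?x z)) \<le> e" using W(3) by (simp add: W)
    ultimately show ?thesis by blast
  qed
  obtain f where f: "f \<in> H2" "coef f = x" using Cauchy[of 1] key by (metis order_refl zero_less_one)
  have "H2.nrm (\<lambda>z. F m z - f z) \<le> e" if "\<forall>m\<ge>N. \<forall>n\<ge>N. H2.nrm (\<lambda>z. F m z - F n z) < e" "m \<ge> N" for m N e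
  proof -
    from key[OF that] obtain f' where f': "f' \<in> H2" "coef f' = x" "H2.nrm (\<lambda>z. F m z - f' z) \<le> e" by blast
    have "f z = f' z" if "z \<in> unit_disk" for z using H2_eq_coef[OF f(1) f'(1)] f f' that by simp
    then have "ip2 (\<lambda>z. F m z - f z) (\<lambda>z. F m z - f z) = ip2 (\<lambda>z. F m z - f' z) (\<lambda>z. F m z - f' z)"
      by (intro ip2_cong) auto
    then show ?thesis using f'(3) by (simp add: H2.nrm_def)
  qed
  note close = this
  have "(\<lambda>n. H2.nrm (\<lambda>z. F n z - f z)) \<longlonglongrightarrow> 0"
  proof (rule LIMSEQ_I)
    fix e :: real assume "0 < e"
    then obtain N where N: "\<forall>m\<ge>N. \<forall>n\<ge>N. H2.nrm (\<lambda>z. F m z - F n z) < e / 2" using Cauchy[of "e / 2"] by auto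
    have "norm (H2.nrm (\<lambda>z. F n z - f z) - 0) < e" if "n \<ge> N" for n
      using close[OF N that] H2.nrm_nonneg[OF H2.diff_mem[OF F f(1)], of n] \<open>0 < e\<close> by simp
    then show "\<exists>N. \<forall>n\<ge>N. norm (H2.nrm (\<lambda>z. F n z - f z) - 0) < e" by blast
  qed
  then show ?thesis using f by blast
qed

section \<open>Radial means and bounded analytic functions\<close>

text \<open>
  Radial limits are taken along this sequence, which allows the use of dominated convergence.
\<close>

definition radius :: "nat \<Rightarrow> real"
  where "radius k = 1 - 1 / (real k + 2)"

lemma radius_bounds: "0 < radius k" "radius k < 1"
  by (auto simp: radius_def field_simps)

lemma radius_tendsto: "radius \<longlonglongrightarrow> 1"
  unfolding radius_def by real_asymp

lemma radius_at_left: "filterlim radius (at_left 1) sequentially"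
  using radius_tendsto radius_bounds(2) less_imp_neq[OF radius_bounds(2)] by (simp add: filterlim_at)

lemma radius_disk: "\<zeta> \<in> sphere 0 1 \<Longrightarrow> 0 \<le> r \<Longrightarrow> r < 1 \<Longrightarrow> of_real r * \<zeta> \<in> unit_disk"
  by (simp add: norm_mult)

lemma continuous_on_circle_dilation:
  assumes "continuous_on unit_disk f" "0 \<le> r" "r < 1"
  shows "continuous_on (sphere 0 1) (\<lambda>\<zeta>. f (of_real r * \<zeta>))"
  by (rule continuous_on_compose2[OF assms(1)]) (use assms in \<open>auto intro!: continuous_intros simp: norm_mult\<close>)

lemma parseval:
  assumes "f holomorphic_on unit_disk" "g holomorphic_on unit_disk" "0 \<le> r" "r < 1"
  shows "(\<lambda>n. coef f n * cnj (coef g n) * of_real (r ^ (2 * n))) sums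
    (CINT \<zeta>. f (of_real r * \<zeta>) * cnj (g (of_real r * \<zeta>)))"
  by (rule parseval_sums) (use assms coef_sums in auto)

lemma mean_square_sums:
  assumes f: "f holomorphic_on unit_disk" and r: "0 \<le> r" "r < 1"
  shows "(\<lambda>n. (cmod (coef f n))\<^sup>2 * r ^ (2 * n)) sums (CINT \<zeta>. (cmod (f (of_real r * \<zeta>)))\<^sup>2)"
proof -
  have "(CINT \<zeta>. f (of_real r * \<zeta>) * cnj (f (of_real r * \<zeta>)))
      = of_real (CINT \<zeta>. (cmod (f (of_real r * \<zeta>)))\<^sup>2)"
    by (simp only: complex_norm_square[symmetric] integral_complex_of_real)
  then have "(\<lambda>n. of_real ((cmod (coef f n))\<^sup>2 * r ^ (2 * n)) :: complex) sums
      of_real (CINT \<zeta>. (cmod (f (of_real r * \<zeta>)))\<^sup>2)"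
    using parseval[OF f f r] by (simp only: complex_norm_square[symmetric] of_real_mult)
  then show ?thesis by (simp only: sums_of_real_iff)
qed

lemma mean_square_le_nrm:
  assumes f: "f \<in> H2" and r: "0 \<le> r" "r < 1"
  shows "(CINT \<zeta>. (cmod (f (of_real r * \<zeta>)))\<^sup>2) \<le> (H2.nrm f)\<^sup>2"
  by (rule sums_le[OF _ mean_square_sums[OF holomorphic_if_H2[OF f] r] H2_nrm_sums[OF f]])
     (use r in \<open>auto intro!: mult_left_le simp: power_le_one\<close>)

lemma H2_if_means_bounded:
  assumes f: "f holomorphic_on unit_disk" and B: "0 \<le> B"
    and bd: "\<And>k. (CINT \<zeta>. (cmod (f (of_real (radius k) * \<zeta>)))\<^sup>2) \<le> B\<^sup>2"
  shows "f \<in> H2" "H2.nrm f \<le> B"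
proof -
  have "(\<Sum>n<K. (cmod (coef f n))\<^sup>2) \<le> B\<^sup>2" for K
  proof (rule LIMSEQ_le_const2)
    have "(\<lambda>k. \<Sum>n<K. (cmod (coef f n))\<^sup>2 * radius k ^ (2 * n)) \<longlonglongrightarrow> (\<Sum>n<K. (cmod (coef f n))\<^sup>2 * 1 ^ (2 * n))"
      by (intro tendsto_sum tendsto_mult_left tendsto_power radius_tendsto)
    then show "(\<lambda>k. \<Sum>n<K. (cmod (coef f n))\<^sup>2 * radius k ^ (2 * n)) \<longlonglongrightarrow> (\<Sum>n<K. (cmod (coef f n))\<^sup>2)" by simp
    have "(\<Sum>n<K. (cmod (coef f n))\<^sup>2 * radius k ^ (2 * n)) \<le> B\<^sup>2" for k
    proof -
      have r: "0 \<le> radius k" "radius k < 1" using radius_bounds[of k] by auto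
      note s = mean_square_sums[OF f r]
      have "(\<Sum>n<K. (cmod (coef f n))\<^sup>2 * radius k ^ (2 * n)) \<le> (\<Sum>n. (cmod (coef f n))\<^sup>2 * radius k ^ (2 * n))"
        by (rule sum_le_suminf[OF sums_summable[OF s]]) (use r in auto)
      also have "\<dots> \<le> B\<^sup>2" using bd[of k] unfolding sums_unique[OF s] .
      finally show ?thesis .
    qed
    then show "\<exists>N. \<forall>k\<ge>N. (\<Sum>n<K. (cmod (coef f n))\<^sup>2 * radius k ^ (2 * n)) \<le> B\<^sup>2" by blast
  qed
  note P = powser_H2[OF this B]
  have e: "powser (coef f) z = f z" if "z \<in> unit_disk" for z
    unfolding powser_def using coef_sums[OF f that] by (rule sums_unique[symmetric])
  show "f \<in> H2" by (rule H2_cong[OF P(1)]) (simp add: e)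
  have "ip2 (powser (coef f)) (powser (coef f)) = ip2 f f" by (rule ip2_cong) (use e in auto)
  then show "H2.nrm f \<le> B" using P(3) by (simp add: H2.nrm_def)
qed

lemma ip2_radial_limit:
  assumes f: "f \<in> H2" and g: "g \<in> H2"
  shows "(\<lambda>k. CINT \<zeta>. f (of_real (radius k) * \<zeta>) * cnj (g (of_real (radius k) * \<zeta>))) \<longlonglongrightarrow> ip2 f g"
proof -
  let ?a = "\<lambda>n k. coef f n * cnj (coef g n) * of_real (radius k ^ (2 * n))"
  have lim: "(\<lambda>k. ?a n k) \<longlonglongrightarrow> coef f n * cnj (coef g n)" for n
  proof -
    have "(\<lambda>k. ?a n k) \<longlonglongrightarrow> coef f n * cnj (coef g n) * of_real (1 ^ (2 * n))"
      by (intro tendsto_mult_left tendsto_of_real tendsto_power radius_tendsto)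
    then show ?thesis by simp
  qed
  have bd: "norm (?a n k) \<le> cmod (coef f n * cnj (coef g n))" for n k
    using radius_bounds[of k] unfolding norm_mult[of _ "of_real (radius k ^ (2 * n))"] norm_of_real
    by (intro mult_left_le) (auto simp: power_le_one)
  have ev: "\<forall>\<^sub>F (n, k) in sequentially \<times>\<^sub>F sequentially. norm (?a n k) \<le> cmod (coef f n * cnj (coef g n))"
    by (rule always_eventually) (use bd in auto)
  have "(\<lambda>k. suminf (\<lambda>n. ?a n k)) \<longlonglongrightarrow> (\<Sum>n. coef f n * cnj (coef g n))"
    by (rule tannerys_theorem[OF lim ev, THEN conjunct2, THEN conjunct2])
       (use f g summable_mult_if_summable_squares in \<open>auto simp: H2_def\<close>)
  moreover have "suminf (\<lambda>n. ?a n k) = (CINT \<zeta>. f (of_real (radius k) * \<zeta>) * cnj (g (of_real (radius k) * \<zeta>)))" for k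
    using parseval[OF holomorphic_if_H2[OF f] holomorphic_if_H2[OF g], of "radius k"] radius_bounds[of k]
    by (simp add: sums_iff)
  ultimately show ?thesis by (simp add: ip2_def)
qed

lemma hardy_infty_bound:
  assumes "f \<in> hardy_infty"
  obtains B where "0 \<le> B" "\<And>z. z \<in> unit_disk \<Longrightarrow> cmod (f z) \<le> B"
proof -
  obtain B where "\<forall>x\<in>f ` unit_disk. cmod x \<le> B"
    using assms unfolding hardy_infty_def bounded_iff by blast
  then show ?thesis using that[of "max B 0"] by force
qed

lemma hardy_inftyI: "f holomorphic_on unit_disk \<Longrightarrow> (\<And>z. z \<in> unit_disk \<Longrightarrow> cmod (f z) \<le> B) \<Longrightarrow> f \<in> hardy_infty"
  unfolding hardy_infty_def bounded_iff by blast

lemma hardy_infty_holomorphic: "f \<in> hardy_infty \<Longrightarrow> f holomorphic_on unit_disk"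
  by (simp add: hardy_infty_def)

lemma hardy_infty_mult:
  assumes "f \<in> hardy_infty" "g \<in> hardy_infty" shows "(\<lambda>z. f z * g z) \<in> hardy_infty"
proof -
  obtain B C where B: "0 \<le> B" "\<And>z. z \<in> unit_disk \<Longrightarrow> cmod (f z) \<le> B"
    and C: "0 \<le> C" "\<And>z. z \<in> unit_disk \<Longrightarrow> cmod (g z) \<le> C"
    using assms hardy_infty_bound by metis
  show ?thesis
    by (rule hardy_inftyI[where B = "B * C"])
       (use assms B C in \<open>auto simp: norm_mult hardy_infty_def intro!: holomorphic_intros mult_mono\<close>)
qed

lemma hardy_infty_add:
  assumes "f \<in> hardy_infty" "g \<in> hardy_infty" shows "(\<lambda>z. f z + g z) \<in> hardy_infty"
proof -
  obtain B C where B: "0 \<le> B" "\<And>z. z \<in> unit_disk \<Longrightarrow> cmod (f z) \<le> B"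
    and C: "0 \<le> C" "\<And>z. z \<in> unit_disk \<Longrightarrow> cmod (g z) \<le> C"
    using assms hardy_infty_bound by metis
  show ?thesis
    by (rule hardy_inftyI[where B = "B + C"])
       (use assms B C in \<open>auto simp: hardy_infty_def intro!: holomorphic_intros norm_triangle_le add_mono\<close>)
qed

lemma hardy_infty_const: "(\<lambda>z. c) \<in> hardy_infty"
  by (rule hardy_inftyI[where B = "cmod c"]) (auto intro!: holomorphic_intros)

lemma hardy_infty_scale: "f \<in> hardy_infty \<Longrightarrow> (\<lambda>z. c * f z) \<in> hardy_infty"
  using hardy_infty_mult[OF hardy_infty_const] .

lemma continuous_on_dilation_if_holomorphic:
  assumes "f holomorphic_on unit_disk" "0 \<le> r" "r < 1"
  shows "continuous_on (sphere 0 1) (\<lambda>\<zeta>. f (of_real r * \<zeta>))"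
  using assms by (intro continuous_on_circle_dilation holomorphic_on_imp_continuous_on)

lemma circle_integral_le:
  fixes F :: "complex \<Rightarrow> real"
  assumes "continuous_on (sphere 0 1) F" "\<And>\<zeta>. \<zeta> \<in> sphere 0 1 \<Longrightarrow> F \<zeta> \<le> B"
  shows "(CINT \<zeta>. F \<zeta>) \<le> B"
proof -
  have "(CINT \<zeta>. F \<zeta>) \<le> (CINT \<zeta>. B)"
    by (rule integral_mono_AE) (use assms in \<open>auto simp: space_circle_measure circle_integrable_if_continuous\<close>)
  then show ?thesis by (simp add: space_circle_measure)
qed

lemma H2_if_bounded:
  assumes f: "f holomorphic_on unit_disk" and B: "0 \<le> B" "\<And>z. z \<in> unit_disk \<Longrightarrow> cmod (f z) \<le> B"
  shows "f \<in> H2" "H2.nrm f \<le> B"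
proof -
  have "(CINT \<zeta>. (cmod (f (of_real (radius k) * \<zeta>)))\<^sup>2) \<le> B\<^sup>2" for k
    by (rule circle_integral_le)
       (use radius_bounds[of k] f B radius_disk[of _ "radius k"] in
         \<open>auto intro!: continuous_intros continuous_on_dilation_if_holomorphic power_mono\<close>)
  from H2_if_means_bounded[OF f B(1) this] show "f \<in> H2" "H2.nrm f \<le> B" by auto
qed

lemma H2_if_hardy_infty:
  assumes "f \<in> hardy_infty" shows "f \<in> H2"
proof -
  obtain B where "0 \<le> B" "\<And>z. z \<in> unit_disk \<Longrightarrow> cmod (f z) \<le> B"
    using hardy_infty_bound[OF assms] by blast
  then show ?thesis by (rule H2_if_bounded(1)[OF hardy_infty_holomorphic[OF assms]])
qed

text \<open>
  Taylor coefficients are integrals over the circle of radius \<open>1/2\<close>, where dominated convergence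
  applies; bounded functions are bounded in \<open>H2\<close>, so the weak limit theorem does the rest.
\<close>

lemma H2_bounded_pointwise_limit:
  assumes F: "\<And>n. F n holomorphic_on unit_disk" and B: "\<And>n z. z \<in> unit_disk \<Longrightarrow> cmod (F n z) \<le> B"
    and lim: "\<And>z. z \<in> unit_disk \<Longrightarrow> (\<lambda>n. F n z) \<longlonglongrightarrow> f z"
    and f: "f holomorphic_on unit_disk"
  shows "\<And>k. (\<lambda>n. coef (F n) k) \<longlonglongrightarrow> coef f k"
    and "\<And>g. g \<in> H2 \<Longrightarrow> (\<lambda>n. ip2 (F n) g) \<longlonglongrightarrow> ip2 f g"
proof -
  have B0: "0 \<le> B" using order_trans[OF norm_ge_zero B[of 0 0]] by simp
  show coef: "(\<lambda>n. coef (F n) k) \<longlonglongrightarrow> coef f k" for k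
  proof -
    define e :: "nat \<Rightarrow> complex" where "e n = (if n = k then 1 else 0)" for n
    have e: "(\<lambda>n. e n * z ^ n) sums z ^ k" for z
      unfolding e_def by (rule monomial_sums)
    have c: "(CINT \<zeta>. h (of_real (1/2) * \<zeta>) * cnj ((of_real (1/2) * \<zeta>) ^ k)) = coef h k * (1/2) ^ (2 * k)"
      if h: "h holomorphic_on unit_disk" for h
    proof (rule sums_unique2)
      show "(\<lambda>n. coef h n * cnj (e n) * of_real ((1/2) ^ (2 * n))) sums
        (CINT \<zeta>. h (of_real (1/2) * \<zeta>) * cnj ((of_real (1/2) * \<zeta>) ^ k))"
        by (rule parseval_sums[where g = "\<lambda>z. z ^ k"]) (use coef_sums[OF h] e in auto)
      show "(\<lambda>n. coef h n * cnj (e n) * of_real ((1/2) ^ (2 * n))) sums (coef h k * (1/2) ^ (2 * k))"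
        using sums_single[of k "\<lambda>n. coef h n * (1/2) ^ (2 * n)"]
        unfolding e_def by (rule sums_cong[THEN iffD1, rotated]) auto
    qed
    have "(\<lambda>n. CINT \<zeta>. F n (of_real (1/2) * \<zeta>) * cnj ((of_real (1/2) * \<zeta>) ^ k))
      \<longlonglongrightarrow> (CINT \<zeta>. f (of_real (1/2) * \<zeta>) * cnj ((of_real (1/2) * \<zeta>) ^ k))"
    proof (rule integral_dominated_convergence[where w = "\<lambda>_. B"])
      have m: "(\<lambda>\<zeta>. h (of_real (1/2) * \<zeta>) * cnj ((of_real (1/2) * \<zeta>) ^ k)) \<in> borel_measurable circle_measure"
        if "h holomorphic_on unit_disk" for h
        using that by (intro circle_measurable_if_continuous continuous_intros continuous_on_dilation_if_holomorphic) auto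
      show "(\<lambda>\<zeta>. f (of_real (1/2) * \<zeta>) * cnj ((of_real (1/2) * \<zeta>) ^ k)) \<in> borel_measurable circle_measure"
        "\<And>n. (\<lambda>\<zeta>. F n (of_real (1/2) * \<zeta>) * cnj ((of_real (1/2) * \<zeta>) ^ k)) \<in> borel_measurable circle_measure"
        using m F f by blast+
      show "AE \<zeta> in circle_measure. norm (F n (of_real (1/2) * \<zeta>) * cnj ((of_real (1/2) * \<zeta>) ^ k)) \<le> B" for n
      proof (rule AE_I2)
        fix \<zeta> assume "\<zeta> \<in> space circle_measure"
        then have z: "cmod \<zeta> = 1" by (simp add: space_circle_measure)
        have "cmod (F n (of_real (1/2) * \<zeta>)) * (1/2) ^ k \<le> B * 1"
          using z B0 by (intro mult_mono B) (auto simp: norm_mult power_le_one)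
        then show "norm (F n (of_real (1/2) * \<zeta>) * cnj ((of_real (1/2) * \<zeta>) ^ k)) \<le> B"
          using z by (simp add: norm_mult norm_power norm_divide power_divide)
      qed
      show "AE \<zeta> in circle_measure. (\<lambda>n. F n (of_real (1/2) * \<zeta>) * cnj ((of_real (1/2) * \<zeta>) ^ k))
          \<longlonglongrightarrow> f (of_real (1/2) * \<zeta>) * cnj ((of_real (1/2) * \<zeta>) ^ k)"
        by (rule AE_I2, rule tendsto_mult_right, rule lim) (auto simp: space_circle_measure norm_mult)
    qed auto
    then have "(\<lambda>n. coef (F n) k * (1/2) ^ (2 * k)) \<longlonglongrightarrow> coef f k * (1/2) ^ (2 * k)"
      unfolding c[OF F] c[OF f] .
    from tendsto_mult_right[OF this, of "2 ^ (2 * k)"] show ?thesis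
      by (simp add: power_divide)
  qed
  have "F n \<in> H2" "H2.nrm (F n) \<le> B" for n using H2_if_bounded[OF F B0 B] by blast+
  note W = H2_weak_limit(4)[OF this coef]
  fix g assume g: "g \<in> H2"
  have "ip2 (powser (coef f)) g = ip2 f g"
    by (rule ip2_cong) (use coef_sums[OF f] in \<open>auto simp: powser_def sums_iff\<close>)
  then show "(\<lambda>n. ip2 (F n) g) \<longlonglongrightarrow> ip2 f g" using W[OF g] by simp
qed

text \<open>
  The reproducing kernel of \<open>H2\<close>.
\<close>

definition szego :: "complex \<Rightarrow> complex \<Rightarrow> complex"
  where "szego w z = 1 / (1 - cnj w * z)"

lemma szego_sums:
  assumes "w \<in> unit_disk" "z \<in> unit_disk"
  shows "(\<lambda>n. cnj w ^ n * z ^ n) sums szego w z"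
proof -
  have "cmod (cnj w * z) < 1 * 1"
    unfolding norm_mult by (intro mult_strict_mono) (use assms in auto)
  then show ?thesis using geometric_sums[of "cnj w * z"] by (simp add: szego_def power_mult_distrib)
qed

lemma coef_szego: "w \<in> unit_disk \<Longrightarrow> coef (szego w) = (\<lambda>n. cnj w ^ n)"
  by (rule coef_eqI) (rule szego_sums)

lemma szego_hardy_infty:
  assumes w: "w \<in> unit_disk" shows "szego w \<in> hardy_infty"
proof (rule hardy_inftyI)
  show "szego w holomorphic_on unit_disk" by (rule coef_eqI) (rule szego_sums[OF w])
  fix z :: complex assume z: "z \<in> unit_disk"
  have "cmod (cnj w * z) \<le> cmod w" using z by (simp add: norm_mult mult_left_le)
  then have "1 - cmod w \<le> cmod (1 - cnj w * z)" using norm_triangle_ineq2[of 1 "cnj w * z"] by simp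
  then show "cmod (szego w z) \<le> 1 / (1 - cmod w)"
    using w unfolding szego_def norm_divide norm_one by (intro frac_le) auto
qed

lemma ip2_szego:
  assumes f: "f holomorphic_on unit_disk" and w: "w \<in> unit_disk"
  shows "ip2 f (szego w) = f w"
  using coef_sums[OF f w] by (simp add: ip2_def coef_szego[OF w] sums_iff)

section \<open>Bounded approximate inverses of an outer function\<close>

text \<open>
  An outer function is the exponential of such an integral, with \<open>v\<close> the logarithm of the prescribed
  modulus on the circle; the real part is the Poisson integral of \<open>v\<close>.
\<close>

definition herglotz :: "(complex \<Rightarrow> real) \<Rightarrow> complex \<Rightarrow> complex"
  where "herglotz v z = (CINT \<zeta>. (\<zeta> + z) / (\<zeta> - z) * of_real (v \<zeta>))"

text \<open>
  The coefficients in \<open>(1 + q) / (1 - q) = 1 + 2 q + 2 q\<^sup>2 + \<dots>\<close>.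
\<close>

definition herglotz_coef :: "nat \<Rightarrow> complex"
  where "herglotz_coef n = (if n = 0 then 1 else 2)"

lemma herglotz_kernel_sums:
  assumes \<zeta>: "\<zeta> \<in> sphere 0 1" and z: "z \<in> unit_disk"
  shows "(\<lambda>n. herglotz_coef n * (cnj \<zeta> * z) ^ n) sums ((\<zeta> + z) / (\<zeta> - z))"
proof -
  have u: "\<zeta> * cnj \<zeta> = 1" using \<zeta> by (simp add: complex_norm_square[symmetric])
  define q where "q = cnj \<zeta> * z"
  have q: "cmod q < 1" using \<zeta> z by (simp add: q_def norm_mult)
  then have q1: "1 - q \<noteq> 0" by auto
  have "(\<lambda>n. 2 * q ^ n - (if n = 0 then 1 else 0)) sums (2 * (1 / (1 - q)) - 1)"
    using sums_single[of 0 "\<lambda>n. 1::complex"] by (intro sums_diff sums_mult geometric_sums q) simp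
  then have "(\<lambda>n. herglotz_coef n * q ^ n) sums (2 * (1 / (1 - q)) - 1)"
    by (rule sums_cong[THEN iffD1, rotated]) (simp add: herglotz_coef_def)
  also have "2 * (1 / (1 - q)) - 1 = (1 + q) / (1 - q)" using q1 by (simp add: field_simps)
  also have "\<dots> = (\<zeta> * (1 + q)) / (\<zeta> * (1 - q))" using \<zeta> by auto
  also have "\<zeta> * (1 + q) = \<zeta> + z" using u by (simp add: q_def distrib_left mult.assoc[symmetric])
  also have "\<zeta> * (1 - q) = \<zeta> - z" using u by (simp add: q_def right_diff_distrib mult.assoc[symmetric])
  finally show ?thesis by (simp add: q_def)
qed

lemma herglotz_kernel_partial_bound:
  assumes \<zeta>: "\<zeta> \<in> sphere 0 1" and z: "z \<in> unit_disk"
  shows "cmod (\<Sum>n<N. herglotz_coef n * (cnj \<zeta> * z) ^ n) \<le> 2 / (1 - cmod z)"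
proof -
  have "cmod (\<Sum>n<N. herglotz_coef n * (cnj \<zeta> * z) ^ n) \<le> (\<Sum>n<N. 2 * cmod z ^ n)"
    by (rule order_trans[OF norm_sum])
       (use \<zeta> in \<open>auto intro!: sum_mono simp: norm_mult norm_power herglotz_coef_def\<close>)
  also have "\<dots> \<le> (\<Sum>n. 2 * cmod z ^ n)"
    using z by (intro sum_le_suminf summable_mult summable_geometric) auto
  also have "\<dots> = 2 * (1 / (1 - cmod z))"
    using z by (simp add: suminf_mult suminf_geometric summable_geometric)
  finally show ?thesis by simp
qed

lemma herglotz_kernel_bound:
  assumes \<zeta>: "\<zeta> \<in> sphere 0 1" and z: "z \<in> unit_disk"
  shows "cmod ((\<zeta> + z) / (\<zeta> - z)) \<le> 2 / (1 - cmod z)"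
  using tendsto_norm[OF herglotz_kernel_sums[OF assms, unfolded sums_def]]
  by (rule LIMSEQ_le_const2) (use herglotz_kernel_partial_bound[OF assms] in blast)

lemma herglotz_kernel_continuous:
  "z \<in> unit_disk \<Longrightarrow> continuous_on (sphere 0 1) (\<lambda>\<zeta>. (\<zeta> + z) / (\<zeta> - z))"
  by (intro continuous_intros) auto

lemma herglotz_integrable:
  assumes v: "integrable circle_measure v" and z: "z \<in> unit_disk"
  shows "integrable circle_measure (\<lambda>\<zeta>. (\<zeta> + z) / (\<zeta> - z) * of_real (v \<zeta>))"
proof (rule Bochner_Integration.integrable_bound[where f = "\<lambda>\<zeta>. 2 / (1 - cmod z) * v \<zeta>"])
  show "integrable circle_measure (\<lambda>\<zeta>. 2 / (1 - cmod z) * v \<zeta>)" using v by simp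
  show "(\<lambda>\<zeta>. (\<zeta> + z) / (\<zeta> - z) * of_real (v \<zeta>)) \<in> borel_measurable circle_measure"
    using v circle_measurable_if_continuous[OF herglotz_kernel_continuous[OF z]] by measurable
  show "AE \<zeta> in circle_measure. norm ((\<zeta> + z) / (\<zeta> - z) * of_real (v \<zeta>)) \<le> norm (2 / (1 - cmod z) * v \<zeta>)"
    by (rule AE_I2, unfold norm_mult, rule mult_mono)
       (use herglotz_kernel_bound[OF _ z] z in \<open>auto simp: space_circle_measure\<close>)
qed

text \<open>
  This expansion shows that the integral is holomorphic in \<open>z\<close>.
\<close>

lemma herglotz_sums:
  assumes v: "integrable circle_measure v" and z: "z \<in> unit_disk"
  shows "(\<lambda>n. herglotz_coef n * (CINT \<zeta>. cnj \<zeta> ^ n * of_real (v \<zeta>)) * z ^ n) sums herglotz v z"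
proof -
  have int: "integrable circle_measure (\<lambda>\<zeta>. cnj \<zeta> ^ n * of_real (v \<zeta>))" for n
  proof (rule Bochner_Integration.integrable_bound[OF v])
    have "(\<lambda>\<zeta>. cnj \<zeta> ^ n) \<in> borel_measurable circle_measure"
      by (intro circle_measurable_if_continuous continuous_intros)
    then show "(\<lambda>\<zeta>. cnj \<zeta> ^ n * of_real (v \<zeta>)) \<in> borel_measurable circle_measure"
      using v by measurable
  qed (auto intro!: AE_I2 simp: space_circle_measure norm_mult norm_power)
  have "(\<lambda>N. CINT \<zeta>. (\<Sum>n<N. herglotz_coef n * (cnj \<zeta> * z) ^ n) * of_real (v \<zeta>)) \<longlonglongrightarrow> herglotz v z"
    unfolding herglotz_def
  proof (rule integral_dominated_convergence[where w = "\<lambda>\<zeta>. 2 / (1 - cmod z) * \<bar>v \<zeta>\<bar>"])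
    show "integrable circle_measure (\<lambda>\<zeta>. 2 / (1 - cmod z) * \<bar>v \<zeta>\<bar>)" using v by simp
    show "(\<lambda>\<zeta>. (\<zeta> + z) / (\<zeta> - z) * of_real (v \<zeta>)) \<in> borel_measurable circle_measure"
      using herglotz_integrable[OF v z] by simp
    have "(\<lambda>\<zeta>. \<Sum>n<N. herglotz_coef n * (cnj \<zeta> * z) ^ n) \<in> borel_measurable circle_measure" for N
      by (intro circle_measurable_if_continuous continuous_intros)
    then show "(\<lambda>\<zeta>. (\<Sum>n<N. herglotz_coef n * (cnj \<zeta> * z) ^ n) * of_real (v \<zeta>)) \<in> borel_measurable circle_measure" for N
      using v by measurable
    show "AE \<zeta> in circle_measure. (\<lambda>N. (\<Sum>n<N. herglotz_coef n * (cnj \<zeta> * z) ^ n) * of_real (v \<zeta>))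
        \<longlonglongrightarrow> (\<zeta> + z) / (\<zeta> - z) * of_real (v \<zeta>)"
      using herglotz_kernel_sums[OF _ z] unfolding sums_def
      by (intro AE_I2 tendsto_mult_right) (auto simp: space_circle_measure)
    show "AE \<zeta> in circle_measure. norm ((\<Sum>n<N. herglotz_coef n * (cnj \<zeta> * z) ^ n) * of_real (v \<zeta>))
        \<le> 2 / (1 - cmod z) * \<bar>v \<zeta>\<bar>" for N
      using herglotz_kernel_partial_bound[OF _ z, of _ N]
      by (intro AE_I2) (simp only: norm_mult norm_of_real, rule mult_right_mono, auto simp: space_circle_measure)
  qed
  moreover have "(CINT \<zeta>. (\<Sum>n<N. herglotz_coef n * (cnj \<zeta> * z) ^ n) * of_real (v \<zeta>))
      = (\<Sum>n<N. herglotz_coef n * (CINT \<zeta>. cnj \<zeta> ^ n * of_real (v \<zeta>)) * z ^ n)" for N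
  proof -
    have "(CINT \<zeta>. (\<Sum>n<N. herglotz_coef n * (cnj \<zeta> * z) ^ n) * of_real (v \<zeta>))
        = (CINT \<zeta>. (\<Sum>n<N. (herglotz_coef n * z ^ n) * (cnj \<zeta> ^ n * of_real (v \<zeta>))))"
      unfolding sum_distrib_right
      by (intro Bochner_Integration.integral_cong refl sum.cong) (simp add: power_mult_distrib mult_ac)
    also have "\<dots> = (\<Sum>n<N. (herglotz_coef n * z ^ n) * (CINT \<zeta>. cnj \<zeta> ^ n * of_real (v \<zeta>)))"
      using int by (subst Bochner_Integration.integral_sum) auto
    finally show ?thesis by (simp only: mult_ac)
  qed
  ultimately show ?thesis unfolding sums_def by simp
qed

lemma herglotz_holomorphic:
  "integrable circle_measure v \<Longrightarrow> herglotz v holomorphic_on unit_disk"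
  by (rule coef_eqI) (rule herglotz_sums)

lemma herglotz_one:
  assumes z: "z \<in> unit_disk" shows "herglotz (\<lambda>_. 1) z = 1"
proof -
  have i: "(CINT \<zeta>. cnj \<zeta> ^ n * of_real 1) = (if n = 0 then 1 else 0)" for n
    using circle_orthogonality[of 0 n] by simp
  have "(\<lambda>n. herglotz_coef n * (if n = 0 then 1 else 0) * z ^ n) sums herglotz (\<lambda>_. 1) z"
    using herglotz_sums[OF _ z, of "\<lambda>_. 1"] unfolding i by simp
  moreover have "(\<lambda>n. herglotz_coef n * (if n = 0 then 1 else 0) * z ^ n) sums 1"
    using sums_single[of 0 "\<lambda>n. 1::complex"]
    by (rule sums_cong[THEN iffD1, rotated]) (simp add: herglotz_coef_def)
  ultimately show ?thesis by (rule sums_unique2)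
qed

lemma Re_herglotz_kernel:
  assumes \<zeta>: "\<zeta> \<in> sphere 0 1" and z: "z \<in> unit_disk"
  shows "0 \<le> Re ((\<zeta> + z) / (\<zeta> - z))"
proof -
  have "Re ((\<zeta> + z) * cnj (\<zeta> - z)) = (cmod \<zeta>)\<^sup>2 - (cmod z)\<^sup>2"
    unfolding cmod_power2 by (simp add: algebra_simps power2_eq_square)
  also have "\<dots> \<ge> 0" using \<zeta> z by (simp add: power_le_one)
  finally show ?thesis by (simp add: Re_complex_div_ge_0)
qed

lemma Re_herglotz_mono:
  assumes u: "integrable circle_measure u" and v: "integrable circle_measure v" and z: "z \<in> unit_disk"
    and le: "\<And>\<zeta>. \<zeta> \<in> sphere 0 1 \<Longrightarrow> u \<zeta> \<le> v \<zeta>"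
  shows "Re (herglotz u z) \<le> Re (herglotz v z)"
proof -
  have "(CINT \<zeta>. Re ((\<zeta> + z) / (\<zeta> - z) * of_real (u \<zeta>)))
      \<le> (CINT \<zeta>. Re ((\<zeta> + z) / (\<zeta> - z) * of_real (v \<zeta>)))"
  proof (rule integral_mono)
    show "integrable circle_measure (\<lambda>\<zeta>. Re ((\<zeta> + z) / (\<zeta> - z) * of_real (u \<zeta>)))"
      "integrable circle_measure (\<lambda>\<zeta>. Re ((\<zeta> + z) / (\<zeta> - z) * of_real (v \<zeta>)))"
      by (intro integrable_Re herglotz_integrable assms)+
    fix \<zeta> assume "\<zeta> \<in> space circle_measure"
    then have \<zeta>: "\<zeta> \<in> sphere 0 1" by (simp add: space_circle_measure)
    show "Re ((\<zeta> + z) / (\<zeta> - z) * of_real (u \<zeta>)) \<le> Re ((\<zeta> + z) / (\<zeta> - z) * of_real (v \<zeta>))"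
      using mult_left_mono[OF le[OF \<zeta>] Re_herglotz_kernel[OF \<zeta> z]] by (simp only: Re_complex_of_real times_complex.sel Im_complex_of_real mult_zero_right diff_zero)
  qed
  then show ?thesis
    using integral_Re[OF herglotz_integrable[OF u z]] integral_Re[OF herglotz_integrable[OF v z]]
    by (simp add: herglotz_def)
qed

text \<open>
  The functions \<open>E n\<close> are, up to a unimodular factor, the reciprocals of the outer functions with
  modulus \<open>max h (1 / (n + 1))\<close> on the circle, where \<open>h\<close> is the modulus of \<open>a\<close>.  The truncation makes them
  bounded.  The product \<open>a \<cdot> E n\<close> is the exponential of the Herglotz integral of
  \<open>w n = ln h - ln (max h (1 / (n + 1)))\<close>, which is at most \<open>0\<close> and tends to \<open>0\<close> dominated by \<open>\<bar>ln h\<bar>\<close>.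
\<close>

lemma outer_approximants:
  assumes "outer a"
  shows "\<exists>E :: nat \<Rightarrow> complex \<Rightarrow> complex. (\<forall>n. E n \<in> hardy_infty) \<and>
    (\<forall>n. \<forall>z\<in>unit_disk. cmod (a z * E n z) \<le> 1) \<and> (\<forall>z\<in>unit_disk. (\<lambda>n. a z * E n z) \<longlonglongrightarrow> 1)"
proof -
  obtain c h where c: "norm c = 1" and hm: "h \<in> borel_measurable circle_measure"
    and hpos: "\<forall>\<zeta>\<in>sphere 0 1. 0 < h \<zeta>" and hi: "integrable circle_measure (\<lambda>\<zeta>. ln (h \<zeta> :: real))"
    and a: "\<And>z. z \<in> unit_disk \<Longrightarrow> a z = c * exp (herglotz (\<lambda>\<zeta>. ln (h \<zeta>)) z)"
    using assms unfolding outer_def herglotz_def by blast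
  define v where "v n \<zeta> = ln (max (h \<zeta>) (1 / real (Suc n)))" for n \<zeta>
  define w where "w n \<zeta> = ln (h \<zeta>) - v n \<zeta>" for n \<zeta>
  have vm: "v n \<in> borel_measurable circle_measure" for n unfolding v_def using hm by measurable
  have ln0: "ln (1 / real (Suc n)) \<le> 0" for n by (simp add: ln_div)
  have wle: "w n \<zeta> \<le> 0" and wabs: "\<bar>w n \<zeta>\<bar> \<le> \<bar>ln (h \<zeta>)\<bar>" if "\<zeta> \<in> sphere 0 1" for n \<zeta>
  proof -
    have hp: "0 < h \<zeta>" using hpos that by blast
    show "w n \<zeta> \<le> 0" unfolding w_def v_def using hp by simp
    show "\<bar>w n \<zeta>\<bar> \<le> \<bar>ln (h \<zeta>)\<bar>"
    proof (cases "h \<zeta> \<ge> 1 / real (Suc n)")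
      case True then show ?thesis by (simp add: w_def v_def max_def)
    next
      case False
      then have "ln (h \<zeta>) \<le> ln (1 / real (Suc n))" using hp by (intro ln_mono) auto
      moreover have e: "max (h \<zeta>) (1 / real (Suc n)) = 1 / real (Suc n)" using False by linarith
      ultimately show ?thesis using ln0[of n] unfolding w_def v_def e by linarith
    qed
  qed
  have wi: "integrable circle_measure (w n)" for n
  proof (rule Bochner_Integration.integrable_bound[OF hi])
    show "w n \<in> borel_measurable circle_measure" unfolding w_def using vm hm by measurable
  qed (use wabs in \<open>auto intro!: AE_I2 simp: space_circle_measure\<close>)
  have vw: "v n = (\<lambda>\<zeta>. ln (h \<zeta>) - w n \<zeta>)" for n by (simp add: w_def)
  have vi: "integrable circle_measure (v n)" for n unfolding vw using hi wi by simp
  define E where "E n z = cnj c * exp (- herglotz (v n) z)" for n z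
  have aO: "a z * E n z = exp (herglotz (w n) z)" if z: "z \<in> unit_disk" for n z
  proof -
    have "herglotz (w n) z = herglotz (\<lambda>\<zeta>. ln (h \<zeta>)) z - herglotz (v n) z"
      unfolding herglotz_def w_def
      using herglotz_integrable[OF hi z] herglotz_integrable[OF vi z]
      by (subst Bochner_Integration.integral_diff[symmetric]) (auto simp: right_diff_distrib)
    moreover have "cnj c * c = 1" using c by (simp add: mult.commute[of "cnj c"] complex_norm_square[symmetric])
    ultimately show ?thesis by (simp add: a[OF z] E_def exp_diff exp_minus divide_inverse mult.assoc mult.left_commute[of _ "cnj c"])
  qed
  show ?thesis
  proof (intro exI[of _ E] conjI allI ballI)
    fix n
    show "E n \<in> hardy_infty"
    proof (rule hardy_inftyI)
      show "E n holomorphic_on unit_disk"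
        unfolding E_def by (intro holomorphic_intros herglotz_holomorphic vi)
      fix z assume z: "z \<in> unit_disk"
      have "Re (herglotz (\<lambda>_. ln (1 / real (Suc n))) z) \<le> Re (herglotz (v n) z)"
        by (rule Re_herglotz_mono[OF _ vi z]) (auto simp: v_def simp del: of_nat_Suc intro!: ln_mono)
      moreover have "herglotz (\<lambda>_. ln (1 / real (Suc n))) z = of_real (ln (1 / real (Suc n))) * herglotz (\<lambda>_. 1) z"
        by (simp only: herglotz_def of_real_1 mult_1_right integral_mult_left_zero) (rule mult.commute)
      ultimately have "ln (1 / real (Suc n)) \<le> Re (herglotz (v n) z)"
        unfolding herglotz_one[OF z] by (simp del: of_real_of_nat_eq of_nat_Suc)
      then show "cmod (E n z) \<le> exp (- ln (1 / real (Suc n)))"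
        using c by (simp add: E_def norm_mult del: of_nat_Suc)
    qed
  next
    fix n z assume z: "z \<in> unit_disk"
    have "Re (herglotz (w n) z) \<le> Re (herglotz (\<lambda>_. 0) z)"
      by (rule Re_herglotz_mono[OF wi _ z]) (use wle in auto)
    also have "\<dots> = 0" by (simp add: herglotz_def)
    finally show "cmod (a z * E n z) \<le> 1" by (simp add: aO[OF z])
  next
    fix z assume z: "z \<in> unit_disk"
    have "(\<lambda>n. herglotz (w n) z) \<longlonglongrightarrow> (CINT \<zeta>. 0)"
      unfolding herglotz_def
    proof (rule integral_dominated_convergence[where w = "\<lambda>\<zeta>. 2 / (1 - cmod z) * \<bar>ln (h \<zeta>)\<bar>"])
      show "integrable circle_measure (\<lambda>\<zeta>. 2 / (1 - cmod z) * \<bar>ln (h \<zeta>)\<bar>)" using hi by simp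
      show "(\<lambda>\<zeta>. (\<zeta> + z) / (\<zeta> - z) * of_real (w n \<zeta>)) \<in> borel_measurable circle_measure" for n
        using herglotz_integrable[OF wi z] by simp
      show "AE \<zeta> in circle_measure. norm ((\<zeta> + z) / (\<zeta> - z) * of_real (w n \<zeta>)) \<le> 2 / (1 - cmod z) * \<bar>ln (h \<zeta>)\<bar>" for n
        by (rule AE_I2, unfold norm_mult norm_of_real, rule mult_mono)
           (use herglotz_kernel_bound[OF _ z] wabs z in \<open>auto simp: space_circle_measure\<close>)
      show "AE \<zeta> in circle_measure. (\<lambda>n. (\<zeta> + z) / (\<zeta> - z) * of_real (w n \<zeta>)) \<longlonglongrightarrow> 0"
      proof (rule AE_I2)
        fix \<zeta> assume "\<zeta> \<in> space circle_measure"
        then have hp: "0 < h \<zeta>" using hpos by (simp add: space_circle_measure)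
        have "\<forall>\<^sub>F n in sequentially. 1 / real (Suc n) < h \<zeta>"
          using LIMSEQ_Suc[OF lim_1_over_n] hp by (intro order_tendstoD)
        then have "\<forall>\<^sub>F n in sequentially. (\<zeta> + z) / (\<zeta> - z) * of_real (w n \<zeta>) = 0"
          by eventually_elim (simp add: w_def v_def max_def)
        then show "(\<lambda>n. (\<zeta> + z) / (\<zeta> - z) * of_real (w n \<zeta>)) \<longlonglongrightarrow> 0" by (rule tendsto_eventually)
      qed
    qed auto
    then have "(\<lambda>n. exp (herglotz (w n) z)) \<longlonglongrightarrow> exp 0" by (intro tendsto_exp) simp
    then show "(\<lambda>n. a z * E n z) \<longlonglongrightarrow> 1" by (simp add: aO[OF z])
  qed
qed

lemma outer_nonzero:
  assumes "outer a" "z \<in> unit_disk" shows "a z \<noteq> 0"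
proof -
  obtain c e where "norm c = 1" "a z = c * exp e" using assms unfolding outer_def by blast
  then show ?thesis by auto
qed

section \<open>A model of the de Branges-Rovnyak space\<close>

lemma H2_nrm_zero: "f \<in> H2 \<Longrightarrow> H2.nrm f = 0 \<Longrightarrow> z \<in> unit_disk \<Longrightarrow> f z = 0"
  using H2.Cauchy_Schwarz[OF _ H2_if_hardy_infty[OF szego_hardy_infty], of f z]
    ip2_szego[OF holomorphic_if_H2, of f z] by simp

lemma ip2_zero_left: "ip2 (\<lambda>z. 0) g = 0"
proof -
  have "coef (\<lambda>z. 0) = (\<lambda>n. 0)" by (rule coef_eqI) simp
  then show ?thesis by (simp add: ip2_def)
qed

lemma H2_zero: "(\<lambda>z. 0) \<in> H2"
  using H2_polynomial[of "\<lambda>_. 0" 0] by simp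

lemma ip2_tendsto_if_nrm:
  assumes F: "\<And>n. F n \<in> H2" "f \<in> H2" and g: "g \<in> H2"
    and lim: "(\<lambda>n. H2.nrm (\<lambda>z. F n z - f z)) \<longlonglongrightarrow> 0"
  shows "(\<lambda>n. ip2 (F n) g) \<longlonglongrightarrow> ip2 f g"
proof (rule LIM_zero_cancel, rule Lim_null_comparison)
  have "norm (ip2 (F n) g - ip2 f g) \<le> H2.nrm (\<lambda>z. F n z - f z) * H2.nrm g" for n
    using H2.Cauchy_Schwarz[OF H2.diff_mem[OF F(1) F(2)] g, of n] H2.ip_diff[OF F(1) F(2) g, of n] by simp
  then show "\<forall>\<^sub>F n in sequentially. norm (ip2 (F n) g - ip2 f g) \<le> H2.nrm (\<lambda>z. F n z - f z) * H2.nrm g" by simp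
  show "(\<lambda>n. H2.nrm (\<lambda>z. F n z - f z) * H2.nrm g) \<longlonglongrightarrow> 0" using tendsto_mult_right[OF lim] by simp
qed

locale pythagorean_pair =
  fixes a b :: "complex \<Rightarrow> complex"
  assumes b_holomorphic: "b holomorphic_on unit_disk"
    and b_disk: "b ` unit_disk \<subseteq> unit_disk"
    and mate: "pythagorean_mate b a"
begin

lemma a_bound: "z \<in> unit_disk \<Longrightarrow> cmod (a z) \<le> 1"
  using mate unfolding pythagorean_mate_def by (simp add: image_subset_iff)

lemma b_bound: "z \<in> unit_disk \<Longrightarrow> cmod (b z) \<le> 1"
  using b_disk by (force simp: image_subset_iff)

lemma a_hardy_infty: "a \<in> hardy_infty"
  using mate a_bound by (intro hardy_inftyI[where B = 1]) (auto simp: pythagorean_mate_def)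

lemma b_hardy_infty: "b \<in> hardy_infty"
  by (intro hardy_inftyI[where B = 1] b_holomorphic b_bound)

lemma a_mult: "u \<in> hardy_infty \<Longrightarrow> (\<lambda>z. a z * u z) \<in> hardy_infty"
  by (rule hardy_infty_mult[OF a_hardy_infty])

lemma b_mult: "u \<in> hardy_infty \<Longrightarrow> (\<lambda>z. b z * u z) \<in> hardy_infty"
  by (rule hardy_infty_mult[OF b_hardy_infty])

lemma a_mult_H2: "u \<in> hardy_infty \<Longrightarrow> (\<lambda>z. a z * u z) \<in> H2"
  by (intro H2_if_hardy_infty a_mult)

lemma b_mult_H2: "u \<in> hardy_infty \<Longrightarrow> (\<lambda>z. b z * u z) \<in> H2"
  by (intro H2_if_hardy_infty b_mult)

text \<open>
  On the circle of radius \<open>r\<close> the difference of the two sides is the integral of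
  \<open>(\<bar>b\<bar>\<^sup>2 + \<bar>a\<bar>\<^sup>2 - 1) F cnj u\<close>.  The first factor tends to \<open>0\<close> almost everywhere as \<open>r \<rightarrow> 1\<close>, and the other two
  are bounded.
\<close>

lemma pythagorean_isometry:
  assumes F: "F \<in> hardy_infty" and u: "u \<in> hardy_infty"
  shows "ip2 (\<lambda>z. b z * F z) (\<lambda>z. b z * u z) + ip2 (\<lambda>z. a z * F z) (\<lambda>z. a z * u z) = ip2 F u"
proof -
  obtain A B where A: "0 \<le> A" "\<And>z. z \<in> unit_disk \<Longrightarrow> cmod (F z) \<le> A"
    and B: "0 \<le> B" "\<And>z. z \<in> unit_disk \<Longrightarrow> cmod (u z) \<le> B"
    using hardy_infty_bound[OF F] hardy_infty_bound[OF u] by metis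
  define d where "d k \<zeta> = ((cmod (b (of_real (radius k) * \<zeta>)))\<^sup>2 + (cmod (a (of_real (radius k) * \<zeta>)))\<^sup>2 - 1)" for k \<zeta>
  define P where "P k \<zeta> = F (of_real (radius k) * \<zeta>) * cnj (u (of_real (radius k) * \<zeta>))" for k \<zeta>
  have cont: "continuous_on (sphere 0 1) (\<lambda>\<zeta>. f (of_real (radius k) * \<zeta>))" if "f \<in> hardy_infty" for f k
    using radius_bounds[of k] hardy_infty_holomorphic[OF that] by (intro continuous_on_dilation_if_holomorphic) auto
  have contP: "continuous_on (sphere 0 1) (P k)" for k unfolding P_def by (intro continuous_intros cont F u)
  have contd: "continuous_on (sphere 0 1) (d k)" for k unfolding d_def by (intro continuous_intros cont a_hardy_infty b_hardy_infty)
  have in_disk: "of_real (radius k) * \<zeta> \<in> unit_disk" if "\<zeta> \<in> sphere 0 1" for k \<zeta>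
    using radius_disk[OF that] radius_bounds[of k] by simp
  have Pb: "cmod (P k \<zeta>) \<le> A * B" if "\<zeta> \<in> sphere 0 1" for k \<zeta>
    unfolding P_def norm_mult complex_mod_cnj by (intro mult_mono A B in_disk that) auto
  have db: "\<bar>d k \<zeta>\<bar> \<le> 1" if "\<zeta> \<in> sphere 0 1" for k \<zeta>
  proof -
    have "(cmod (b (of_real (radius k) * \<zeta>)))\<^sup>2 \<le> 1" "(cmod (a (of_real (radius k) * \<zeta>)))\<^sup>2 \<le> 1"
      using a_bound[OF in_disk[OF that]] b_bound[OF in_disk[OF that]] by (auto simp: power_le_one)
    moreover have "0 \<le> (cmod (b (of_real (radius k) * \<zeta>)))\<^sup>2" "0 \<le> (cmod (a (of_real (radius k) * \<zeta>)))\<^sup>2" by auto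
    ultimately show ?thesis unfolding d_def abs_le_iff by linarith
  qed
  have D: "(\<lambda>k. CINT \<zeta>. of_real (d k \<zeta>) * P k \<zeta>) \<longlonglongrightarrow> (CINT \<zeta>. 0)"
  proof (rule integral_dominated_convergence[where w = "\<lambda>_. A * B"])
    show "(\<lambda>\<zeta>. of_real (d k \<zeta>) * P k \<zeta>) \<in> borel_measurable circle_measure" for k
      by (intro circle_measurable_if_continuous continuous_intros contd contP)
    show "AE \<zeta> in circle_measure. norm (of_real (d k \<zeta>) * P k \<zeta>) \<le> A * B" for k
    proof (rule AE_I2)
      fix \<zeta> assume "\<zeta> \<in> space circle_measure"
      then have "\<zeta> \<in> sphere 0 1" by (simp add: space_circle_measure)
      then have "norm (of_real (d k \<zeta>) * P k \<zeta>) \<le> 1 * (A * B)"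
        unfolding norm_mult norm_of_real by (intro mult_mono db Pb) auto
      then show "norm (of_real (d k \<zeta>) * P k \<zeta>) \<le> A * B" by simp
    qed
    have "AE \<zeta> in circle_measure. \<exists>\<alpha> \<beta>. has_radial_limit a \<zeta> \<alpha> \<and> has_radial_limit b \<zeta> \<beta> \<and> (cmod \<alpha>)\<^sup>2 + (cmod \<beta>)\<^sup>2 = 1"
      using mate by (simp add: pythagorean_mate_def)
    then show "AE \<zeta> in circle_measure. (\<lambda>k. of_real (d k \<zeta>) * P k \<zeta>) \<longlonglongrightarrow> 0"
    proof (rule AE_mp, intro AE_I2 impI)
      fix \<zeta> assume sp: "\<zeta> \<in> space circle_measure"
        and "\<exists>\<alpha> \<beta>. has_radial_limit a \<zeta> \<alpha> \<and> has_radial_limit b \<zeta> \<beta> \<and> (cmod \<alpha>)\<^sup>2 + (cmod \<beta>)\<^sup>2 = 1"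
      then obtain \<alpha> \<beta> where l: "has_radial_limit a \<zeta> \<alpha>" "has_radial_limit b \<zeta> \<beta>" "(cmod \<alpha>)\<^sup>2 + (cmod \<beta>)\<^sup>2 = 1" by blast
      have "(\<lambda>k. a (of_real (radius k) * \<zeta>)) \<longlonglongrightarrow> \<alpha>" "(\<lambda>k. b (of_real (radius k) * \<zeta>)) \<longlonglongrightarrow> \<beta>"
        using l filterlim_compose[OF _ radius_at_left] unfolding has_radial_limit_def by blast+
      then have "(\<lambda>k. d k \<zeta>) \<longlonglongrightarrow> (cmod \<beta>)\<^sup>2 + (cmod \<alpha>)\<^sup>2 - 1"
        unfolding d_def by (intro tendsto_intros)
      then have d0: "(\<lambda>k. d k \<zeta>) \<longlonglongrightarrow> 0" using l(3) by (simp add: add.commute)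
      show "(\<lambda>k. of_real (d k \<zeta>) * P k \<zeta>) \<longlonglongrightarrow> 0"
      proof (rule Lim_null_comparison)
        have "norm (of_real (d k \<zeta>) * P k \<zeta>) \<le> \<bar>d k \<zeta>\<bar> * (A * B)" for k
          unfolding norm_mult norm_of_real using sp by (intro mult_left_mono Pb) (auto simp: space_circle_measure)
        then show "\<forall>\<^sub>F k in sequentially. norm (of_real (d k \<zeta>) * P k \<zeta>) \<le> \<bar>d k \<zeta>\<bar> * (A * B)" by simp
        show "(\<lambda>k. \<bar>d k \<zeta>\<bar> * (A * B)) \<longlonglongrightarrow> 0"
          using tendsto_mult_right[OF tendsto_rabs[OF d0], of "A * B"] by simp
      qed
    qed
  qed auto
  define J where "J c k = (CINT \<zeta>. c (of_real (radius k) * \<zeta>) * F (of_real (radius k) * \<zeta>)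
      * cnj (c (of_real (radius k) * \<zeta>) * u (of_real (radius k) * \<zeta>)))" for c k
  have J: "integrable circle_measure (\<lambda>\<zeta>. c (of_real (radius k) * \<zeta>) * F (of_real (radius k) * \<zeta>)
      * cnj (c (of_real (radius k) * \<zeta>) * u (of_real (radius k) * \<zeta>)))" if "c \<in> hardy_infty" for c k
    by (intro circle_integrable_if_continuous continuous_intros cont F u that)
  have "(CINT \<zeta>. of_real (d k \<zeta>) * P k \<zeta>) = J b k + J a k - J (\<lambda>_. 1) k" for k
    unfolding J_def Bochner_Integration.integral_add[OF J[OF b_hardy_infty] J[OF a_hardy_infty], symmetric]
      Bochner_Integration.integral_diff[OF Bochner_Integration.integrable_add[OF J[OF b_hardy_infty] J[OF a_hardy_infty]]
        J[OF hardy_infty_const], symmetric]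
    by (intro Bochner_Integration.integral_cong refl)
       (simp add: d_def P_def complex_norm_square algebra_simps del: of_real_power)
  with D have "(\<lambda>k. J b k + J a k - J (\<lambda>_. 1) k) \<longlonglongrightarrow> 0" by simp
  moreover have "(\<lambda>k. J b k + J a k - J (\<lambda>_. 1) k)
      \<longlonglongrightarrow> ip2 (\<lambda>z. b z * F z) (\<lambda>z. b z * u z) + ip2 (\<lambda>z. a z * F z) (\<lambda>z. a z * u z) - ip2 F u"
  proof (intro tendsto_diff tendsto_add)
    show "J b \<longlonglongrightarrow> ip2 (\<lambda>z. b z * F z) (\<lambda>z. b z * u z)"
      unfolding J_def[abs_def] by (rule ip2_radial_limit[OF b_mult_H2[OF F] b_mult_H2[OF u]])
    show "J a \<longlonglongrightarrow> ip2 (\<lambda>z. a z * F z) (\<lambda>z. a z * u z)"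
      unfolding J_def[abs_def] by (rule ip2_radial_limit[OF a_mult_H2[OF F] a_mult_H2[OF u]])
    show "J (\<lambda>_. 1) \<longlonglongrightarrow> ip2 F u"
      using ip2_radial_limit[OF H2_if_hardy_infty[OF F] H2_if_hardy_infty[OF u]] by (simp add: J_def[abs_def])
  qed
  ultimately have "ip2 (\<lambda>z. b z * F z) (\<lambda>z. b z * u z) + ip2 (\<lambda>z. a z * F z) (\<lambda>z. a z * u z) - ip2 F u = 0"
    using LIMSEQ_unique by blast
  then show ?thesis by simp
qed

text \<open>
  In terms of Toeplitz operators, \<open>T(cnj b) f = T(cnj a) g\<close>, tested against bounded analytic functions.
\<close>

definition companion :: "(complex \<Rightarrow> complex) \<Rightarrow> (complex \<Rightarrow> complex) \<Rightarrow> bool"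
  where "companion f g \<longleftrightarrow> f \<in> H2 \<and> g \<in> H2 \<and>
    (\<forall>u\<in>hardy_infty. ip2 f (\<lambda>z. b z * u z) = ip2 g (\<lambda>z. a z * u z))"

text \<open>
  Within \<open>H2\<close>, this is the domain of the Toeplitz operator with the unbounded symbol \<open>cnj (b / a)\<close>, and
  \<open>plus_part\<close> below is that operator.
\<close>

definition dBR_model :: "(complex \<Rightarrow> complex) set"
  where "dBR_model = {f. \<exists>g. companion f g}"

definition plus_part :: "(complex \<Rightarrow> complex) \<Rightarrow> complex \<Rightarrow> complex"
  where "plus_part f = (SOME g. companion f g)"

definition dBR_ip :: "(complex \<Rightarrow> complex) \<Rightarrow> (complex \<Rightarrow> complex) \<Rightarrow> complex"
  where "dBR_ip f g = ip2 f g + ip2 (plus_part f) (plus_part g)"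

text \<open>
  The products of \<open>a\<close> with its approximate inverses converge to \<open>1\<close> boundedly, hence weakly; so the
  Szego kernel at \<open>w\<close> is a weak limit of functions \<open>a u\<close>.
\<close>

lemma a_range_dense:
  assumes g: "g \<in> H2" and orth: "\<And>u. u \<in> hardy_infty \<Longrightarrow> ip2 g (\<lambda>z. a z * u z) = 0" and w: "w \<in> unit_disk"
  shows "g w = 0"
proof -
  have "outer a" using mate by (simp add: pythagorean_mate_def)
  from outer_approximants[OF this] obtain E where E_props: "(\<forall>n. E n \<in> hardy_infty) \<and>
    (\<forall>n. \<forall>z\<in>unit_disk. cmod (a z * E n z) \<le> 1) \<and> (\<forall>z\<in>unit_disk. (\<lambda>n. a z * E n z) \<longlonglongrightarrow> 1)" ..
  have E: "E n \<in> hardy_infty" "z \<in> unit_disk \<Longrightarrow> cmod (a z * E n z) \<le> 1"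
    "z \<in> unit_disk \<Longrightarrow> (\<lambda>n. a z * E n z) \<longlonglongrightarrow> 1" for n z
    using E_props by simp_all
  obtain B where B: "0 \<le> B" "\<And>z. z \<in> unit_disk \<Longrightarrow> cmod (szego w z) \<le> B"
    using hardy_infty_bound[OF szego_hardy_infty[OF w]] by blast
  have Ou: "(\<lambda>z. E n z * szego w z) \<in> hardy_infty" for n
    by (intro hardy_infty_mult E szego_hardy_infty w)
  have "(\<lambda>n. ip2 (\<lambda>z. a z * (E n z * szego w z)) g) \<longlonglongrightarrow> ip2 (szego w) g"
  proof (rule H2_bounded_pointwise_limit(2)[where B = B])
    show "(\<lambda>z. a z * (E n z * szego w z)) holomorphic_on unit_disk" for n
      by (intro hardy_infty_holomorphic a_mult Ou)
    show "cmod (a z * (E n z * szego w z)) \<le> B" if z: "z \<in> unit_disk" for n z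
    proof -
      have "cmod (a z * E n z) * cmod (szego w z) \<le> 1 * B" by (intro mult_mono E B z) auto
      then show ?thesis by (simp add: norm_mult mult.assoc)
    qed
    show "(\<lambda>n. a z * (E n z * szego w z)) \<longlonglongrightarrow> szego w z" if z: "z \<in> unit_disk" for z
      using tendsto_mult_right[OF E(3)[OF z], of "szego w z"] by (simp add: mult.assoc)
  qed (use g hardy_infty_holomorphic[OF szego_hardy_infty[OF w]] in auto)
  moreover have "ip2 (\<lambda>z. a z * (E n z * szego w z)) g = 0" for n
    using H2.ip_commute[OF g a_mult_H2[OF Ou]] orth[OF Ou, of n] by simp
  ultimately have "ip2 (szego w) g = 0" by (simp add: LIMSEQ_const_iff)
  then show ?thesis
    using H2.ip_commute[OF g H2_if_hardy_infty[OF szego_hardy_infty[OF w]]] ip2_szego[OF holomorphic_if_H2[OF g] w]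
    by simp
qed

lemma companion_unique:
  assumes "companion f g" "companion f' g'" "\<And>z. z \<in> unit_disk \<Longrightarrow> f z = f' z" "z \<in> unit_disk"
  shows "g z = g' z"
proof -
  have H: "g \<in> H2" "g' \<in> H2" using assms by (auto simp: companion_def)
  have "(\<lambda>z. g z - g' z) z = 0"
  proof (rule a_range_dense[OF H2.diff_mem[OF H] _ assms(4)])
    fix u assume u: "u \<in> hardy_infty"
    have "ip2 f (\<lambda>z. b z * u z) = ip2 f' (\<lambda>z. b z * u z)" by (rule ip2_cong) (use assms(3) in auto)
    then show "ip2 (\<lambda>z. g z - g' z) (\<lambda>z. a z * u z) = 0"
      using assms(1,2) u by (simp add: H2.ip_diff[OF H a_mult_H2[OF u]] companion_def)
  qed
  then show ?thesis by simp
qed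

lemma companion_plus_part: "f \<in> dBR_model \<Longrightarrow> companion f (plus_part f)"
  using someI_ex[of "companion f"] by (auto simp: dBR_model_def plus_part_def)

lemma dBR_modelI: "companion f g \<Longrightarrow> f \<in> dBR_model"
  by (auto simp: dBR_model_def)

lemma plus_part_eq: "companion f g \<Longrightarrow> z \<in> unit_disk \<Longrightarrow> plus_part f z = g z"
  using companion_unique[OF companion_plus_part[OF dBR_modelI]] by blast

lemma plus_part_H2: "f \<in> dBR_model \<Longrightarrow> plus_part f \<in> H2" and dBR_model_H2: "f \<in> dBR_model \<Longrightarrow> f \<in> H2"
  using companion_plus_part by (auto simp: companion_def)

lemma companion_add: "companion f g \<Longrightarrow> companion f' g' \<Longrightarrow> companion (\<lambda>z. f z + f' z) (\<lambda>z. g z + g' z)"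
  by (simp add: companion_def H2.ip_add a_mult_H2 b_mult_H2 H2_add)

lemma companion_scale: "companion f g \<Longrightarrow> companion (\<lambda>z. c * f z) (\<lambda>z. c * g z)"
  by (simp add: companion_def H2.ip_scale a_mult_H2 b_mult_H2 H2_scale)

lemma companion_diff: "companion f g \<Longrightarrow> companion f' g' \<Longrightarrow> companion (\<lambda>z. f z - f' z) (\<lambda>z. g z - g' z)"
  by (simp add: companion_def H2.ip_diff a_mult_H2 b_mult_H2 H2.diff_mem)

lemma companion_cong:
  assumes "companion f g" "\<And>z. z \<in> unit_disk \<Longrightarrow> f' z = f z" "\<And>z. z \<in> unit_disk \<Longrightarrow> g' z = g z"
  shows "companion f' g'"
proof -
  have "ip2 f' (\<lambda>z. b z * u z) = ip2 f (\<lambda>z. b z * u z)" "ip2 g' (\<lambda>z. a z * u z) = ip2 g (\<lambda>z. a z * u z)" for u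
    by (rule ip2_cong; use assms in simp)+
  moreover have "f' \<in> H2" "g' \<in> H2"
    using assms by (auto simp: companion_def intro: H2_cong)
  ultimately show ?thesis using assms(1) by (simp add: companion_def)
qed

lemma companion_zero: "companion (\<lambda>z. 0) (\<lambda>z. 0)"
  by (simp add: companion_def H2_zero ip2_zero_left)

lemma dBR_ip_eq:
  assumes "companion f g" "companion f' g'"
  shows "dBR_ip f f' = ip2 f f' + ip2 g g'"
  unfolding dBR_ip_def using ip2_cong[of "plus_part f" g "plus_part f'" g'] plus_part_eq assms by simp

text \<open>
  Let \<open>s\<close> be the Szego kernel at \<open>w\<close>.  The kernel of \<open>\<H>(b)\<close> is \<open>s - cnj (b w) b s\<close>, and pairing it with \<open>b u\<close>
  gives \<open>cnj (b w) (\<langle>s, u\<rangle> - \<langle>b s, b u\<rangle>)\<close>.  By the Pythagorean identity this is \<open>cnj (b w) \<langle>a s, a u\<rangle>\<close>.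
\<close>

lemma companion_kernel:
  assumes w: "w \<in> unit_disk"
  shows "companion (dBR_kernel b w) (\<lambda>z. cnj (b w) * (a z * szego w z))"
proof -
  note S = szego_hardy_infty[OF w]
  have k: "dBR_kernel b w = (\<lambda>z. szego w z - cnj (b w) * (b z * szego w z))"
    by (auto simp: dBR_kernel_def szego_def diff_divide_distrib)
  have "ip2 (dBR_kernel b w) (\<lambda>z. b z * u z) = ip2 (\<lambda>z. cnj (b w) * (a z * szego w z)) (\<lambda>z. a z * u z)"
    if u: "u \<in> hardy_infty" for u
  proof -
    have 1: "ip2 (szego w) f = cnj (f w)" if "f \<in> hardy_infty" for f
      using H2.ip_commute[OF H2_if_hardy_infty[OF that] H2_if_hardy_infty[OF S]]
        ip2_szego[OF hardy_infty_holomorphic[OF that] w] by simp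
    have "ip2 (dBR_kernel b w) (\<lambda>z. b z * u z)
        = cnj (b w * u w) - cnj (b w) * ip2 (\<lambda>z. b z * szego w z) (\<lambda>z. b z * u z)"
      unfolding k using 1[OF b_mult[OF u]]
      by (simp add: H2.ip_diff H2.ip_scale H2_scale b_mult_H2 u S H2_if_hardy_infty)
    also have "\<dots> = cnj (b w) * (cnj (u w) - ip2 (\<lambda>z. b z * szego w z) (\<lambda>z. b z * u z))"
      by (simp add: algebra_simps)
    also have "cnj (u w) - ip2 (\<lambda>z. b z * szego w z) (\<lambda>z. b z * u z) = ip2 (\<lambda>z. a z * szego w z) (\<lambda>z. a z * u z)"
      using pythagorean_isometry[OF S u] 1[OF u] by (simp add: algebra_simps)
    finally show ?thesis by (simp add: H2.ip_scale a_mult_H2 u S)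
  qed
  then show ?thesis
    unfolding companion_def k
    by (intro conjI ballI H2.diff_mem H2_scale a_mult_H2 b_mult_H2 H2_if_hardy_infty[OF S] S) simp
qed

lemma dBR_ip_definite:
  assumes H: "f \<in> dBR_model"
  shows "dBR_ip f f = 0 \<longleftrightarrow> (\<forall>x\<in>unit_disk. f x = 0)"
proof
  assume "dBR_ip f f = 0"
  then have "Re (ip2 f f) + Re (ip2 (plus_part f) (plus_part f)) = 0" by (simp add: dBR_ip_def flip: plus_complex.sel)
  then have "Re (ip2 f f) = 0"
    using H2.ip_nonneg[OF dBR_model_H2[OF H]] H2.ip_nonneg[OF plus_part_H2[OF H]] by linarith
  then show "\<forall>x\<in>unit_disk. f x = 0" using H2_nrm_zero[OF dBR_model_H2[OF H]] by (simp add: H2.nrm_def)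
next
  assume z: "\<forall>x\<in>unit_disk. f x = 0"
  have "companion f (\<lambda>z. 0)" by (rule companion_cong[OF companion_zero]) (use z in auto)
  from this this have "dBR_ip f f = ip2 f f + ip2 (\<lambda>z. 0) (\<lambda>z. 0)" by (rule dBR_ip_eq)
  also have "ip2 f f = ip2 (\<lambda>z. 0) (\<lambda>z. 0)" by (rule ip2_cong) (use z in auto)
  finally show "dBR_ip f f = 0" by (simp add: ip2_zero_left)
qed

text \<open>
  The squared norm is the sum of the squared norms of a function and its companion, so both
  components converge in \<open>H2\<close>; the defining relation is closed under these limits.
\<close>

lemma dBR_model_complete:
  fixes F :: "nat \<Rightarrow> complex \<Rightarrow> complex"
  assumes F: "\<And>n. F n \<in> dBR_model"
    and C: "\<And>e. 0 < e \<Longrightarrow> \<exists>N. \<forall>m\<ge>N. \<forall>n\<ge>N. sqrt (Re (dBR_ip (\<lambda>x. F m x - F n x) (\<lambda>x. F m x - F n x))) < e"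
  shows "\<exists>f\<in>dBR_model. (\<lambda>n. sqrt (Re (dBR_ip (\<lambda>x. F n x - f x) (\<lambda>x. F n x - f x)))) \<longlonglongrightarrow> 0"
proof -
  have nb: "Re (dBR_ip (\<lambda>x. f x - f' x) (\<lambda>x. f x - f' x)) = (H2.nrm (\<lambda>x. f x - f' x))\<^sup>2 + (H2.nrm (\<lambda>x. g x - g' x))\<^sup>2"
    if c: "companion f g" "companion f' g'" for f f' g g'
  proof -
    have "f \<in> H2" "g \<in> H2" "f' \<in> H2" "g' \<in> H2" using c by (auto simp: companion_def)
    then show ?thesis
      using dBR_ip_eq[OF companion_diff[OF c] companion_diff[OF c]] by (simp add: H2.nrm_sq H2.diff_mem)
  qed
  note nF = nb[OF companion_plus_part[OF F] companion_plus_part[OF F]]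
  have le: "H2.nrm (\<lambda>z. F m z - F n z) \<le> sqrt (Re (dBR_ip (\<lambda>x. F m x - F n x) (\<lambda>x. F m x - F n x)))"
    "H2.nrm (\<lambda>z. plus_part (F m) z - plus_part (F n) z) \<le> sqrt (Re (dBR_ip (\<lambda>x. F m x - F n x) (\<lambda>x. F m x - F n x)))" for m n
    unfolding nF by (auto intro: real_le_rsqrt)
  have "\<exists>f\<in>H2. (\<lambda>n. H2.nrm (\<lambda>z. F n z - f z)) \<longlonglongrightarrow> 0"
  proof (rule H2_complete[OF dBR_model_H2[OF F]])
    fix e :: real assume "0 < e"
    from C[OF this] obtain N where "\<forall>m\<ge>N. \<forall>n\<ge>N. sqrt (Re (dBR_ip (\<lambda>x. F m x - F n x) (\<lambda>x. F m x - F n x))) < e" ..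
    then show "\<exists>N. \<forall>m\<ge>N. \<forall>n\<ge>N. H2.nrm (\<lambda>z. F m z - F n z) < e"
      using order_le_less_trans[OF le(1)] by blast
  qed
  then obtain f where f: "f \<in> H2" "(\<lambda>n. H2.nrm (\<lambda>z. F n z - f z)) \<longlonglongrightarrow> 0" by blast
  have "\<exists>g\<in>H2. (\<lambda>n. H2.nrm (\<lambda>z. plus_part (F n) z - g z)) \<longlonglongrightarrow> 0"
  proof (rule H2_complete[OF plus_part_H2[OF F]])
    fix e :: real assume "0 < e"
    from C[OF this] obtain N where "\<forall>m\<ge>N. \<forall>n\<ge>N. sqrt (Re (dBR_ip (\<lambda>x. F m x - F n x) (\<lambda>x. F m x - F n x))) < e" ..
    then show "\<exists>N. \<forall>m\<ge>N. \<forall>n\<ge>N. H2.nrm (\<lambda>z. plus_part (F m) z - plus_part (F n) z) < e"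
      using order_le_less_trans[OF le(2)] by blast
  qed
  then obtain g where g: "g \<in> H2" "(\<lambda>n. H2.nrm (\<lambda>z. plus_part (F n) z - g z)) \<longlonglongrightarrow> 0" by blast
  have "companion f g"
    unfolding companion_def
  proof (intro conjI ballI f g)
    fix u assume u: "u \<in> hardy_infty"
    have "(\<lambda>n. ip2 (F n) (\<lambda>z. b z * u z)) \<longlonglongrightarrow> ip2 f (\<lambda>z. b z * u z)"
      by (rule ip2_tendsto_if_nrm[OF dBR_model_H2[OF F] f(1) b_mult_H2[OF u] f(2)])
    moreover have "(\<lambda>n. ip2 (plus_part (F n)) (\<lambda>z. a z * u z)) \<longlonglongrightarrow> ip2 g (\<lambda>z. a z * u z)"
      by (rule ip2_tendsto_if_nrm[OF plus_part_H2[OF F] g(1) a_mult_H2[OF u] g(2)])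
    moreover have "ip2 (F n) (\<lambda>z. b z * u z) = ip2 (plus_part (F n)) (\<lambda>z. a z * u z)" for n
      using companion_plus_part[OF F] u by (simp add: companion_def)
    ultimately show "ip2 f (\<lambda>z. b z * u z) = ip2 g (\<lambda>z. a z * u z)" using LIMSEQ_unique by fastforce
  qed
  note c = this
  have "(\<lambda>n. sqrt ((H2.nrm (\<lambda>x. F n x - f x))\<^sup>2 + (H2.nrm (\<lambda>x. plus_part (F n) x - g x))\<^sup>2)) \<longlonglongrightarrow> sqrt (0\<^sup>2 + 0\<^sup>2)"
    by (intro tendsto_real_sqrt tendsto_add tendsto_power f g)
  then have "(\<lambda>n. sqrt (Re (dBR_ip (\<lambda>x. F n x - f x) (\<lambda>x. F n x - f x)))) \<longlonglongrightarrow> 0"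
    unfolding nb[OF companion_plus_part[OF F] c] by simp
  then show "\<exists>f\<in>dBR_model. (\<lambda>n. sqrt (Re (dBR_ip (\<lambda>x. F n x - f x) (\<lambda>x. F n x - f x)))) \<longlonglongrightarrow> 0" by (rule bexI[OF _ dBR_modelI[OF c]])
qed

text \<open>
  The two terms that contain \<open>b w\<close> cancel by the defining relation of the companion, tested with the
  Szego kernel at \<open>w\<close>.
\<close>

lemma dBR_ip_reproducing:
  assumes H: "f \<in> dBR_model" and w: "w \<in> unit_disk"
  shows "f w = dBR_ip f (dBR_kernel b w)"
proof -
  note S = szego_hardy_infty[OF w]
  have k: "dBR_kernel b w = (\<lambda>z. szego w z - cnj (b w) * (b z * szego w z))"
    by (auto simp: dBR_kernel_def szego_def diff_divide_distrib)
  have "dBR_ip f (dBR_kernel b w) = ip2 f (dBR_kernel b w) + ip2 (plus_part f) (\<lambda>z. cnj (b w) * (a z * szego w z))"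
    by (rule dBR_ip_eq[OF companion_plus_part[OF H] companion_kernel[OF w]])
  also have "\<dots> = f w - b w * ip2 f (\<lambda>z. b z * szego w z) + b w * ip2 (plus_part f) (\<lambda>z. a z * szego w z)"
    unfolding k using ip2_szego[OF holomorphic_if_H2[OF dBR_model_H2[OF H]] w]
    by (simp add: H2.ip_diff_right H2.ip_scale_right H2_scale a_mult_H2 b_mult_H2 S H2_if_hardy_infty dBR_model_H2 plus_part_H2 H)
  also have "ip2 f (\<lambda>z. b z * szego w z) = ip2 (plus_part f) (\<lambda>z. a z * szego w z)"
    using companion_plus_part[OF H] S by (simp add: companion_def)
  finally show "f w = dBR_ip f (dBR_kernel b w)" by simp
qed

lemma rkhs_dBR_model: "rkhs unit_disk (dBR_kernel b) dBR_model dBR_ip"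
proof
  fix f g :: "complex \<Rightarrow> complex" assume "f \<in> dBR_model" "\<And>x. x \<in> unit_disk \<Longrightarrow> g x = f x"
  then show "g \<in> dBR_model" by (rule dBR_modelI[OF companion_cong[OF companion_plus_part _ refl]])
next
  show "(\<lambda>x. 0) \<in> dBR_model" by (rule dBR_modelI[OF companion_zero])
next
  fix f g assume "f \<in> dBR_model" "g \<in> dBR_model"
  then show "(\<lambda>x. f x + g x) \<in> dBR_model" by (rule dBR_modelI[OF companion_add[OF companion_plus_part companion_plus_part]])
next
  fix f c assume "f \<in> dBR_model"
  then show "(\<lambda>x. c * f x) \<in> dBR_model" by (rule dBR_modelI[OF companion_scale[OF companion_plus_part]])
next
  fix f g h assume H: "f \<in> dBR_model" "g \<in> dBR_model" "h \<in> dBR_model"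
  show "dBR_ip (\<lambda>x. f x + g x) h = dBR_ip f h + dBR_ip g h"
    using dBR_ip_eq[OF companion_add[OF companion_plus_part[OF H(1)] companion_plus_part[OF H(2)]] companion_plus_part[OF H(3)]]
    by (simp add: dBR_ip_def H2.ip_add plus_part_H2 dBR_model_H2 H)
next
  fix f g c assume H: "f \<in> dBR_model" "g \<in> dBR_model"
  show "dBR_ip (\<lambda>x. c * f x) g = c * dBR_ip f g"
    using dBR_ip_eq[OF companion_scale[OF companion_plus_part[OF H(1)]] companion_plus_part[OF H(2)]]
    by (simp add: dBR_ip_def H2.ip_scale plus_part_H2 dBR_model_H2 H distrib_left)
next
  fix f g assume H: "f \<in> dBR_model" "g \<in> dBR_model"
  show "dBR_ip g f = cnj (dBR_ip f g)"
    using H2.ip_commute[OF dBR_model_H2[OF H(1)] dBR_model_H2[OF H(2)]] H2.ip_commute[OF plus_part_H2[OF H(1)] plus_part_H2[OF H(2)]]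
    by (simp add: dBR_ip_def)
next
  fix f assume H: "f \<in> dBR_model"
  show "0 \<le> Re (dBR_ip f f)" by (simp add: dBR_ip_def H2.ip_nonneg dBR_model_H2 plus_part_H2 H)
  show "dBR_ip f f = 0 \<longleftrightarrow> (\<forall>x\<in>unit_disk. f x = 0)" by (rule dBR_ip_definite[OF H])
next
  fix w :: complex assume "w \<in> unit_disk"
  then show "dBR_kernel b w \<in> dBR_model" by (rule dBR_modelI[OF companion_kernel])
qed (fact dBR_model_complete dBR_ip_reproducing)+

lemma dBR_space_eq: "dBR_space b = dBR_model"
  unfolding dBR_space_def
proof (rule the_equality)
  show "(\<forall>f\<in>dBR_model. f holomorphic_on unit_disk) \<and> (\<exists>ip. rkhs unit_disk (dBR_kernel b) dBR_model ip)"
    using rkhs_dBR_model dBR_model_H2 holomorphic_if_H2 by blast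
qed (use rkhs_dBR_model rkhs_unique in blast)

interpretation dBR: rkhs unit_disk "dBR_kernel b" dBR_model dBR_ip by (rule rkhs_dBR_model)

lemma ip2_szego_comb:
  assumes "f \<in> H2"
  shows "xs \<in> combs unit_disk \<Longrightarrow> kernel_comb szego xs \<in> hardy_infty \<and> ip2 f (kernel_comb szego xs) = dual_comb f xs"
proof (induction xs)
  case Nil
  have "ip2 f (\<lambda>z. 0) = 0" using H2.ip_scale_right[OF assms assms, of 0] by simp
  then show ?case using hardy_infty_const[of 0] by (simp add: kernel_comb_simps dual_comb_simps)
next
  case (Cons x xs)
  obtain c w where x: "x = (c, w)" by force
  have w: "w \<in> unit_disk" and xs: "xs \<in> combs unit_disk" using Cons.prems by (simp_all add: x)
  note S = szego_hardy_infty[OF w] and IH = Cons.IH[OF xs]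
  then show ?case
    using assms ip2_szego[OF holomorphic_if_H2[OF assms] w]
    by (simp add: x kernel_comb_simps dual_comb_simps hardy_infty_add hardy_infty_scale
        H2.ip_add_right H2.ip_scale_right H2_scale H2_if_hardy_infty)
qed

text \<open>
  By linearity from a single kernel; \<open>v\<close> is the Szego combination in which the coefficient at \<open>w\<close> is
  multiplied by \<open>cnj (b w)\<close>.
\<close>

lemma companion_kernel_comb:
  "xs \<in> combs unit_disk \<Longrightarrow> \<exists>v\<in>hardy_infty.
    kernel_comb (dBR_kernel b) xs = (\<lambda>z. kernel_comb szego xs z - b z * v z) \<and>
    companion (kernel_comb (dBR_kernel b) xs) (\<lambda>z. a z * v z)"
proof (induction xs)
  case Nil
  then show ?case using hardy_infty_const[of 0] companion_zero
    by (intro bexI[of _ "\<lambda>z. 0"]) (auto simp: kernel_comb_simps)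
next
  case (Cons x xs)
  obtain c w where x: "x = (c, w)" by force
  have w: "w \<in> unit_disk" and xs: "xs \<in> combs unit_disk" using Cons.prems by (simp_all add: x)
  obtain v where v: "v \<in> hardy_infty" "kernel_comb (dBR_kernel b) xs = (\<lambda>z. kernel_comb szego xs z - b z * v z)"
    "companion (kernel_comb (dBR_kernel b) xs) (\<lambda>z. a z * v z)" using Cons.IH[OF xs] by blast
  define v' where "v' z = c * cnj (b w) * szego w z + v z" for z
  have k: "dBR_kernel b w z = szego w z - cnj (b w) * (b z * szego w z)" for z
    by (auto simp: dBR_kernel_def szego_def diff_divide_distrib)
  have "v' \<in> hardy_infty" unfolding v'_def by (intro hardy_infty_add hardy_infty_scale szego_hardy_infty w v)
  moreover have "kernel_comb (dBR_kernel b) (x # xs) = (\<lambda>z. kernel_comb szego (x # xs) z - b z * v' z)"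
    by (simp add: x kernel_comb_simps v(2) v'_def k algebra_simps)
  moreover have "companion (kernel_comb (dBR_kernel b) (x # xs)) (\<lambda>z. a z * v' z)"
    using companion_add[OF companion_scale[OF companion_kernel[OF w], of c] v(3)]
    unfolding x kernel_comb_simps by (simp add: v'_def algebra_simps)
  ultimately show ?case by blast
qed

text \<open>
  For a kernel combination \<open>k = g - b v\<close> with companion \<open>a v\<close> the dual value of \<open>f\<close> is
  \<open>\<langle>f, g\<rangle> = \<langle>f, k\<rangle> + \<langle>f, b v\<rangle>\<close>, and both \<open>\<parallel>k\<parallel>\<close> and \<open>\<parallel>a v\<parallel>\<close> are at most the norm of the combination in \<open>\<H>(b)\<close>.
  Hence the dual criterion for reproducing kernel spaces applies.
\<close>

lemma dBR_space_memI:
  assumes f: "f \<in> H2" and bd: "\<And>u. u \<in> hardy_infty \<Longrightarrow> cmod (ip2 f (\<lambda>z. b z * u z)) \<le> C * H2.nrm (\<lambda>z. a z * u z)"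
    and C: "0 \<le> C"
  shows "f \<in> dBR_space b"
  unfolding dBR_space_eq
proof (rule dBR.mem_if_dual_bounded)
  fix xs :: "(complex \<times> complex) list" assume xs: "xs \<in> combs unit_disk"
  obtain v where v: "v \<in> hardy_infty" and k: "kernel_comb (dBR_kernel b) xs = (\<lambda>z. kernel_comb szego xs z - b z * v z)"
    and c: "companion (kernel_comb (dBR_kernel b) xs) (\<lambda>z. a z * v z)" using companion_kernel_comb[OF xs] by blast
  let ?k = "kernel_comb (dBR_kernel b) xs" and ?g = "kernel_comb szego xs"
  have g: "?g \<in> H2" using ip2_szego_comb[OF f xs] H2_if_hardy_infty by blast
  have kH: "?k \<in> H2" using c by (simp add: companion_def)
  have n: "(dBR.nrm ?k)\<^sup>2 = (H2.nrm ?k)\<^sup>2 + (H2.nrm (\<lambda>z. a z * v z))\<^sup>2"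
    using dBR.nrm_sq[OF dBR_modelI[OF c]] dBR_ip_eq[OF c c] by (simp add: H2.nrm_sq kH a_mult_H2 v)
  have n1: "H2.nrm ?k \<le> dBR.nrm ?k" and n2: "H2.nrm (\<lambda>z. a z * v z) \<le> dBR.nrm ?k"
    by (rule power2_le_imp_le, use n dBR.nrm_nonneg[OF dBR_modelI[OF c]] in auto)+
  have "dual_comb f xs = ip2 f ?k + ip2 f (\<lambda>z. b z * v z)"
    using ip2_szego_comb[OF f xs] H2.ip_diff_right[OF g b_mult_H2[OF v] f] unfolding k by simp
  then have "cmod (dual_comb f xs) \<le> cmod (ip2 f ?k) + cmod (ip2 f (\<lambda>z. b z * v z))"
    using norm_triangle_ineq by metis
  also have "\<dots> \<le> H2.nrm f * H2.nrm ?k + C * H2.nrm (\<lambda>z. a z * v z)"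
    by (intro add_mono H2.Cauchy_Schwarz f kH bd v)
  also have "\<dots> \<le> H2.nrm f * dBR.nrm ?k + C * dBR.nrm ?k"
    by (intro add_mono mult_left_mono n1 n2 C H2.nrm_nonneg f)
  finally show "cmod (dual_comb f xs) \<le> (H2.nrm f + C) * dBR.nrm ?k" by (simp add: distrib_right)
qed

lemma dBR_space_memD:
  assumes "f \<in> dBR_space b"
  shows "\<exists>C. \<forall>u\<in>hardy_infty. cmod (ip2 f (\<lambda>z. b z * u z)) \<le> C * H2.nrm (\<lambda>z. a z * u z)"
proof (intro exI ballI)
  have H: "f \<in> dBR_model" using assms by (simp add: dBR_space_eq)
  fix u assume u: "u \<in> hardy_infty"
  have "ip2 f (\<lambda>z. b z * u z) = ip2 (plus_part f) (\<lambda>z. a z * u z)"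
    using companion_plus_part[OF H] u by (simp add: companion_def)
  then show "cmod (ip2 f (\<lambda>z. b z * u z)) \<le> H2.nrm (plus_part f) * H2.nrm (\<lambda>z. a z * u z)"
    using H2.Cauchy_Schwarz[OF plus_part_H2[OF H] a_mult_H2[OF u]] by simp
qed

end

section \<open>From integrability of the quotient to the inclusion\<close>

interpretation circle_L2: semi_inner "{F. continuous_on (sphere 0 1) F}" "\<lambda>F G. CINT \<zeta>. F \<zeta> * cnj (G \<zeta>)"
proof (unfold_locales, unfold mem_Collect_eq)
  fix F G H :: "complex \<Rightarrow> complex" and c
  assume F: "continuous_on (sphere 0 1) F"
  show "continuous_on (sphere 0 1) (\<lambda>x. c * F x)" by (intro continuous_intros F)
  have "(CINT \<zeta>. F \<zeta> * cnj (F \<zeta>)) = of_real (CINT \<zeta>. (cmod (F \<zeta>))\<^sup>2)"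
    by (simp only: complex_norm_square[symmetric] integral_complex_of_real)
  then show "0 \<le> Re (CINT \<zeta>. F \<zeta> * cnj (F \<zeta>))" by simp
  assume G: "continuous_on (sphere 0 1) G"
  have i: "integrable circle_measure (\<lambda>\<zeta>. f \<zeta> * cnj (g \<zeta>))"
    if "continuous_on (sphere 0 1) f" "continuous_on (sphere 0 1) g" for f g :: "complex \<Rightarrow> complex"
    by (intro circle_integrable_if_continuous continuous_intros that)
  show "continuous_on (sphere 0 1) (\<lambda>x. F x + G x)" by (intro continuous_intros F G)
  show "(CINT \<zeta>. c * F \<zeta> * cnj (G \<zeta>)) = c * (CINT \<zeta>. F \<zeta> * cnj (G \<zeta>))"
    by (simp add: mult.assoc)
  have "(CINT \<zeta>. G \<zeta> * cnj (F \<zeta>)) = (CINT \<zeta>. cnj (F \<zeta> * cnj (G \<zeta>)))"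
    by (simp add: mult.commute)
  then show "(CINT \<zeta>. G \<zeta> * cnj (F \<zeta>)) = cnj (CINT \<zeta>. F \<zeta> * cnj (G \<zeta>))"
    by (simp only: integral_bounded_linear[OF bounded_linear_cnj i[OF F G]])
  assume H: "continuous_on (sphere 0 1) H"
  show "(CINT \<zeta>. (F \<zeta> + G \<zeta>) * cnj (H \<zeta>)) = (CINT \<zeta>. F \<zeta> * cnj (H \<zeta>)) + (CINT \<zeta>. G \<zeta> * cnj (H \<zeta>))"
    by (simp add: distrib_right Bochner_Integration.integral_add[OF i[OF F H] i[OF G H]])
qed

lemma circle_L2_nrm: "circle_L2.nrm F = sqrt (CINT \<zeta>. (cmod (F \<zeta>))\<^sup>2)"
proof -
  have "(CINT \<zeta>. F \<zeta> * cnj (F \<zeta>)) = of_real (CINT \<zeta>. (cmod (F \<zeta>))\<^sup>2)"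
    by (simp only: complex_norm_square[symmetric] integral_complex_of_real)
  then show ?thesis by (simp add: circle_L2.nrm_def)
qed

lemma circle_integral_mono:
  fixes F G :: "complex \<Rightarrow> real"
  assumes "continuous_on (sphere 0 1) F" "continuous_on (sphere 0 1) G"
    "\<And>\<zeta>. \<zeta> \<in> sphere 0 1 \<Longrightarrow> F \<zeta> \<le> G \<zeta>"
  shows "(CINT \<zeta>. F \<zeta>) \<le> (CINT \<zeta>. G \<zeta>)"
  by (rule integral_mono) (use assms in \<open>auto simp: space_circle_measure circle_integrable_if_continuous\<close>)

lemma continuous_on_norm_powr:
  fixes F :: "'a::topological_space \<Rightarrow> complex"
  assumes "continuous_on S F" "0 < p"
  shows "continuous_on S (\<lambda>x. cmod (F x) powr p)"
  by (rule continuous_on_powr') (use assms in \<open>auto intro!: continuous_intros\<close>)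

text \<open>
  For holomorphic \<open>f\<close> the integrands are continuous, so the extended integrals in the definition are
  finite real integrals.
\<close>

lemma hardy_iff:
  assumes p: "0 < p"
  shows "f \<in> hardy p \<longleftrightarrow> f holomorphic_on unit_disk \<and>
    (\<exists>K. \<forall>r\<in>{0<..<1}. (CINT \<zeta>. cmod (f (of_real r * \<zeta>)) powr p) \<le> K)"
proof (cases "f holomorphic_on unit_disk")
  case True
  have e: "(\<integral>\<^sup>+ \<zeta>. ennreal (cmod (f (of_real r * \<zeta>)) powr p) \<partial>circle_measure)
      = ennreal (CINT \<zeta>. cmod (f (of_real r * \<zeta>)) powr p)" if "r \<in> {0<..<1}" for r :: real
    using that p True
    by (intro nn_integral_eq_integral circle_integrable_if_continuous continuous_on_norm_powr
        continuous_on_dilation_if_holomorphic) auto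
  let ?I = "\<lambda>r. \<integral>\<^sup>+ \<zeta>. ennreal (cmod (f (of_real r * \<zeta>)) powr p) \<partial>circle_measure"
  let ?J = "\<lambda>r::real. CINT \<zeta>. cmod (f (of_real r * \<zeta>)) powr p"
  have "(SUP r\<in>{0<..<1::real}. ?I r) < \<infinity> \<longleftrightarrow> (\<exists>K. \<forall>r\<in>{0<..<1}. ?J r \<le> K)"
  proof
    assume fin: "(SUP r\<in>{0<..<1::real}. ?I r) < \<infinity>"
    have "?J r \<le> enn2real (SUP r\<in>{0<..<1::real}. ?I r)" if r: "r \<in> {0<..<1}" for r
    proof -
      have "ennreal (?J r) \<le> (SUP r\<in>{0<..<1::real}. ?I r)" unfolding e[OF r, symmetric] using r by (rule SUP_upper)
      then have "enn2real (ennreal (?J r)) \<le> enn2real (SUP r\<in>{0<..<1::real}. ?I r)" using fin by (intro enn2real_mono) auto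
      then show ?thesis by simp
    qed
    then show "\<exists>K. \<forall>r\<in>{0<..<1}. ?J r \<le> K" by blast
  next
    assume "\<exists>K. \<forall>r\<in>{0<..<1}. ?J r \<le> K"
    then obtain K where K: "\<forall>r\<in>{0<..<1}. ?J r \<le> K" by blast
    have "(SUP r\<in>{0<..<1::real}. ?I r) \<le> ennreal K"
      by (rule SUP_least) (use e K in \<open>simp add: ennreal_leI\<close>)
    then show "(SUP r\<in>{0<..<1::real}. ?I r) < \<infinity>" using le_less_trans by fastforce
  qed
  then show ?thesis using True by (simp add: hardy_def)
qed (simp add: hardy_def)

lemma square_le_one_plus_powr:
  fixes x p :: real
  assumes "0 \<le> x" "2 \<le> p" shows "x\<^sup>2 \<le> 1 + x powr p"
proof (cases "x \<le> 1")
  case True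
  then have "x\<^sup>2 \<le> 1" using assms by (simp add: power_le_one)
  then show ?thesis using powr_ge_zero[of x p] by linarith
next
  case False
  then have "x\<^sup>2 = x powr 2" by simp
  also have "\<dots> \<le> x powr p" using False assms by (intro powr_mono) auto
  finally show ?thesis by simp
qed

lemma H2_if_hardy_means:
  assumes p: "2 \<le> p" and f: "f holomorphic_on unit_disk"
    and K: "\<And>r. 0 < r \<Longrightarrow> r < 1 \<Longrightarrow> (CINT \<zeta>. cmod (f (of_real r * \<zeta>)) powr p) \<le> K"
  shows "f \<in> H2" "H2.nrm f \<le> sqrt (1 + K)"
proof -
  have "0 \<le> (CINT \<zeta>. cmod (f (of_real (1/2) * \<zeta>)) powr p)" by simp
  then have K0: "0 \<le> K" using K[of "1/2"] by linarith
  have "(CINT \<zeta>. (cmod (f (of_real (radius k) * \<zeta>)))\<^sup>2) \<le> (sqrt (1 + K))\<^sup>2" for k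
  proof -
    have r: "0 < radius k" "radius k < 1" using radius_bounds by auto
    have c: "continuous_on (sphere 0 1) (\<lambda>\<zeta>. f (of_real (radius k) * \<zeta>))"
      using r f by (intro continuous_on_dilation_if_holomorphic) auto
    have cp: "continuous_on (sphere 0 1) (\<lambda>\<zeta>. cmod (f (of_real (radius k) * \<zeta>)) powr p)"
      using c p by (intro continuous_on_norm_powr) auto
    have "(CINT \<zeta>. (cmod (f (of_real (radius k) * \<zeta>)))\<^sup>2)
        \<le> (CINT \<zeta>. 1 + cmod (f (of_real (radius k) * \<zeta>)) powr p)"
      by (rule circle_integral_mono) (use c cp p in \<open>auto intro!: continuous_intros square_le_one_plus_powr\<close>)
    also have "\<dots> = 1 + (CINT \<zeta>. cmod (f (of_real (radius k) * \<zeta>)) powr p)"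
      using circle_integrable_if_continuous[OF cp] by (simp add: space_circle_measure)
    also have "\<dots> \<le> 1 + K" using K[OF r] by simp
    finally show ?thesis using K0 by simp
  qed
  from H2_if_means_bounded[OF f _ this] K0 show "f \<in> H2" "H2.nrm f \<le> sqrt (1 + K)" by auto
qed

text \<open>
  The exponents \<open>p/2\<close> and \<open>q/2\<close> with \<open>q = 2 p / (p - 2)\<close> are conjugate.
\<close>

lemma Young_square_product:
  fixes p x y :: real
  assumes p: "2 < p" and "0 \<le> x" "0 \<le> y"
  shows "(x * y)\<^sup>2 \<le> x powr p + y powr (2 * p / (p - 2))"
proof -
  define q where "q = 2 * p / (p - 2)"
  have q: "2 < q" using p by (simp add: q_def field_simps)
  have "x\<^sup>2 * y\<^sup>2 \<le> (x\<^sup>2) powr (p/2) / (p/2) + (y\<^sup>2) powr (q/2) / (q/2)"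
    by (rule Youngs_inequality) (use p q in \<open>auto simp: q_def field_simps\<close>)
  also have "(x\<^sup>2) powr (p/2) = x powr p" using assms by (cases "x = 0") (simp_all add: powr_powr flip: powr_numeral)
  also have "(y\<^sup>2) powr (q/2) = y powr q" using assms by (cases "y = 0") (simp_all add: powr_powr flip: powr_numeral)
  also have "x powr p / (p/2) + y powr q / (q/2) \<le> x powr p + y powr q"
    using p q divide_left_mono[of 1 "p/2" "x powr p"] divide_left_mono[of 1 "q/2" "y powr q"]
    by (intro add_mono) simp_all
  finally show ?thesis by (simp add: power_mult_distrib q_def)
qed

context pythagorean_pair
begin

lemma a_nonzero: "z \<in> unit_disk \<Longrightarrow> a z \<noteq> 0"
  using mate outer_nonzero by (simp add: pythagorean_mate_def)

lemma phi_holomorphic: "(\<lambda>z. b z / a z) holomorphic_on unit_disk"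
  using a_nonzero by (intro holomorphic_intros b_holomorphic hardy_infty_holomorphic[OF a_hardy_infty])

text \<open>
  On each circle, \<open>f cnj (b u) = (f cnj \<phi>) cnj (a u)\<close>.  The first factor is bounded in mean square by
  Young's inequality, uniformly in the radius.
\<close>

lemma hardy_subset_dBR_space:
  assumes p: "2 < p" and phi: "(\<lambda>z. b z / a z) \<in> hardy (2 * p / (p - 2))"
  shows "hardy p \<subseteq> dBR_space b"
proof
  define q where "q = 2 * p / (p - 2)"
  have q: "2 < q" using p by (simp add: q_def field_simps)
  fix f assume "f \<in> hardy p"
  then obtain K where f: "f holomorphic_on unit_disk"
    and K: "\<And>r. 0 < r \<Longrightarrow> r < 1 \<Longrightarrow> (CINT \<zeta>. cmod (f (of_real r * \<zeta>)) powr p) \<le> K"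
    using p hardy_iff[of p f] by (metis greaterThanLessThan_iff less_trans zero_less_numeral)
  have "\<exists>L. \<forall>r\<in>{0<..<1}. (CINT \<zeta>. cmod (b (of_real r * \<zeta>) / a (of_real r * \<zeta>)) powr q) \<le> L"
    using phi q hardy_iff[of q "\<lambda>z. b z / a z"] unfolding q_def[symmetric] by simp
  then obtain L where L: "\<And>r. 0 < r \<Longrightarrow> r < 1 \<Longrightarrow> (CINT \<zeta>. cmod (b (of_real r * \<zeta>) / a (of_real r * \<zeta>)) powr q) \<le> L"
    by (metis greaterThanLessThan_iff)
  have fH: "f \<in> H2" by (rule H2_if_hardy_means(1)[OF _ f K]) (use p in auto)
  have bd: "cmod (ip2 f (\<lambda>z. b z * u z)) \<le> sqrt (K + L) * H2.nrm (\<lambda>z. a z * u z)" if u: "u \<in> hardy_infty" for u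
  proof (rule LIMSEQ_le_const2)
    show "(\<lambda>k. cmod (CINT \<zeta>. f (of_real (radius k) * \<zeta>) * cnj (b (of_real (radius k) * \<zeta>) * u (of_real (radius k) * \<zeta>))))
      \<longlonglongrightarrow> cmod (ip2 f (\<lambda>z. b z * u z))"
      by (intro tendsto_norm ip2_radial_limit fH b_mult_H2 u)
    have "cmod (CINT \<zeta>. f (of_real (radius k) * \<zeta>) * cnj (b (of_real (radius k) * \<zeta>) * u (of_real (radius k) * \<zeta>)))
        \<le> sqrt (K + L) * H2.nrm (\<lambda>z. a z * u z)" for k
    proof -
      define r where "r = radius k"
      have r: "0 < r" "r < 1" using radius_bounds by (auto simp: r_def)
      have cont: "continuous_on (sphere 0 1) (\<lambda>\<zeta>. h (of_real r * \<zeta>))" if "h holomorphic_on unit_disk" for h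
        using r that by (intro continuous_on_dilation_if_holomorphic) auto
      define phi' where "phi' \<zeta> = b (of_real r * \<zeta>) / a (of_real r * \<zeta>)" for \<zeta>
      define F where "F \<zeta> = f (of_real r * \<zeta>) * cnj (phi' \<zeta>)" for \<zeta>
      define G where "G \<zeta> = a (of_real r * \<zeta>) * u (of_real r * \<zeta>)" for \<zeta>
      have cphi: "continuous_on (sphere 0 1) phi'" unfolding phi'_def by (rule cont[OF phi_holomorphic])
      have cf: "continuous_on (sphere 0 1) (\<lambda>\<zeta>. f (of_real r * \<zeta>))" by (rule cont[OF f])
      have cF: "continuous_on (sphere 0 1) F" unfolding F_def by (intro continuous_intros cf cphi)
      have cG: "continuous_on (sphere 0 1) G" unfolding G_def
        by (intro continuous_intros cont hardy_infty_holomorphic a_hardy_infty u)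
      have F_le: "circle_L2.nrm F \<le> sqrt (K + L)"
      proof -
        have c1: "continuous_on (sphere 0 1) (\<lambda>\<zeta>. cmod (f (of_real r * \<zeta>)) powr p)"
          using p by (intro continuous_on_norm_powr cf) auto
        have c2: "continuous_on (sphere 0 1) (\<lambda>\<zeta>. cmod (phi' \<zeta>) powr q)"
          using q by (intro continuous_on_norm_powr cphi) auto
        have "(CINT \<zeta>. (cmod (F \<zeta>))\<^sup>2)
            \<le> (CINT \<zeta>. cmod (f (of_real r * \<zeta>)) powr p + cmod (phi' \<zeta>) powr q)"
        proof (rule circle_integral_mono)
          show "(cmod (F \<zeta>))\<^sup>2 \<le> cmod (f (of_real r * \<zeta>)) powr p + cmod (phi' \<zeta>) powr q" for \<zeta>
            using Young_square_product[OF p, of "cmod (f (of_real r * \<zeta>))" "cmod (phi' \<zeta>)"]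
            by (simp add: F_def norm_mult q_def)
        qed (intro continuous_intros cF c1 c2)+
        also have "\<dots> = (CINT \<zeta>. cmod (f (of_real r * \<zeta>)) powr p) + (CINT \<zeta>. cmod (phi' \<zeta>) powr q)"
          by (intro Bochner_Integration.integral_add circle_integrable_if_continuous c1 c2)
        also have "\<dots> \<le> K + L" using K[OF r] L[OF r] unfolding phi'_def by (rule add_mono)
        finally show ?thesis by (simp add: circle_L2_nrm)
      qed
      have G_le: "circle_L2.nrm G \<le> H2.nrm (\<lambda>z. a z * u z)"
      proof -
        have "(CINT \<zeta>. (cmod (G \<zeta>))\<^sup>2) \<le> (H2.nrm (\<lambda>z. a z * u z))\<^sup>2"
          unfolding G_def using r by (intro mean_square_le_nrm a_mult_H2 u) auto
        then show ?thesis unfolding circle_L2_nrm using H2.nrm_nonneg[OF a_mult_H2[OF u]] by (rule real_le_lsqrt[rotated 1])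
      qed
      have "(CINT \<zeta>. f (of_real r * \<zeta>) * cnj (b (of_real r * \<zeta>) * u (of_real r * \<zeta>)))
          = (CINT \<zeta>. F \<zeta> * cnj (G \<zeta>))"
      proof (intro Bochner_Integration.integral_cong refl)
        fix \<zeta> assume "\<zeta> \<in> space circle_measure"
        then have "a (of_real r * \<zeta>) \<noteq> 0" using r by (intro a_nonzero) (simp add: space_circle_measure norm_mult)
        then show "f (of_real r * \<zeta>) * cnj (b (of_real r * \<zeta>) * u (of_real r * \<zeta>)) = F \<zeta> * cnj (G \<zeta>)"
          by (simp add: F_def G_def phi'_def)
      qed
      also have "cmod \<dots> \<le> circle_L2.nrm F * circle_L2.nrm G" by (rule circle_L2.Cauchy_Schwarz) (use cF cG in auto)
      also have "\<dots> \<le> sqrt (K + L) * H2.nrm (\<lambda>z. a z * u z)"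
      proof (intro mult_mono F_le G_le)
        show "0 \<le> circle_L2.nrm G" using circle_L2.nrm_nonneg[of G] cG by simp
        show "0 \<le> sqrt (K + L)" by (rule order_trans[OF _ F_le], rule circle_L2.nrm_nonneg) (simp add: cF)
      qed
      finally show ?thesis unfolding r_def .
    qed
    then show "\<exists>N. \<forall>k\<ge>N. cmod (CINT \<zeta>. f (of_real (radius k) * \<zeta>) * cnj (b (of_real (radius k) * \<zeta>) * u (of_real (radius k) * \<zeta>)))
        \<le> sqrt (K + L) * H2.nrm (\<lambda>z. a z * u z)" by blast
  qed
  have "0 \<le> sqrt (K + L)"
  proof -
    have "0 \<le> K" by (rule order_trans[OF _ K[of "1/2"]]) simp_all
    moreover have "0 \<le> L" by (rule order_trans[OF _ L[of "1/2"]]) simp_all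
    ultimately show ?thesis by simp
  qed
  then show "f \<in> dBR_space b" by (intro dBR_space_memI[OF fH bd])
qed

end

section \<open>Uniform boundedness by a gliding hump\<close>

lemma coef_zero: "coef (\<lambda>z. 0) = (\<lambda>n. 0)"
  by (rule coef_eqI) simp

text \<open>
  The weights decrease so fast that all later weights together amount to half of the present one.
\<close>

definition hump_weight :: "nat \<Rightarrow> real"
  where "hump_weight i = (1/3) ^ Suc i"

lemma hump_weight_tail: "(\<Sum>i=m..<n. hump_weight i) \<le> (3/2) * hump_weight m"
proof -
  have "(\<Sum>i=m..<n. hump_weight i) = (3/2) * (hump_weight m - hump_weight n)" if "m \<le> n" for n
    using that by (induction n rule: dec_induct) (simp_all add: hump_weight_def)
  moreover have "0 \<le> hump_weight n" "0 \<le> hump_weight m" by (simp_all add: hump_weight_def)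
  ultimately show ?thesis by (cases "m \<le> n") auto
qed

text \<open>
  The weights have sum at most \<open>1\<close>, so partial sums stay within the bound for the summands.
\<close>

lemma hump_sum_H2:
  assumes F: "\<And>i::nat. F i \<in> H2" "\<And>i. H2.nrm (F i) \<le> R" and s: "\<And>i. s i \<in> {1, -1::real}"
  defines "X \<equiv> \<lambda>n z. \<Sum>i<n. of_real (s i * hump_weight i) * F i z"
  shows "X n \<in> H2" "H2.nrm (X n) \<le> R"
    "coef (X n) = (\<lambda>k. \<Sum>i<n. of_real (s i * hump_weight i) * coef (F i) k)"
proof -
  have Fhol: "F i holomorphic_on unit_disk" for i by (rule holomorphic_if_H2[OF F(1)])
  have w0: "0 \<le> hump_weight i" for i by (simp add: hump_weight_def)
  have sw: "\<bar>s i * hump_weight i\<bar> = hump_weight i" for i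
    using s[of i] by (auto simp: abs_mult hump_weight_def)
  have XS: "X (Suc n) = (\<lambda>z. X n z + of_real (s n * hump_weight n) * F n z)" "X 0 = (\<lambda>z. 0)" for n
    by (auto simp: X_def)
  have XH: "X n \<in> H2 \<and> H2.nrm (X n) \<le> (\<Sum>i<n. hump_weight i) * R \<and>
      coef (X n) = (\<lambda>k. \<Sum>i<n. of_real (s i * hump_weight i) * coef (F i) k)" for n
  proof (induction n)
    case 0 show ?case by (simp add: XS H2_zero H2.nrm_def ip2_zero_left coef_zero)
  next
    case (Suc n)
    have "H2.nrm (X (Suc n)) \<le> H2.nrm (X n) + H2.nrm (\<lambda>z. of_real (s n * hump_weight n) * F n z)"
      unfolding XS using Suc by (intro H2.nrm_triangle H2_scale F) simp
    also have "H2.nrm (\<lambda>z. of_real (s n * hump_weight n) * F n z) = hump_weight n * H2.nrm (F n)"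
      unfolding H2.nrm_scale[OF F(1)] norm_of_real sw ..
    also have "\<dots> \<le> hump_weight n * R" by (intro mult_left_mono F w0)
    finally have "H2.nrm (X (Suc n)) \<le> (\<Sum>i<Suc n. hump_weight i) * R" using Suc by (simp add: distrib_right)
    moreover have "coef (X (Suc n)) = (\<lambda>k. \<Sum>i<Suc n. of_real (s i * hump_weight i) * coef (F i) k)"
      unfolding XS using Suc by (subst coef_add) (auto intro!: holomorphic_if_H2 H2_scale F simp: coef_scale[OF Fhol])
    ultimately show ?case using Suc unfolding XS by (auto intro!: H2_add H2_scale F)
  qed
  have R0: "0 \<le> R" using H2.nrm_nonneg[OF F(1)] F(2) by (rule order_trans)
  have w1: "(\<Sum>i<n. hump_weight i) \<le> 1"
    using hump_weight_tail[of 0 n] by (simp add: lessThan_atLeast0 hump_weight_def)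
  have "H2.nrm (X n) \<le> (\<Sum>i<n. hump_weight i) * R" using XH[of n] by blast
  also have "\<dots> \<le> 1 * R" by (intro mult_right_mono w1 R0)
  finally show "H2.nrm (X n) \<le> R" by simp
  show "X n \<in> H2" "coef (X n) = (\<lambda>k. \<Sum>i<n. of_real (s i * hump_weight i) * coef (F i) k)"
    using XH[of n] by blast+
qed

text \<open>
  The gliding hump argument.  Let \<open>N y\<close> be the supremum of \<open>\<bar>\<langle>f, y\<rangle>\<bar>\<close> over \<open>S\<close>.  If these suprema are
  unbounded, there are \<open>y n\<close> with \<open>hump_weight n \<cdot> N (y n)\<close> larger than \<open>n\<close>, and \<open>F n\<close> in \<open>S\<close> that attain
  at least three quarters of them.  In the sum of the functions \<open>F n\<close> with weights, the sign of each
  summand is chosen such that it does not cancel against the sum of the earlier ones, while the later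
  summands contribute at most half of \<open>hump_weight n \<cdot> N (y n)\<close>.  What remains is a quarter, so the sum
  of the series is unbounded on the \<open>y n\<close>.  Convergence of such series within \<open>S\<close> takes the place of
  completeness.
\<close>

lemma H2_uniform_boundedness:
  fixes S Y :: "(complex \<Rightarrow> complex) set"
  assumes S: "\<And>f. f \<in> S \<Longrightarrow> f \<in> H2" "\<And>f. f \<in> S \<Longrightarrow> H2.nrm f \<le> R"
    and Y: "Y \<subseteq> H2"
    and series: "\<And>F s. (\<And>i::nat. F i \<in> S) \<Longrightarrow> (\<And>i. s i \<in> {1, -1::real}) \<Longrightarrow>
      \<exists>f\<in>S. \<forall>k. (\<lambda>n. \<Sum>i<n. of_real (s i * hump_weight i) * coef (F i) k) \<longlonglongrightarrow> coef f k"
    and pointwise: "\<And>f. f \<in> S \<Longrightarrow> \<exists>C. \<forall>y\<in>Y. cmod (ip2 f y) \<le> C"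
  shows "\<exists>C. \<forall>f\<in>S. \<forall>y\<in>Y. cmod (ip2 f y) \<le> C"
proof (rule ccontr)
  assume unb: "\<not> ?thesis"
  then obtain f0 where f0: "f0 \<in> S" by blast
  define N where "N y = (SUP f\<in>S. cmod (ip2 f y))" for y
  have bdd: "bdd_above ((\<lambda>f. cmod (ip2 f y)) ` S)" if "y \<in> Y" for y
  proof (rule bdd_aboveI2)
    fix f assume f: "f \<in> S"
    have y: "y \<in> H2" using that Y by blast
    have "cmod (ip2 f y) \<le> H2.nrm f * H2.nrm y" by (rule H2.Cauchy_Schwarz[OF S(1)[OF f] y])
    also have "\<dots> \<le> R * H2.nrm y" by (intro mult_right_mono S(2) f H2.nrm_nonneg y)
    finally show "cmod (ip2 f y) \<le> R * H2.nrm y" .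
  qed
  have le_N: "cmod (ip2 f y) \<le> N y" if "y \<in> Y" "f \<in> S" for f y
    unfolding N_def using bdd[OF that(1)] that(2) by (rule cSUP_upper2[OF _ _ order_refl])
  have "\<exists>y\<in>Y. \<exists>f\<in>S. real n < hump_weight n * N y \<and> (3/4) * N y \<le> cmod (ip2 f y)" for n
  proof -
    have w: "0 < hump_weight n" by (simp add: hump_weight_def)
    have "\<exists>g\<in>S. \<exists>y\<in>Y. real (Suc n) / hump_weight n < cmod (ip2 g y)"
    proof (rule ccontr)
      assume "\<not> ?thesis"
      then have "\<forall>f\<in>S. \<forall>y\<in>Y. cmod (ip2 f y) \<le> real (Suc n) / hump_weight n" by (simp add: not_less)
      with unb show False by (elim notE) (rule exI)
    qed
    then obtain y g where y: "y \<in> Y" "g \<in> S" "real (Suc n) / hump_weight n < cmod (ip2 g y)" by blast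
    have "real (Suc n) / hump_weight n < N y" using y(3) le_N[OF y(1,2)] by (rule less_le_trans)
    then have big': "real (Suc n) < hump_weight n * N y" using w by (simp only: pos_divide_less_eq mult.commute)
    then have big: "real n < hump_weight n * N y" by simp
    have "0 < hump_weight n * N y" by (rule le_less_trans[OF of_nat_0_le_iff big])
    then have pos: "0 < N y" using w by (simp add: zero_less_mult_iff)
    have "\<exists>f\<in>S. (3/4) * N y < cmod (ip2 f y)"
      using less_cSUP_iff[OF _ bdd[OF y(1)], of "(3/4) * N y"] f0 pos unfolding N_def[symmetric] by auto
    then show ?thesis using y(1) big by (blast intro: less_imp_le)
  qed
  then have "\<exists>y f. y \<in> Y \<and> f \<in> S \<and> real n < hump_weight n * N y \<and> (3/4) * N y \<le> cmod (ip2 f y)" for n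
    by blast
  then obtain y F where yF: "\<And>n. y n \<in> Y \<and> F n \<in> S \<and> real n < hump_weight n * N (y n)
      \<and> (3/4) * N (y n) \<le> cmod (ip2 (F n) (y n))"
    by metis
  then have y: "y n \<in> Y" and F: "F n \<in> S" and big: "real n < hump_weight n * N (y n)"
    and near: "(3/4) * N (y n) \<le> cmod (ip2 (F n) (y n))" for n by blast+
  have yH: "y n \<in> H2" and FH: "F n \<in> H2" for n using y Y F S(1) by auto
  define sg where "sg g n = (if cmod (ip2 g (y n) + of_real (hump_weight n) * ip2 (F n) (y n))
      \<ge> cmod (of_real (hump_weight n) * ip2 (F n) (y n)) then 1 else -1 :: real)" for g n
  define X where "X = rec_nat (\<lambda>z. 0) (\<lambda>n g. (\<lambda>z. g z + of_real (sg g n * hump_weight n) * F n z))"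
  define s where "s n = sg (X n) n" for n
  have X0: "X 0 = (\<lambda>z. 0)" and XS: "X (Suc n) = (\<lambda>z. X n z + of_real (s n * hump_weight n) * F n z)" for n
    by (simp_all add: X_def s_def)
  have s1: "s i \<in> {1, -1}" for i by (simp add: s_def sg_def)
  have sw: "\<bar>s i * hump_weight i\<bar> = hump_weight i" for i
    using s1[of i] by (auto simp: abs_mult hump_weight_def)
  have X: "X n = (\<lambda>z. \<Sum>i<n. of_real (s i * hump_weight i) * F i z)" for n
    by (induction n) (simp_all add: X0 XS)
  have XH: "X n \<in> H2" and XR: "H2.nrm (X n) \<le> R"
    and coefX: "coef (X n) = (\<lambda>k. \<Sum>i<n. of_real (s i * hump_weight i) * coef (F i) k)" for n
    unfolding X by (rule hump_sum_H2[OF FH S(2)[OF F] s1])+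
  have ipX: "ip2 (X (Suc n)) g = ip2 (X n) g + of_real (s n * hump_weight n) * ip2 (F n) g" if "g \<in> H2" for g n
    unfolding XS using that by (simp add: H2.ip_add XH H2_scale FH H2.ip_scale)
  have step: "hump_weight n * ((3/4) * N (y n)) \<le> cmod (ip2 (X (Suc n)) (y n))" for n
  proof -
    let ?u = "ip2 (X n) (y n)" and ?v = "of_real (hump_weight n) * ip2 (F n) (y n)"
    have "cmod ?v \<le> cmod (?u + ?v) \<or> cmod ?v \<le> cmod (?u - ?v)"
    proof -
      have "2 * cmod ?v = cmod ((?u + ?v) - (?u - ?v))" by (simp add: norm_mult)
      also have "\<dots> \<le> cmod (?u + ?v) + cmod (?u - ?v)" by (rule norm_triangle_ineq4)
      finally show ?thesis by linarith
    qed
    then have "cmod ?v \<le> cmod (?u + of_real (s n) * ?v)" by (auto simp: s_def sg_def)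
    also have "?u + of_real (s n) * ?v = ip2 (X (Suc n)) (y n)" using ipX[OF yH] by simp
    finally have "cmod ?v \<le> cmod (ip2 (X (Suc n)) (y n))" .
    moreover have "hump_weight n * ((3/4) * N (y n)) \<le> cmod ?v"
    proof -
      have "\<bar>hump_weight n\<bar> = hump_weight n" by (simp add: hump_weight_def)
      then show ?thesis unfolding norm_mult norm_of_real
        using mult_left_mono[OF near[of n] abs_ge_zero[of "hump_weight n"]] by simp
    qed
    ultimately show ?thesis by linarith
  qed
  from series[OF F s1] obtain f where f: "f \<in> S"
    and "\<forall>k. (\<lambda>n. \<Sum>i<n. of_real (s i * hump_weight i) * coef (F i) k) \<longlonglongrightarrow> coef f k" ..
  then have lim: "(\<lambda>n. coef (X n) k) \<longlonglongrightarrow> coef f k" for k unfolding coefX by simp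
  have ipf: "(\<lambda>m. ip2 (X m) g) \<longlonglongrightarrow> ip2 f g" if "g \<in> H2" for g
    using H2_weak_limit(2,4)[OF XH XR lim] that by (simp add: ip2_def)
  have tail: "cmod (ip2 (X (n + m)) (y k) - ip2 (X n) (y k)) \<le> (\<Sum>i=n..<n+m. hump_weight i) * N (y k)" for n m k
  proof (induction m)
    case (Suc m)
    have "cmod (ip2 (X (n + Suc m)) (y k) - ip2 (X n) (y k))
        \<le> cmod (ip2 (X (n + m)) (y k) - ip2 (X n) (y k)) + cmod (of_real (s (n+m) * hump_weight (n+m)) * ip2 (F (n+m)) (y k))"
      using ipX[OF yH, of "n+m" k] norm_triangle_ineq[of "ip2 (X (n + m)) (y k) - ip2 (X n) (y k)" "of_real (s (n+m) * hump_weight (n+m)) * ip2 (F (n+m)) (y k)"]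
      by (simp add: algebra_simps)
    also have "cmod (of_real (s (n+m) * hump_weight (n+m)) * ip2 (F (n+m)) (y k)) \<le> hump_weight (n+m) * N (y k)"
      unfolding norm_mult norm_of_real sw by (intro mult_left_mono le_N y F) (simp add: hump_weight_def)
    finally show ?case using Suc by (simp add: distrib_right)
  qed simp
  obtain C where C: "\<And>n. cmod (ip2 f (y n)) \<le> C" using pointwise[OF f] y by blast
  have "real n / 4 \<le> C" for n
  proof -
    have N0: "0 \<le> N (y n)" using le_N[OF y F] norm_ge_zero order_trans by blast
    have "(\<lambda>m. cmod (ip2 (X (Suc n + m)) (y n) - ip2 (X (Suc n)) (y n))) \<longlonglongrightarrow> cmod (ip2 f (y n) - ip2 (X (Suc n)) (y n))"
      using LIMSEQ_ignore_initial_segment[OF ipf[OF yH[of n]], of "Suc n"]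
      by (intro tendsto_norm tendsto_diff tendsto_const) (simp add: add.commute)
    then have "cmod (ip2 f (y n) - ip2 (X (Suc n)) (y n)) \<le> (3/2) * hump_weight (Suc n) * N (y n)"
    proof (rule LIMSEQ_le_const2)
      have "cmod (ip2 (X (Suc n + m)) (y n) - ip2 (X (Suc n)) (y n)) \<le> (3/2) * hump_weight (Suc n) * N (y n)" for m
        by (rule order_trans[OF tail mult_right_mono[OF hump_weight_tail N0]])
      then show "\<exists>M. \<forall>m\<ge>M. cmod (ip2 (X (Suc n + m)) (y n) - ip2 (X (Suc n)) (y n)) \<le> (3/2) * hump_weight (Suc n) * N (y n)" by blast
    qed
    also have "(3/2) * hump_weight (Suc n) * N (y n) = (1/2) * (hump_weight n * N (y n))" by (simp add: hump_weight_def)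
    finally have "cmod (ip2 (X (Suc n)) (y n)) \<le> cmod (ip2 f (y n)) + (1/2) * (hump_weight n * N (y n))"
      using norm_triangle_ineq2[of "ip2 (X (Suc n)) (y n)" "ip2 f (y n)"] by (simp add: norm_minus_commute)
    then show ?thesis using step[of n] C[of n] big[of n] by simp
  qed
  moreover obtain n where "4 * C < real n" using reals_Archimedean2 by blast
  ultimately have "real n / 4 \<le> C" "4 * C < real n" by auto
  then show False by simp
qed

section \<open>Poisson averages and the unit ball of the Hardy space\<close>

lemma powser_shift_sums:
  fixes y :: "nat \<Rightarrow> complex"
  assumes "(\<lambda>n. y n * z ^ n) sums s"
  shows "(\<lambda>n. (if k \<le> n then y (n - k) else 0) * z ^ n) sums (z ^ k * s)"
proof -
  have "(\<lambda>n. z ^ k * (y n * z ^ n)) sums (z ^ k * s)" by (rule sums_mult[OF assms])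
  then have "(\<lambda>n. (if k \<le> n + k then y (n + k - k) else 0) * z ^ (n + k)) sums (z ^ k * s)"
    by (simp add: power_add mult_ac)
  then show ?thesis
    unfolding sums_iff_shift[of "\<lambda>n. (if k \<le> n then y (n - k) else 0) * z ^ n" k "z ^ k * s"] by simp
qed

definition poisson :: "real \<Rightarrow> complex \<Rightarrow> real"
  where "poisson r \<eta> = (1 - r\<^sup>2) / (cmod (1 - of_real r * \<eta>))\<^sup>2"

lemma poisson_nonneg: "0 \<le> r \<Longrightarrow> r < 1 \<Longrightarrow> 0 \<le> poisson r \<eta>"
  by (simp add: poisson_def power_le_one)

lemma one_minus_nonzero:
  fixes \<eta> :: complex
  assumes "0 \<le> r" "r < 1" "\<eta> \<in> sphere 0 1" shows "1 - of_real r * \<eta> \<noteq> 0"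
proof
  assume "1 - of_real r * \<eta> = 0"
  then have "cmod (of_real r * \<eta>) = 1" by simp
  then show False using assms by (simp add: norm_mult)
qed

lemma poisson_continuous:
  assumes "0 \<le> r" "r < 1" shows "continuous_on (sphere 0 1) (poisson r)"
  unfolding poisson_def using one_minus_nonzero[OF assms] by (intro continuous_intros) auto

text \<open>
  With \<open>s = sqrt r\<close>, the integrand is a multiple of the product of \<open>z ^ k / (1 - s z)\<close> and the conjugate
  of \<open>1 / (1 - s z)\<close> on the circle of radius \<open>s\<close>, to which Parseval's formula applies.
\<close>

lemma poisson_moment:
  assumes r: "0 < r" "r < 1"
  shows "(CINT \<eta>. of_real (poisson r \<eta>) * \<eta> ^ k) = of_real r ^ k"
proof -
  define s where "s = sqrt r"
  have s: "0 < s" "s < 1" "s * s = r" using r by (auto simp: s_def)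
  have s4: "s ^ 4 = r\<^sup>2" using s(3) by (simp add: power2_eq_square power4_eq_xxxx mult.assoc)
  define x :: "nat \<Rightarrow> complex" where "x n = (if k \<le> n then of_real s ^ (n - k) else 0)" for n
  have g: "(\<lambda>n. of_real s ^ n * z ^ n) sums szego (of_real s) z" if "z \<in> unit_disk" for z
    using szego_sums[of "of_real s" z] that s by simp
  have f: "(\<lambda>n. x n * z ^ n) sums (z ^ k * szego (of_real s) z)" if "z \<in> unit_disk" for z
    unfolding x_def by (rule powser_shift_sums[OF g[OF that]])
  have "(\<lambda>n. x n * cnj (of_real s ^ n) * of_real (s ^ (2 * n))) sums
    (CINT \<zeta>. ((of_real s * \<zeta>) ^ k * szego (of_real s) (of_real s * \<zeta>)) * cnj (szego (of_real s) (of_real s * \<zeta>)))"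
    by (rule parseval_sums[OF f g]) (use s in auto)
  moreover have "(\<lambda>n. x n * cnj (of_real s ^ n) * of_real (s ^ (2 * n))) sums (of_real s ^ (3 * k) / (1 - (of_real r)\<^sup>2))"
  proof -
    have "(\<lambda>n. ((of_real r)\<^sup>2) ^ n) sums (1 / (1 - (of_real r)\<^sup>2 :: complex))"
      using r by (intro geometric_sums) (simp add: norm_power power_less_one_iff)
    from sums_mult[OF this, of "of_real s ^ (3 * k)"]
    have "(\<lambda>n. of_real s ^ (3 * k) * ((of_real r)\<^sup>2) ^ n) sums (of_real s ^ (3 * k) / (1 - (of_real r)\<^sup>2 :: complex))"
      by simp
    moreover have "x (n + k) * cnj (of_real s ^ (n + k)) * of_real (s ^ (2 * (n + k))) = of_real s ^ (3 * k) * ((of_real r)\<^sup>2) ^ n" for n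
    proof -
      have "x (n + k) * cnj (of_real s ^ (n + k)) * of_real (s ^ (2 * (n + k))) = of_real (s ^ (n + (n + k) + 2 * (n + k)))"
      proof -
        have "x (n + k) = of_real (s ^ n)" by (simp add: x_def)
        then show ?thesis
          by (simp only: complex_cnj_power complex_cnj_complex_of_real of_real_power[symmetric]
              of_real_mult[symmetric] power_add[symmetric])
      qed
      also have "n + (n + k) + 2 * (n + k) = 3 * k + 4 * n" by simp
      also have "s ^ (3 * k + 4 * n) = s ^ (3 * k) * (r\<^sup>2) ^ n" by (simp add: power_add power_mult s4)
      finally show ?thesis by simp
    qed
    ultimately have "(\<lambda>n. x (n + k) * cnj (of_real s ^ (n + k)) * of_real (s ^ (2 * (n + k)))) sums (of_real s ^ (3 * k) / (1 - (of_real r)\<^sup>2))"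
      by simp
    then show ?thesis
      unfolding sums_iff_shift[of "\<lambda>n. x n * cnj (of_real s ^ n) * of_real (s ^ (2 * n))" k] by (simp add: x_def)
  qed
  ultimately have 1: "(CINT \<zeta>. ((of_real s * \<zeta>) ^ k * szego (of_real s) (of_real s * \<zeta>)) * cnj (szego (of_real s) (of_real s * \<zeta>)))
     = of_real s ^ (3 * k) / (1 - (of_real r)\<^sup>2)" by (rule sums_unique2)
  have "(CINT \<eta>. of_real (poisson r \<eta>) * \<eta> ^ k)
      = (CINT \<eta>. ((1 - (of_real r)\<^sup>2) / of_real s ^ k) * (((of_real s * \<eta>) ^ k * szego (of_real s) (of_real s * \<eta>)) * cnj (szego (of_real s) (of_real s * \<eta>))))"
  proof (intro Bochner_Integration.integral_cong refl)
    fix \<eta> :: complex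
    have z: "szego (of_real s) (of_real s * \<eta>) = 1 / (1 - of_real r * \<eta>)"
    proof -
      have "of_real s * (of_real s * \<eta>) = of_real r * \<eta>"
        unfolding s(3)[symmetric] of_real_mult mult.assoc ..
      then show ?thesis by (simp add: szego_def)
    qed
    have "szego (of_real s) (of_real s * \<eta>) * cnj (szego (of_real s) (of_real s * \<eta>)) = 1 / of_real ((cmod (1 - of_real r * \<eta>))\<^sup>2)"
      unfolding z complex_norm_square by simp
    then show "of_real (poisson r \<eta>) * \<eta> ^ k = ((1 - (of_real r)\<^sup>2) / of_real s ^ k) * (((of_real s * \<eta>) ^ k * szego (of_real s) (of_real s * \<eta>)) * cnj (szego (of_real s) (of_real s * \<eta>)))"
      using s(1) by (simp add: poisson_def power_mult_distrib mult.assoc)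
  qed
  also have "\<dots> = ((1 - (of_real r)\<^sup>2) / of_real s ^ k) * (of_real s ^ (3 * k) / (1 - (of_real r)\<^sup>2))"
    by (simp only: integral_mult_right_zero 1)
  also have "\<dots> = of_real s ^ (3 * k) / of_real s ^ k"
  proof -
    have "(1 - (of_real r)\<^sup>2 :: complex) \<noteq> 0"
    proof
      assume "(1 - (of_real r)\<^sup>2 :: complex) = 0"
      then have "of_real (r\<^sup>2) = (of_real 1 :: complex)" by simp
      then have "r\<^sup>2 = 1" by (simp only: of_real_eq_iff)
      moreover have "r\<^sup>2 < 1" using r by (simp add: power_less_one_iff)
      ultimately show False by simp
    qed
    then show ?thesis by simp
  qed
  also have "\<dots> = of_real r ^ k"
  proof -
    have "s ^ (3 * k) = s ^ k * r ^ k" 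
      unfolding power_mult power_mult_distrib[symmetric] s(3)[symmetric] by (simp add: power3_eq_cube mult.assoc)
    then have "of_real (s ^ (3 * k)) = (of_real (s ^ k * r ^ k) :: complex)" by simp
    then show ?thesis using s(1) by simp
  qed
  finally show ?thesis .
qed

lemma poisson_integral: "0 < r \<Longrightarrow> r < 1 \<Longrightarrow> (CINT \<eta>. poisson r \<eta>) = 1"
proof -
  assume "0 < r" "r < 1"
  from poisson_moment[OF this, of 0] have "complex_of_real (CINT \<eta>. poisson r \<eta>) = of_real 1" by simp
  then show ?thesis by (simp only: of_real_eq_iff)
qed

lemma poisson_moment_cnj:
  assumes r: "0 < r" "r < 1"
  shows "(CINT \<eta>. of_real (poisson r \<eta>) * cnj (\<eta> ^ k)) = of_real r ^ k"
proof -
  have "integrable circle_measure (\<lambda>\<eta>. of_real (poisson r \<eta>) * \<eta> ^ k)"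
    using r by (intro circle_integrable_if_continuous continuous_intros poisson_continuous) auto
  from integral_bounded_linear[OF bounded_linear_cnj this] show ?thesis
    unfolding poisson_moment[OF r] by simp
qed

text \<open>
  A power lies above its tangent at \<open>u\<close>.  This form of convexity includes \<open>u = 0\<close> and gives Jensen's
  inequality for sums and for integrals by summation and integration.
\<close>

lemma powr_tangent_le:
  fixes p t u :: real
  assumes p: "1 < p" and "0 \<le> t" "0 \<le> u"
  shows "u powr p + p * u powr (p - 1) * (t - u) \<le> t powr p"
proof (cases "u = 0")
  case False
  then have u: "0 < u" using assms by simp
  have "t * u powr (p - 1) \<le> t powr p / p + (u powr (p - 1)) powr (p / (p - 1)) / (p / (p - 1))"
    by (rule Youngs_inequality) (use assms in \<open>auto simp: field_simps\<close>)
  also have "(u powr (p - 1)) powr (p / (p - 1)) = u powr p" using p by (simp add: powr_powr)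
  finally have "p * (t * u powr (p - 1)) \<le> t powr p + (p - 1) * u powr p" using p by (simp add: field_simps)
  moreover have "u powr (p - 1) * u = u powr p" using u by (simp add: powr_mult_base mult.commute)
  ultimately show ?thesis by (simp add: algebra_simps)
qed simp

lemma powr_weighted_sum_le:
  fixes p :: real and w t :: "nat \<Rightarrow> real"
  assumes p: "1 < p" and w: "\<And>i. 0 \<le> w i" "(\<Sum>i<n. w i) \<le> 1" and t: "\<And>i. 0 \<le> t i"
  shows "(\<Sum>i<n. w i * t i) powr p \<le> (\<Sum>i<n. w i * t i powr p)"
proof -
  define u where "u = (\<Sum>i<n. w i * t i)"
  define W where "W = (\<Sum>i<n. w i)"
  have u: "0 \<le> u" unfolding u_def by (intro sum_nonneg mult_nonneg_nonneg w t)
  have uu: "u powr (p - 1) * u = u powr p" using u p by (cases "u = 0") (simp_all add: powr_mult_base mult.commute)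
  have "u powr p \<le> (W + p * (1 - W)) * u powr p"
  proof -
    have "0 \<le> (p - 1) * (1 - W)" using p w(2) by (simp add: W_def)
    then have "1 \<le> W + p * (1 - W)" by (simp add: algebra_simps)
    then show ?thesis using mult_right_mono[of 1 "W + p * (1 - W)" "u powr p"] by simp
  qed
  also have "\<dots> = (\<Sum>i<n. w i * (u powr p + p * u powr (p - 1) * (t i - u)))"
  proof -
    define A B where "A = u powr p" and "B = p * u powr (p - 1)"
    have Bu: "B * u = p * A" using uu by (simp add: A_def B_def)
    have "(\<Sum>i<n. w i * (A + B * (t i - u))) = (\<Sum>i<n. A * w i + B * (w i * t i) - (B * u) * w i)"
      by (intro sum.cong refl) (simp add: algebra_simps)
    also have "\<dots> = A * W + B * u - (B * u) * W"
      by (simp only: sum.distrib sum_subtractf sum_distrib_left[symmetric] u_def[symmetric] W_def[symmetric])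
    also have "\<dots> = (W + p * (1 - W)) * A" unfolding Bu by (simp add: algebra_simps)
    finally show ?thesis by (simp add: A_def B_def)
  qed
  also have "\<dots> \<le> (\<Sum>i<n. w i * t i powr p)"
    by (intro sum_mono mult_left_mono powr_tangent_le p t u w)
  finally show ?thesis unfolding u_def .
qed

text \<open>
  Polynomials are given by a coefficient sequence and a length, so that two of them can be brought to
  a common length.
\<close>

definition partial_poly :: "(nat \<Rightarrow> complex) \<Rightarrow> nat \<Rightarrow> complex \<Rightarrow> complex"
  where "partial_poly x N z = (\<Sum>j<N. x j * z ^ j)"

lemma partial_poly_continuous: "continuous_on A (partial_poly x N)"
  unfolding partial_poly_def by (intro continuous_intros)

lemma partial_poly_holomorphic: "partial_poly x N holomorphic_on A"
  unfolding partial_poly_def by (intro holomorphic_intros)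

lemma circle_integral_rotation_real:
  fixes F :: "complex \<Rightarrow> real"
  assumes F: "continuous_on (sphere 0 1) F" and \<eta>: "\<eta> \<in> sphere 0 1"
  shows "(CINT \<zeta>. F (\<zeta> * \<eta>)) = (CINT \<zeta>. F \<zeta>)"
proof -
  have "(CINT \<zeta>. of_real (F (\<zeta> * \<eta>)) :: complex) = (CINT \<zeta>. of_real (F \<zeta>))"
    by (rule circle_integral_rotation[OF _ \<eta>]) (intro continuous_intros F)
  then show ?thesis by simp
qed

lemma poisson_partial_poly:
  assumes r: "0 < r" "r < 1"
  shows "(CINT \<eta>. of_real (poisson r \<eta>) * partial_poly x N (\<zeta> * \<eta>)) = partial_poly x N (of_real r * \<zeta>)"
proof -
  have i: "integrable circle_measure (\<lambda>\<eta>. (x j * \<zeta> ^ j) * (of_real (poisson r \<eta>) * \<eta> ^ j))" for j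
    using r by (intro circle_integrable_if_continuous continuous_intros poisson_continuous) auto
  have "(CINT \<eta>. of_real (poisson r \<eta>) * partial_poly x N (\<zeta> * \<eta>))
      = (CINT \<eta>. (\<Sum>j<N. (x j * \<zeta> ^ j) * (of_real (poisson r \<eta>) * \<eta> ^ j)))"
    unfolding partial_poly_def sum_distrib_left
    by (intro Bochner_Integration.integral_cong refl sum.cong) (simp add: power_mult_distrib mult_ac)
  also have "\<dots> = (\<Sum>j<N. CINT \<eta>. (x j * \<zeta> ^ j) * (of_real (poisson r \<eta>) * \<eta> ^ j))"
    by (rule Bochner_Integration.integral_sum) (rule i)
  also have "\<dots> = (\<Sum>j<N. (x j * \<zeta> ^ j) * of_real r ^ j)"
    by (simp only: integral_mult_right_zero poisson_moment[OF r])
  finally show ?thesis by (simp add: partial_poly_def power_mult_distrib mult_ac)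
qed

text \<open>
  Jensen's inequality for the Poisson kernel, which is a probability density.
\<close>

lemma partial_poly_powr_le_poisson:
  assumes p: "1 < p" and r: "0 < r" "r < 1" and \<zeta>: "\<zeta> \<in> sphere 0 1"
  shows "cmod (partial_poly x N (of_real r * \<zeta>)) powr p \<le> (CINT \<eta>. poisson r \<eta> * cmod (partial_poly x N (\<zeta> * \<eta>)) powr p)"
proof -
  have r0: "0 \<le> r" using r by simp
  have c: "continuous_on (sphere 0 1) (\<lambda>\<eta>. partial_poly x N (\<zeta> * \<eta>))"
    by (rule continuous_on_compose2[OF partial_poly_continuous[of UNIV]]) (auto intro!: continuous_intros)
  note cP = poisson_continuous[OF r0 r(2)]
  have cp: "continuous_on (sphere 0 1) (\<lambda>\<eta>. cmod (partial_poly x N (\<zeta> * \<eta>)) powr p)"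
    using p by (intro continuous_on_norm_powr c) auto
  define u where "u = (CINT \<eta>. poisson r \<eta> * cmod (partial_poly x N (\<zeta> * \<eta>)))"
  have iPt: "integrable circle_measure (\<lambda>\<eta>. poisson r \<eta> * cmod (partial_poly x N (\<zeta> * \<eta>)))"
    by (intro circle_integrable_if_continuous continuous_intros cP c)
  have iP: "integrable circle_measure (poisson r)" by (rule circle_integrable_if_continuous[OF cP])
  have u0: "0 \<le> u" unfolding u_def using poisson_nonneg[OF r0 r(2)] by (intro Bochner_Integration.integral_nonneg) auto
  have "cmod (partial_poly x N (of_real r * \<zeta>)) \<le> (CINT \<eta>. cmod (of_real (poisson r \<eta>) * partial_poly x N (\<zeta> * \<eta>)))"
    unfolding poisson_partial_poly[OF r, symmetric] by (rule integral_norm_bound)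
  also have "\<dots> = u" unfolding u_def using poisson_nonneg[OF r0 r(2)] by (simp add: norm_mult)
  finally have "cmod (partial_poly x N (of_real r * \<zeta>)) powr p \<le> u powr p" using p by (intro powr_mono2) auto
  also have "u powr p = (CINT \<eta>. (u powr p - p * u powr (p - 1) * u) * poisson r \<eta>
      + p * u powr (p - 1) * (poisson r \<eta> * cmod (partial_poly x N (\<zeta> * \<eta>))))"
    using iPt iP poisson_integral[OF r] by (simp add: u_def)
  also have "\<dots> \<le> (CINT \<eta>. poisson r \<eta> * cmod (partial_poly x N (\<zeta> * \<eta>)) powr p)"
  proof (rule circle_integral_mono)
    fix \<eta>
    have "poisson r \<eta> * (u powr p + p * u powr (p - 1) * (cmod (partial_poly x N (\<zeta> * \<eta>)) - u)) \<le> poisson r \<eta> * cmod (partial_poly x N (\<zeta> * \<eta>)) powr p"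
      by (intro mult_left_mono powr_tangent_le p u0 poisson_nonneg r r0) auto
    then show "(u powr p - p * u powr (p - 1) * u) * poisson r \<eta> + p * u powr (p - 1) * (poisson r \<eta> * cmod (partial_poly x N (\<zeta> * \<eta>)))
        \<le> poisson r \<eta> * cmod (partial_poly x N (\<zeta> * \<eta>)) powr p" by (simp add: algebra_simps)
  qed (intro continuous_intros cP c cp)+
  finally show ?thesis .
qed

text \<open>
  The preceding inequality is integrated over the circle; by Fubini's theorem and rotation invariance
  the right-hand side becomes the mean on the unit circle.
\<close>

lemma partial_poly_mean_mono:
  assumes p: "1 < p" and r: "0 < r" "r < 1"
  shows "(CINT \<zeta>. cmod (partial_poly x N (of_real r * \<zeta>)) powr p) \<le> (CINT \<zeta>. cmod (partial_poly x N \<zeta>) powr p)"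
proof -
  have r0: "0 \<le> r" using r by simp
  let ?T = "\<lambda>\<zeta> \<eta>. poisson r \<eta> * cmod (partial_poly x N (\<zeta> * \<eta>)) powr p"
  interpret pair_sigma_finite circle_measure circle_measure ..
  have id: "(\<lambda>z. z) \<in> circle_measure \<rightarrow>\<^sub>M borel"
    by (rule circle_measurable_if_continuous) (intro continuous_intros)
  have f1: "fst \<in> borel_measurable (circle_measure \<Otimes>\<^sub>M circle_measure)"
    and f2: "snd \<in> borel_measurable (circle_measure \<Otimes>\<^sub>M circle_measure)"
    by (rule measurable_compose[OF measurable_fst id], rule measurable_compose[OF measurable_snd id])
  have meas: "case_prod ?T \<in> borel_measurable (circle_measure \<Otimes>\<^sub>M circle_measure)"
    unfolding poisson_def partial_poly_def case_prod_beta using f1 f2 by measurable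
  have c: "continuous_on (sphere 0 1) (\<lambda>\<eta>. partial_poly x N (\<zeta> * \<eta>))" "continuous_on (sphere 0 1) (\<lambda>\<zeta>. partial_poly x N (\<zeta> * \<eta>))" for \<zeta> \<eta>
    by (rule continuous_on_compose2[OF partial_poly_continuous[of UNIV]], auto intro!: continuous_intros)+
  note cP = poisson_continuous[OF r0 r(2)]
  have cp: "continuous_on A (\<lambda>\<zeta>. cmod (partial_poly x N \<zeta>) powr p)" for A
    using p by (intro continuous_on_norm_powr partial_poly_continuous) auto
  have "compact (poisson r ` sphere 0 1)" "compact ((\<lambda>\<zeta>. cmod (partial_poly x N \<zeta>) powr p) ` sphere 0 1)"
    by (intro compact_continuous_image cP cp; simp)+
  then have "\<exists>A. \<forall>\<eta>\<in>sphere 0 1. \<bar>poisson r \<eta>\<bar> \<le> A" "\<exists>B. \<forall>\<eta>\<in>sphere 0 1. \<bar>cmod (partial_poly x N \<eta>) powr p\<bar> \<le> B"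
    by (auto dest!: compact_imp_bounded simp: bounded_iff)
  then obtain A B where A: "\<And>\<eta>. \<eta> \<in> sphere 0 1 \<Longrightarrow> \<bar>poisson r \<eta>\<bar> \<le> A"
    and B: "\<And>\<eta>. \<eta> \<in> sphere 0 1 \<Longrightarrow> \<bar>cmod (partial_poly x N \<eta>) powr p\<bar> \<le> B"
    by blast
  have A0: "0 \<le> A" using A[of 1] by force
  interpret pair: finite_measure "circle_measure \<Otimes>\<^sub>M circle_measure"
    by (rule finite_measure_pair_measure) unfold_locales
  have int: "integrable (circle_measure \<Otimes>\<^sub>M circle_measure) (case_prod ?T)"
  proof (rule pair.integrable_const_bound[where B = "A * B", OF _ meas])
    show "AE z in circle_measure \<Otimes>\<^sub>M circle_measure. norm (case_prod ?T z) \<le> A * B"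
    proof (rule AE_I2)
      fix z assume "z \<in> space (circle_measure \<Otimes>\<^sub>M circle_measure)"
      then have "fst z \<in> sphere 0 1" "snd z \<in> sphere 0 1" by (auto simp: space_pair_measure space_circle_measure)
      then show "norm (case_prod ?T z) \<le> A * B"
        unfolding case_prod_beta real_norm_def abs_mult
        by (intro mult_mono A B A0) (auto simp: norm_mult)
    qed
  qed
  have "(CINT \<zeta>. cmod (partial_poly x N (of_real r * \<zeta>)) powr p) \<le> (CINT \<zeta>. (CINT \<eta>. ?T \<zeta> \<eta>))"
  proof (rule integral_mono)
    show "integrable circle_measure (\<lambda>\<zeta>. cmod (partial_poly x N (of_real r * \<zeta>)) powr p)"
      using p by (intro circle_integrable_if_continuous continuous_on_norm_powr
          continuous_on_compose2[OF partial_poly_continuous[of UNIV]]) (auto intro!: continuous_intros)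
    show "integrable circle_measure (\<lambda>\<zeta>. CINT \<eta>. ?T \<zeta> \<eta>)"
      using integrable_fst'[OF int] by simp
    show "cmod (partial_poly x N (of_real r * \<zeta>)) powr p \<le> (CINT \<eta>. ?T \<zeta> \<eta>)" if "\<zeta> \<in> space circle_measure" for \<zeta>
      using that by (intro partial_poly_powr_le_poisson p r) (simp add: space_circle_measure)
  qed
  also have "\<dots> = (CINT \<eta>. (CINT \<zeta>. ?T \<zeta> \<eta>))"
    by (rule Fubini_integral[OF int, symmetric])
  also have "\<dots> = (CINT \<eta>. poisson r \<eta> * (CINT \<zeta>. cmod (partial_poly x N \<zeta>) powr p))"
  proof (intro Bochner_Integration.integral_cong refl)
    fix \<eta> assume "\<eta> \<in> space circle_measure"
    then have "(CINT \<zeta>. cmod (partial_poly x N (\<zeta> * \<eta>)) powr p) = (CINT \<zeta>. cmod (partial_poly x N \<zeta>) powr p)"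
      by (intro circle_integral_rotation_real cp) (simp add: space_circle_measure)
    then show "(CINT \<zeta>. ?T \<zeta> \<eta>) = poisson r \<eta> * (CINT \<zeta>. cmod (partial_poly x N \<zeta>) powr p)" by simp
  qed
  also have "\<dots> = (CINT \<zeta>. cmod (partial_poly x N \<zeta>) powr p)" by (simp add: poisson_integral[OF r])
  finally show ?thesis .
qed

definition hardy_ball :: "real \<Rightarrow> (complex \<Rightarrow> complex) set"
  where "hardy_ball p = {f. f holomorphic_on unit_disk \<and>
    (\<forall>r. 0 < r \<longrightarrow> r < 1 \<longrightarrow> (CINT \<zeta>. cmod (f (of_real r * \<zeta>)) powr p) \<le> 1)}"

lemma hardy_ball_subset: "0 < p \<Longrightarrow> hardy_ball p \<subseteq> hardy p"
  by (auto simp: hardy_ball_def hardy_iff intro!: exI[of _ 1])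

lemma hardy_ball_H2:
  assumes "2 \<le> p" "f \<in> hardy_ball p" shows "f \<in> H2" "H2.nrm f \<le> sqrt 2"
  using H2_if_hardy_means[of p f 1] assms by (auto simp: hardy_ball_def)

lemma partial_poly_hardy_ball:
  assumes "1 < p" "(CINT \<zeta>. cmod (partial_poly x N \<zeta>) powr p) \<le> 1"
  shows "partial_poly x N \<in> hardy_ball p"
  unfolding hardy_ball_def
  by (intro CollectI conjI allI impI partial_poly_holomorphic order_trans[OF partial_poly_mean_mono[OF assms(1)] assms(2)])

text \<open>
  The pointwise sum exists as a weak limit in \<open>H2\<close>.  Its means are at most \<open>1\<close> because the \<open>p\<close>-th power is
  convex and the weights have sum at most \<open>1\<close>.
\<close>

lemma hardy_ball_series:
  assumes p: "2 \<le> p" and F: "\<And>i::nat. F i \<in> hardy_ball p" and s: "\<And>i. s i \<in> {1, -1::real}"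
  shows "\<exists>f\<in>hardy_ball p. \<forall>k. (\<lambda>n. \<Sum>i<n. of_real (s i * hump_weight i) * coef (F i) k) \<longlonglongrightarrow> coef f k"
proof -
  define X where "X n = (\<lambda>z. \<Sum>i<n. of_real (s i * hump_weight i) * F i z)" for n
  have w0: "0 \<le> hump_weight i" for i by (simp add: hump_weight_def)
  have sw: "\<bar>s i * hump_weight i\<bar> = hump_weight i" for i
    using s[of i] by (auto simp: abs_mult hump_weight_def)
  have w1: "(\<Sum>i<n. hump_weight i) \<le> 1" for n
    using hump_weight_tail[of 0 n] by (simp add: lessThan_atLeast0 hump_weight_def)
  have wsum: "summable hump_weight"
    unfolding hump_weight_def by (intro summable_geometric[THEN summable_Suc_iff[THEN iffD2]]) simp
  have FH: "F i \<in> H2" and FR: "H2.nrm (F i) \<le> sqrt 2" for i using hardy_ball_H2[OF p F] by auto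
  have XH': "X n \<in> H2" and XR: "H2.nrm (X n) \<le> sqrt 2"
    and coefX: "coef (X n) = (\<lambda>k. \<Sum>i<n. of_real (s i * hump_weight i) * coef (F i) k)" for n
    unfolding X_def by (rule hump_sum_H2[OF FH FR s])+
  have "convergent (\<lambda>n. coef (X n) k)" for k
  proof -
    have "summable (\<lambda>i. of_real (s i * hump_weight i) * coef (F i) k)"
    proof (rule summable_comparison_test)
      have "norm (of_real (s i * hump_weight i) * coef (F i) k) \<le> hump_weight i * sqrt 2" for i
        unfolding norm_mult norm_of_real sw by (intro mult_left_mono w0 order_trans[OF coef_le_nrm[OF FH] FR])
      then show "\<exists>N. \<forall>i\<ge>N. norm (of_real (s i * hump_weight i) * coef (F i) k) \<le> hump_weight i * sqrt 2" by blast
      show "summable (\<lambda>i. hump_weight i * sqrt 2)" by (intro summable_mult2 wsum)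
    qed
    then show ?thesis by (simp add: coefX summable_iff_convergent)
  qed
  then obtain y where y: "\<And>k. (\<lambda>n. coef (X n) k) \<longlonglongrightarrow> y k" unfolding convergent_def by metis
  note W = H2_weak_limit[OF XH' XR y]
  have pt: "(\<lambda>n. X n z) \<longlonglongrightarrow> powser y z" if z: "z \<in> unit_disk" for z
    using W(4)[OF H2_if_hardy_infty[OF szego_hardy_infty[OF z]]]
    by (simp add: ip2_szego[OF holomorphic_if_H2[OF XH'] z] ip2_szego[OF holomorphic_if_H2[OF W(1)] z])
  have "powser y \<in> hardy_ball p"
    unfolding hardy_ball_def
  proof (intro CollectI conjI allI impI)
    show "powser y holomorphic_on unit_disk" by (rule holomorphic_if_H2[OF W(1)])
    fix r :: real assume r: "0 < r" "r < 1"
    have c: "continuous_on (sphere 0 1) (\<lambda>\<zeta>. f (of_real r * \<zeta>))" if "f \<in> H2" for f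
      using r holomorphic_if_H2[OF that] by (intro continuous_on_dilation_if_holomorphic) auto
    have cp: "continuous_on (sphere 0 1) (\<lambda>\<zeta>. cmod (f (of_real r * \<zeta>)) powr p)" if "f \<in> H2" for f
      using p by (intro continuous_on_norm_powr c that) auto
    define D where "D = sqrt 2 * (1 / (1 - r))"
    have Xb: "cmod (X n (of_real r * \<zeta>)) \<le> D" if "\<zeta> \<in> sphere 0 1" for n \<zeta>
    proof -
      have z: "of_real r * \<zeta> \<in> unit_disk" using radius_disk[OF that] r by simp
      have "H2.nrm (szego (of_real r * \<zeta>)) \<le> 1 / (1 - r)"
      proof (rule H2_if_bounded(2)[OF hardy_infty_holomorphic[OF szego_hardy_infty[OF z]]])
        fix v :: complex assume v: "v \<in> unit_disk"
        have "cmod (cnj (of_real r * \<zeta>) * v) \<le> r" using v that r by (simp add: norm_mult mult_left_le)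
        then have "1 - r \<le> cmod (1 - cnj (of_real r * \<zeta>) * v)" using norm_triangle_ineq2[of 1 "cnj (of_real r * \<zeta>) * v"] by simp
        then show "cmod (szego (of_real r * \<zeta>) v) \<le> 1 / (1 - r)"
          using r unfolding szego_def norm_divide norm_one by (intro frac_le) auto
      qed (use r in simp)
      then have "H2.nrm (X n) * H2.nrm (szego (of_real r * \<zeta>)) \<le> D"
        unfolding D_def using XR H2.nrm_nonneg[OF H2_if_hardy_infty[OF szego_hardy_infty[OF z]]] by (intro mult_mono) auto
      then show ?thesis
        using H2.Cauchy_Schwarz[OF XH'[of n] H2_if_hardy_infty[OF szego_hardy_infty[OF z]]]
        by (simp add: ip2_szego[OF holomorphic_if_H2[OF XH'] z])
    qed
    have "(\<lambda>n. CINT \<zeta>. cmod (X n (of_real r * \<zeta>)) powr p) \<longlonglongrightarrow> (CINT \<zeta>. cmod (powser y (of_real r * \<zeta>)) powr p)"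
    proof (rule integral_dominated_convergence[where w = "\<lambda>_. D powr p"])
      show "AE \<zeta> in circle_measure. (\<lambda>n. cmod (X n (of_real r * \<zeta>)) powr p) \<longlonglongrightarrow> cmod (powser y (of_real r * \<zeta>)) powr p"
        using p r by (intro AE_I2 tendsto_powr' tendsto_norm pt tendsto_const) (auto simp: space_circle_measure norm_mult)
      show "AE \<zeta> in circle_measure. norm (cmod (X n (of_real r * \<zeta>)) powr p) \<le> D powr p" for n
        using p Xb by (intro AE_I2) (auto simp: space_circle_measure intro!: powr_mono2)
    qed (auto intro!: circle_measurable_if_continuous cp W(1) XH')
    moreover have "(CINT \<zeta>. cmod (X n (of_real r * \<zeta>)) powr p) \<le> 1" for n
    proof -
      have i: "integrable circle_measure (\<lambda>\<zeta>. hump_weight i * cmod (F i (of_real r * \<zeta>)) powr p)" for i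
        by (intro circle_integrable_if_continuous continuous_intros cp FH)
      have "(CINT \<zeta>. cmod (X n (of_real r * \<zeta>)) powr p)
          \<le> (CINT \<zeta>. (\<Sum>i<n. hump_weight i * cmod (F i (of_real r * \<zeta>)) powr p))"
      proof (rule circle_integral_mono)
        fix \<zeta>
        have "cmod (X n (of_real r * \<zeta>)) \<le> (\<Sum>i<n. hump_weight i * cmod (F i (of_real r * \<zeta>)))"
          unfolding X_def by (rule order_trans[OF norm_sum]) (simp only: norm_mult norm_of_real sw order_refl)
        then have "cmod (X n (of_real r * \<zeta>)) powr p \<le> (\<Sum>i<n. hump_weight i * cmod (F i (of_real r * \<zeta>))) powr p"
          using p by (intro powr_mono2) auto
        also have "\<dots> \<le> (\<Sum>i<n. hump_weight i * cmod (F i (of_real r * \<zeta>)) powr p)"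
          using p by (intro powr_weighted_sum_le w0 w1) auto
        finally show "cmod (X n (of_real r * \<zeta>)) powr p \<le> (\<Sum>i<n. hump_weight i * cmod (F i (of_real r * \<zeta>)) powr p)" .
      qed (intro continuous_intros cp FH XH')+
      also have "\<dots> = (\<Sum>i<n. hump_weight i * (CINT \<zeta>. cmod (F i (of_real r * \<zeta>)) powr p))"
        using i by simp
      also have "\<dots> \<le> (\<Sum>i<n. hump_weight i * 1)"
        using F r by (intro sum_mono mult_left_mono w0) (auto simp: hardy_ball_def)
      finally show ?thesis using w1[of n] by simp
    qed
    ultimately show "(CINT \<zeta>. cmod (powser y (of_real r * \<zeta>)) powr p) \<le> 1"
      by (intro LIMSEQ_le_const2) auto
  qed
  moreover have "(\<lambda>n. \<Sum>i<n. of_real (s i * hump_weight i) * coef (F i) k) \<longlonglongrightarrow> coef (powser y) k" for k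
    using y[of k] unfolding W(2) coefX .
  ultimately show ?thesis by blast
qed

section \<open>Trigonometric polynomials\<close>

definition trig_polynomial :: "(complex \<Rightarrow> complex) \<Rightarrow> bool"
  where "trig_polynomial T \<longleftrightarrow> (\<exists>K P. \<forall>\<zeta>\<in>sphere 0 1. \<zeta> ^ K * T \<zeta> = poly P \<zeta>)"

lemma trig_polynomialI: "(\<And>\<zeta>. \<zeta> \<in> sphere 0 1 \<Longrightarrow> \<zeta> ^ K * T \<zeta> = poly P \<zeta>) \<Longrightarrow> trig_polynomial T"
  unfolding trig_polynomial_def by blast

lemma trig_polynomial_const: "trig_polynomial (\<lambda>_. c)"
  by (rule trig_polynomialI[where K = 0 and P = "[:c:]"]) simp

lemma trig_polynomial_add:
  assumes "trig_polynomial S" "trig_polynomial T" shows "trig_polynomial (\<lambda>\<zeta>. S \<zeta> + T \<zeta>)"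
proof -
  obtain K P L Q where "\<forall>\<zeta>\<in>sphere 0 1. \<zeta> ^ K * S \<zeta> = poly P \<zeta>" "\<forall>\<zeta>\<in>sphere 0 1. \<zeta> ^ L * T \<zeta> = poly Q \<zeta>"
    using assms unfolding trig_polynomial_def by blast
  then show ?thesis
    by (intro trig_polynomialI[where K = "K + L" and P = "monom 1 L * P + monom 1 K * Q"])
       (simp add: poly_monom power_add distrib_left mult.assoc mult.left_commute)
qed

lemma trig_polynomial_mult:
  assumes "trig_polynomial S" "trig_polynomial T" shows "trig_polynomial (\<lambda>\<zeta>. S \<zeta> * T \<zeta>)"
proof -
  obtain K P L Q where S: "\<And>\<zeta>. \<zeta> \<in> sphere 0 1 \<Longrightarrow> \<zeta> ^ K * S \<zeta> = poly P \<zeta>"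
    and T: "\<And>\<zeta>. \<zeta> \<in> sphere 0 1 \<Longrightarrow> \<zeta> ^ L * T \<zeta> = poly Q \<zeta>"
    using assms unfolding trig_polynomial_def by blast
  have "\<zeta> ^ (K + L) * (S \<zeta> * T \<zeta>) = poly (P * Q) \<zeta>" if "\<zeta> \<in> sphere 0 1" for \<zeta>
  proof -
    have "\<zeta> ^ (K + L) * (S \<zeta> * T \<zeta>) = (\<zeta> ^ K * S \<zeta>) * (\<zeta> ^ L * T \<zeta>)" by (simp add: power_add mult_ac)
    also have "\<dots> = poly (P * Q) \<zeta>" unfolding S[OF that] T[OF that] by simp
    finally show ?thesis .
  qed
  then show ?thesis by (rule trig_polynomialI)
qed

lemma trig_polynomial_if_real_polynomial:
  fixes f :: "complex \<Rightarrow> real"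
  assumes "real_polynomial_function f" shows "trig_polynomial (\<lambda>\<zeta>. of_real (f \<zeta>))"
  using assms
proof (induction rule: real_polynomial_function.induct)
  case (linear f)
  define \<alpha> \<beta> where "\<alpha> = (of_real (f 1) - \<i> * of_real (f \<i>)) / 2" and "\<beta> = (of_real (f 1) + \<i> * of_real (f \<i>)) / 2"
  show ?case
  proof (rule trig_polynomialI[where K = 1 and P = "[:\<beta>, 0, \<alpha>:]"])
    fix \<zeta> :: complex assume "\<zeta> \<in> sphere 0 1"
    then have u: "\<zeta> * cnj \<zeta> = 1" by (simp add: complex_norm_square[symmetric])
    interpret bounded_linear f by fact
    have "f \<zeta> = f (Re \<zeta> *\<^sub>R 1 + Im \<zeta> *\<^sub>R \<i>)" by (rule arg_cong[where f = f]) (simp add: complex_eq_iff)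
    also have "\<dots> = Re \<zeta> * f 1 + Im \<zeta> * f \<i>" by (simp only: add scaleR real_scaleR_def)
    finally have "of_real (f \<zeta>) = \<alpha> * \<zeta> + \<beta> * cnj \<zeta>"
      by (simp add: \<alpha>_def \<beta>_def complex_eq_iff field_simps)
    then have "\<zeta> * of_real (f \<zeta>) = \<alpha> * \<zeta> * \<zeta> + \<beta> * (\<zeta> * cnj \<zeta>)" by (simp add: algebra_simps)
    then show "\<zeta> ^ 1 * of_real (f \<zeta>) = poly [:\<beta>, 0, \<alpha>:] \<zeta>" unfolding u by (simp add: algebra_simps)
  qed
qed (simp_all add: trig_polynomial_const trig_polynomial_add trig_polynomial_mult)

text \<open>
  The Stone-Weierstrass theorem gives polynomials in the real and imaginary part of the variable; on
  the circle the conjugate is the inverse, so these are trigonometric polynomials.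
\<close>

lemma trig_polynomial_approx:
  fixes F :: "complex \<Rightarrow> complex"
  assumes "continuous_on (sphere 0 1) F" "0 < e"
  shows "\<exists>T. trig_polynomial T \<and> continuous_on (sphere 0 1) T \<and> (\<forall>\<zeta>\<in>sphere 0 1. cmod (F \<zeta> - T \<zeta>) < e)"
proof -
  obtain g where g: "polynomial_function g" "\<forall>\<zeta>\<in>sphere 0 1. norm (F \<zeta> - g \<zeta>) < e"
    using Stone_Weierstrass_polynomial_function[OF _ assms] by auto
  have "real_polynomial_function (Re \<circ> g)" "real_polynomial_function (Im \<circ> g)"
    using g(1) bounded_linear_Re bounded_linear_Im unfolding polynomial_function_def by auto
  then have "trig_polynomial (\<lambda>\<zeta>. of_real (Re (g \<zeta>)) + \<i> * of_real (Im (g \<zeta>)))"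
    using trig_polynomial_if_real_polynomial[of "Re \<circ> g"] trig_polynomial_if_real_polynomial[of "Im \<circ> g"]
    by (intro trig_polynomial_add trig_polynomial_mult trig_polynomial_const) auto
  then have "trig_polynomial g" by (simp flip: complex_eq)
  then show ?thesis using g continuous_on_polymonial_function by blast
qed

lemma tendsto_if_close:
  fixes T :: "nat \<Rightarrow> complex"
  assumes "\<And>n. cmod (c - T n) < 1 / real (Suc n)"
  shows "T \<longlonglongrightarrow> c"
proof (rule LIM_zero_cancel, rule Lim_null_comparison)
  show "\<forall>\<^sub>F n in sequentially. norm (T n - c) \<le> 1 / real (Suc n)"
    using assms by (intro always_eventually allI) (simp add: norm_minus_commute less_imp_le)
  show "(\<lambda>n. 1 / real (Suc n)) \<longlonglongrightarrow> 0" by (rule LIMSEQ_Suc[OF lim_1_over_n])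
qed

lemma circle_uniform_bound:
  fixes F :: "complex \<Rightarrow> complex"
  assumes "continuous_on (sphere 0 1) F"
  obtains B where "0 \<le> B" "\<And>\<zeta>. \<zeta> \<in> sphere 0 1 \<Longrightarrow> cmod (F \<zeta>) \<le> B"
proof -
  have "bounded (F ` sphere 0 1)" using assms by (intro compact_imp_bounded compact_continuous_image) auto
  then obtain B where "\<forall>x\<in>F ` sphere 0 1. norm x \<le> B" unfolding bounded_iff by blast
  then show ?thesis using that[of "max B 0"] by force
qed

text \<open>
  Uniformly close approximants are uniformly bounded; this is the domination in the two limit
  theorems below.
\<close>

lemma circle_approximants_bounded:
  fixes T :: "nat \<Rightarrow> complex \<Rightarrow> complex"
  assumes F: "continuous_on (sphere 0 1) F"
    and close: "\<And>n \<zeta>. \<zeta> \<in> sphere 0 1 \<Longrightarrow> cmod (F \<zeta> - T n \<zeta>) < 1 / real (Suc n)"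
  shows "\<exists>B\<ge>0. \<forall>n. \<forall>\<zeta>\<in>sphere 0 1. cmod (T n \<zeta>) \<le> B"
proof -
  obtain B where B: "0 \<le> B" "\<And>\<zeta>. \<zeta> \<in> sphere 0 1 \<Longrightarrow> cmod (F \<zeta>) \<le> B" using circle_uniform_bound[OF F] by metis
  have "cmod (T n \<zeta>) \<le> B + 1" if z: "\<zeta> \<in> sphere 0 1" for n \<zeta>
  proof -
    have "cmod (T n \<zeta>) \<le> cmod (F \<zeta>) + cmod (F \<zeta> - T n \<zeta>)" using norm_triangle_ineq4[of "F \<zeta>" "F \<zeta> - T n \<zeta>"] by simp
    moreover have "cmod (F \<zeta> - T n \<zeta>) \<le> 1" using close[OF z, of n] by (rule less_imp_le[THEN order_trans]) simp
    ultimately show ?thesis using B(2)[OF z] by linarith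
  qed
  then show ?thesis using B(1) by (intro exI[of _ "B + 1"]) simp
qed

lemma circle_powr_limit:
  fixes T :: "nat \<Rightarrow> complex \<Rightarrow> complex"
  assumes F: "continuous_on (sphere 0 1) F" and T: "\<And>n. continuous_on (sphere 0 1) (T n)"
    and close: "\<And>n \<zeta>. \<zeta> \<in> sphere 0 1 \<Longrightarrow> cmod (F \<zeta> - T n \<zeta>) < 1 / real (Suc n)" and p: "0 < p"
  shows "(\<lambda>n. CINT \<zeta>. cmod (T n \<zeta>) powr p) \<longlonglongrightarrow> (CINT \<zeta>. cmod (F \<zeta>) powr p)"
proof -
  obtain B where B: "0 \<le> B" "\<forall>n. \<forall>\<zeta>\<in>sphere 0 1. cmod (T n \<zeta>) \<le> B"
    using circle_approximants_bounded[OF F close] by blast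
  show ?thesis
  proof (rule integral_dominated_convergence[where w = "\<lambda>_. B powr p"])
    show "AE \<zeta> in circle_measure. (\<lambda>n. cmod (T n \<zeta>) powr p) \<longlonglongrightarrow> cmod (F \<zeta>) powr p"
      using p by (intro AE_I2 tendsto_powr' tendsto_norm tendsto_if_close close tendsto_const) (auto simp: space_circle_measure)
    show "AE \<zeta> in circle_measure. norm (cmod (T n \<zeta>) powr p) \<le> B powr p" for n
      using p B by (intro AE_I2) (auto simp: space_circle_measure intro!: powr_mono2)
  qed (use p in \<open>auto intro!: circle_measurable_if_continuous continuous_on_norm_powr F T\<close>)
qed

lemma circle_sesquilinear_limit:
  fixes S T :: "nat \<Rightarrow> complex \<Rightarrow> complex"
  assumes F: "continuous_on (sphere 0 1) F" and S: "\<And>n. continuous_on (sphere 0 1) (S n)"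
    and G: "continuous_on (sphere 0 1) G" and T: "\<And>n. continuous_on (sphere 0 1) (T n)"
    and h: "continuous_on (sphere 0 1) h"
    and closeS: "\<And>n \<zeta>. \<zeta> \<in> sphere 0 1 \<Longrightarrow> cmod (F \<zeta> - S n \<zeta>) < 1 / real (Suc n)"
    and closeT: "\<And>n \<zeta>. \<zeta> \<in> sphere 0 1 \<Longrightarrow> cmod (G \<zeta> - T n \<zeta>) < 1 / real (Suc n)"
  shows "(\<lambda>n. CINT \<zeta>. S n \<zeta> * cnj (h \<zeta> * T n \<zeta>)) \<longlonglongrightarrow> (CINT \<zeta>. F \<zeta> * cnj (h \<zeta> * G \<zeta>))"
proof -
  obtain A where A: "0 \<le> A" "\<forall>n. \<forall>\<zeta>\<in>sphere 0 1. cmod (S n \<zeta>) \<le> A" using circle_approximants_bounded[OF F closeS] by blast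
  obtain B where B: "0 \<le> B" "\<forall>n. \<forall>\<zeta>\<in>sphere 0 1. cmod (T n \<zeta>) \<le> B" using circle_approximants_bounded[OF G closeT] by blast
  obtain C where C: "0 \<le> C" "\<And>\<zeta>. \<zeta> \<in> sphere 0 1 \<Longrightarrow> cmod (h \<zeta>) \<le> C" using circle_uniform_bound[OF h] by metis
  show ?thesis
  proof (rule integral_dominated_convergence[where w = "\<lambda>_. A * (C * B)"])
    show "AE \<zeta> in circle_measure. (\<lambda>n. S n \<zeta> * cnj (h \<zeta> * T n \<zeta>)) \<longlonglongrightarrow> F \<zeta> * cnj (h \<zeta> * G \<zeta>)"
      by (intro AE_I2 tendsto_mult tendsto_cnj tendsto_const tendsto_if_close closeS closeT) (auto simp: space_circle_measure)
    show "AE \<zeta> in circle_measure. norm (S n \<zeta> * cnj (h \<zeta> * T n \<zeta>)) \<le> A * (C * B)" for n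
      unfolding norm_mult complex_mod_cnj
      by (intro AE_I2 mult_mono) (use A B C in \<open>auto simp: space_circle_measure\<close>)
    show "(\<lambda>\<zeta>. F \<zeta> * cnj (h \<zeta> * G \<zeta>)) \<in> borel_measurable circle_measure"
      by (intro circle_measurable_if_continuous continuous_intros F G h)
    show "(\<lambda>\<zeta>. S n \<zeta> * cnj (h \<zeta> * T n \<zeta>)) \<in> borel_measurable circle_measure" for n
      by (intro circle_measurable_if_continuous continuous_intros S T h)
  qed auto
qed

lemma poly_eq_partial_poly:
  assumes "degree P < N" shows "poly P \<zeta> = partial_poly (coeff P) N \<zeta>"
proof -
  have "poly P \<zeta> = (\<Sum>i\<le>degree P. coeff P i * \<zeta> ^ i)" by (rule poly_altdef)
  also have "\<dots> = (\<Sum>i<N. coeff P i * \<zeta> ^ i)"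
    by (rule sum.mono_neutral_left) (use assms in \<open>auto simp: coeff_eq_0\<close>)
  finally show ?thesis by (simp add: partial_poly_def)
qed

lemma coef_mult_partial_poly:
  assumes h: "h holomorphic_on unit_disk"
  shows "coef (\<lambda>z. h z * partial_poly y N z) j = (\<Sum>m<N. y m * (if m \<le> j then coef h (j - m) else 0))"
proof -
  have "coef (\<lambda>z. h z * partial_poly y N z) = (\<lambda>j. \<Sum>m<N. y m * (if m \<le> j then coef h (j - m) else 0))"
  proof (rule coef_eqI)
    fix z assume z: "z \<in> unit_disk"
    have "(\<lambda>j. \<Sum>m<N. y m * ((if m \<le> j then coef h (j - m) else 0) * z ^ j)) sums (\<Sum>m<N. y m * (z ^ m * h z))"
      by (intro sums_sum sums_mult powser_shift_sums coef_sums h z)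
    then show "(\<lambda>j. (\<Sum>m<N. y m * (if m \<le> j then coef h (j - m) else 0)) * z ^ j) sums (h z * partial_poly y N z)"
      by (simp add: partial_poly_def sum_distrib_left sum_distrib_right mult_ac)
  qed
  then show ?thesis by simp
qed

lemma coef_dilate_half:
  assumes h: "h holomorphic_on unit_disk"
  shows "coef (\<lambda>z. h (z / 2)) = (\<lambda>k. coef h k / 2 ^ k)"
proof (rule coef_eqI)
  fix z :: complex assume z: "z \<in> unit_disk"
  have "(\<lambda>n. coef h n * (z / 2) ^ n) sums h (z / 2)"
    by (rule coef_sums[OF h]) (use z in \<open>simp add: norm_divide\<close>)
  then show "(\<lambda>n. coef h n / 2 ^ n * z ^ n) sums h (z / 2)" by (simp add: power_divide)
qed

lemma ip2_partial_poly_left: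
  assumes "g \<in> H2"
  shows "ip2 (partial_poly x N) g = (\<Sum>j<N. x j * cnj (coef g j))"
proof -
  have "partial_poly x N \<in> H2" using H2_polynomial[of x N] by (simp add: partial_poly_def[abs_def])
  then have "ip2 (partial_poly x N) g = cnj (ip2 g (partial_poly x N))" by (rule H2.ip_commute[OF assms])
  also have "ip2 g (partial_poly x N) = (\<Sum>j<N. coef g j * cnj (x j))"
    using ip2_polynomial[of g x N] by (simp add: partial_poly_def[abs_def])
  finally show ?thesis by (simp add: mult.commute)
qed

lemma partial_poly_hardy_infty: "partial_poly x N \<in> hardy_infty"
proof -
  obtain B where B: "\<And>z. z \<in> cball 0 1 \<Longrightarrow> cmod (partial_poly x N z) \<le> B"
    using compact_imp_bounded[OF compact_continuous_image[OF partial_poly_continuous compact_cball[of 0 1]], of x N]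
    unfolding bounded_iff by blast
  show ?thesis by (rule hardy_inftyI[OF partial_poly_holomorphic, of _ _ B]) (rule B, simp)
qed

text \<open>
  Parseval's formula on the circle of radius \<open>r\<close> for \<open>z ^ j\<close> and \<open>z ^ m h z\<close>.  Only \<open>h\<close> is to be
  dilated, and the powers of \<open>r\<close> that stem from the two monomials are divided out.
\<close>

lemma circle_monomial_integral:
  assumes h: "h holomorphic_on unit_disk" and r: "0 < r" "r < 1"
  shows "(CINT \<zeta>. \<zeta> ^ j * cnj (\<zeta> ^ m * h (of_real r * \<zeta>)))
    = (if m \<le> j then cnj (coef h (j - m)) * of_real r ^ (j - m) else 0)"
proof -
  \<comment> \<open>The coefficient sequences of \<open>z ^ j\<close> and of \<open>z ^ m h z\<close>.\<close>
  define e :: "nat \<Rightarrow> complex" where "e n = (if n = j then 1 else 0)" for n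
  define y where "y n = (if m \<le> n then coef h (n - m) else 0)" for n
  have e: "(\<lambda>n. e n * z ^ n) sums z ^ j" for z
    unfolding e_def by (rule monomial_sums)
  have y: "(\<lambda>n. y n * z ^ n) sums (z ^ m * h z)" if "z \<in> unit_disk" for z
    unfolding y_def by (rule powser_shift_sums[OF coef_sums[OF h that]])
  have "(\<lambda>n. e n * cnj (y n) * of_real (r ^ (2 * n))) sums
      (CINT \<zeta>. (of_real r * \<zeta>) ^ j * cnj ((of_real r * \<zeta>) ^ m * h (of_real r * \<zeta>)))"
    by (rule parseval_sums[OF e y]) (use r in auto)
  moreover have "(\<lambda>n. e n * cnj (y n) * of_real (r ^ (2 * n))) sums (cnj (y j) * of_real (r ^ (2 * j)))"
    using sums_single[of j "\<lambda>n. cnj (y n) * of_real (r ^ (2 * n))"]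
    unfolding e_def by (rule sums_cong[THEN iffD1, rotated]) auto
  ultimately have "(CINT \<zeta>. (of_real r * \<zeta>) ^ j * cnj ((of_real r * \<zeta>) ^ m * h (of_real r * \<zeta>)))
      = cnj (y j) * of_real (r ^ (2 * j))" by (rule sums_unique2)
  moreover have "(CINT \<zeta>. (of_real r * \<zeta>) ^ j * cnj ((of_real r * \<zeta>) ^ m * h (of_real r * \<zeta>)))
      = (CINT \<zeta>. of_real (r ^ (j + m)) * (\<zeta> ^ j * cnj (\<zeta> ^ m * h (of_real r * \<zeta>))))"
    by (intro Bochner_Integration.integral_cong refl) (simp add: power_mult_distrib power_add mult_ac)
  ultimately have *: "of_real (r ^ (j + m)) * (CINT \<zeta>. \<zeta> ^ j * cnj (\<zeta> ^ m * h (of_real r * \<zeta>)))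
      = cnj (y j) * of_real (r ^ (2 * j))" by (simp only: integral_mult_right_zero)
  have r0: "of_real (r ^ (j + m)) \<noteq> (0 :: complex)" using r by simp
  show ?thesis
  proof (cases "m \<le> j")
    case True
    then have "2 * j = (j + m) + (j - m)" by simp
    then have "of_real (r ^ (2 * j)) = (of_real (r ^ (j + m)) * of_real r ^ (j - m) :: complex)"
      by (simp only: power_add of_real_mult of_real_power)
    with * have "of_real (r ^ (j + m)) * (CINT \<zeta>. \<zeta> ^ j * cnj (\<zeta> ^ m * h (of_real r * \<zeta>)))
      = of_real (r ^ (j + m)) * (cnj (coef h (j - m)) * of_real r ^ (j - m))" using True by (simp add: y_def mult_ac)
    then show ?thesis using r0 True by (simp only: mult_cancel_left if_True) blast
  next
    case False
    then show ?thesis using * r0 by (simp add: y_def)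
  qed
qed

section \<open>From the inclusion to integrability of the quotient\<close>

context pythagorean_pair
begin

abbreviation phi :: "complex \<Rightarrow> complex" where "phi \<equiv> \<lambda>z. b z / a z"

text \<open>
  The matrix of multiplication by \<open>phi\<close> with respect to the monomials.
\<close>

definition phi_shift :: "nat \<Rightarrow> nat \<Rightarrow> complex"
  where "phi_shift j m = (if m \<le> j then coef phi (j - m) else 0)"

lemma uniform_bound_if_hardy_subset:
  assumes p: "2 < p" and sub: "hardy p \<subseteq> dBR_space b"
  shows "\<exists>C. \<forall>f\<in>hardy_ball p. \<forall>u\<in>hardy_infty. H2.nrm (\<lambda>z. a z * u z) \<le> 1 \<longrightarrow> cmod (ip2 f (\<lambda>z. b z * u z)) \<le> C"
proof -
  define Y where "Y = {\<lambda>z. b z * u z | u. u \<in> hardy_infty \<and> H2.nrm (\<lambda>z. a z * u z) \<le> 1}"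
  have "\<exists>C. \<forall>f\<in>hardy_ball p. \<forall>y\<in>Y. cmod (ip2 f y) \<le> C"
  proof (rule H2_uniform_boundedness[where R = "sqrt 2"])
    show "Y \<subseteq> H2" unfolding Y_def using b_mult_H2 by blast
    fix f assume f: "f \<in> hardy_ball p"
    show "f \<in> H2" "H2.nrm f \<le> sqrt 2" using hardy_ball_H2[OF _ f] p by auto
    have "f \<in> dBR_space b" using f sub hardy_ball_subset[of p] p by auto
    from dBR_space_memD[OF this] obtain C
      where C: "\<forall>u\<in>hardy_infty. cmod (ip2 f (\<lambda>z. b z * u z)) \<le> C * H2.nrm (\<lambda>z. a z * u z)" ..
    have "cmod (ip2 f y) \<le> \<bar>C\<bar>" if "y \<in> Y" for y
    proof -
      obtain u where u: "u \<in> hardy_infty" "H2.nrm (\<lambda>z. a z * u z) \<le> 1" "y = (\<lambda>z. b z * u z)"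
        using \<open>y \<in> Y\<close> unfolding Y_def by blast
      have "cmod (ip2 f y) \<le> C * H2.nrm (\<lambda>z. a z * u z)" unfolding u(3) by (rule C[rule_format, OF u(1)])
      also have "\<dots> \<le> \<bar>C\<bar> * 1"
        by (intro mult_mono u(2) abs_ge_self abs_ge_zero H2.nrm_nonneg a_mult_H2 u(1))
      finally show ?thesis by simp
    qed
    then show "\<exists>C. \<forall>y\<in>Y. cmod (ip2 f y) \<le> C" by blast
  next
    fix F :: "nat \<Rightarrow> complex \<Rightarrow> complex" and s :: "nat \<Rightarrow> real"
    assume "\<And>i. F i \<in> hardy_ball p" "\<And>i. s i \<in> {1, -1}"
    then show "\<exists>f\<in>hardy_ball p. \<forall>k. (\<lambda>n. \<Sum>i<n. of_real (s i * hump_weight i) * coef (F i) k) \<longlonglongrightarrow> coef f k"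
      using p by (intro hardy_ball_series) auto
  qed
  then show ?thesis unfolding Y_def by blast
qed

text \<open>
  Test functions \<open>u n = E n G\<close> with the approximate inverses \<open>E n\<close> of \<open>a\<close> satisfy \<open>\<parallel>a u n\<parallel> \<le> \<parallel>G\<parallel>\<close>, while the
  functions \<open>b u n = (a E n) phi G\<close> converge to \<open>phi G\<close>.  Since \<open>F\<close> is a polynomial, convergence of finitely
  many Taylor coefficients suffices.
\<close>

lemma toeplitz_form_bound:
  assumes C: "\<And>f u. f \<in> hardy_ball p \<Longrightarrow> u \<in> hardy_infty \<Longrightarrow> H2.nrm (\<lambda>z. a z * u z) \<le> 1 \<Longrightarrow> cmod (ip2 f (\<lambda>z. b z * u z)) \<le> C"
    and p: "2 < p" and x: "(CINT \<zeta>. cmod (partial_poly x N \<zeta>) powr p) \<le> 1"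
    and y: "(CINT \<zeta>. cmod (partial_poly y N \<zeta>) powr 2) \<le> 1"
  shows "cmod (\<Sum>j<N. \<Sum>m<N. x j * cnj (y m * phi_shift j m)) \<le> C"
proof -
  have xB: "partial_poly x N \<in> hardy_ball p" using p x by (intro partial_poly_hardy_ball) auto
  have "outer a" using mate by (simp add: pythagorean_mate_def)
  from outer_approximants[OF this] obtain E where E_props: "(\<forall>n. E n \<in> hardy_infty) \<and>
    (\<forall>n. \<forall>z\<in>unit_disk. cmod (a z * E n z) \<le> 1) \<and> (\<forall>z\<in>unit_disk. (\<lambda>n. a z * E n z) \<longlonglongrightarrow> 1)" ..
  have E: "E n \<in> hardy_infty" "z \<in> unit_disk \<Longrightarrow> cmod (a z * E n z) \<le> 1"
    "z \<in> unit_disk \<Longrightarrow> (\<lambda>n. a z * E n z) \<longlonglongrightarrow> 1" for n z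
    using E_props by simp_all
  define u where "u n z = E n z * partial_poly y N z" for n z
  have u: "u n \<in> hardy_infty" for n unfolding u_def[abs_def] by (intro hardy_infty_mult E partial_poly_hardy_infty)
  have nu: "H2.nrm (\<lambda>z. a z * u n z) \<le> 1" for n
  proof (rule H2_if_means_bounded(2)[OF hardy_infty_holomorphic[OF a_mult[OF u]]])
    fix k
    have r: "0 < radius k" "radius k < 1" using radius_bounds by auto
    have "(CINT \<zeta>. (cmod (a (of_real (radius k) * \<zeta>) * u n (of_real (radius k) * \<zeta>)))\<^sup>2)
        \<le> (CINT \<zeta>. cmod (partial_poly y N (of_real (radius k) * \<zeta>)) powr 2)"
    proof (rule circle_integral_mono)
      fix \<zeta> :: complex assume \<zeta>: "\<zeta> \<in> sphere 0 1"
      let ?z = "of_real (radius k) * \<zeta>"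
      have z: "?z \<in> unit_disk" using radius_disk[OF \<zeta>] r by simp
      have "cmod (a ?z * u n ?z) = cmod (a ?z * E n ?z) * cmod (partial_poly y N ?z)" by (simp add: u_def norm_mult)
      also have "\<dots> \<le> 1 * cmod (partial_poly y N ?z)" by (intro mult_right_mono E z) simp
      finally show "(cmod (a ?z * u n ?z))\<^sup>2 \<le> cmod (partial_poly y N ?z) powr 2" by (simp add: power_mono)
    next
      show "continuous_on (sphere 0 1) (\<lambda>\<zeta>. (cmod (a (of_real (radius k) * \<zeta>) * u n (of_real (radius k) * \<zeta>)))\<^sup>2)"
        using r by (intro continuous_intros continuous_on_dilation_if_holomorphic hardy_infty_holomorphic a_hardy_infty u) auto
      show "continuous_on (sphere 0 1) (\<lambda>\<zeta>. cmod (partial_poly y N (of_real (radius k) * \<zeta>)) powr 2)"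
        using r by (intro continuous_on_norm_powr continuous_on_dilation_if_holomorphic partial_poly_holomorphic) auto
    qed
    also have "\<dots> \<le> (CINT \<zeta>. cmod (partial_poly y N \<zeta>) powr 2)" by (rule partial_poly_mean_mono) (use r in auto)
    also have "\<dots> \<le> 1\<^sup>2" using y by simp
    finally show "(CINT \<zeta>. (cmod (a (of_real (radius k) * \<zeta>) * u n (of_real (radius k) * \<zeta>)))\<^sup>2) \<le> 1\<^sup>2" .
  qed simp
  have gh: "(\<lambda>z. phi z * partial_poly y N z) holomorphic_on unit_disk"
    by (intro holomorphic_intros phi_holomorphic partial_poly_holomorphic)
  \<comment> \<open>The functions \<open>b u n\<close> are uniformly bounded on compact sets only; dilating by \<open>1/2\<close> brings them under the convergence theorem for bounded functions.\<close>
  have half: "z / 2 \<in> unit_disk" if "z \<in> unit_disk" for z :: complex using that by (simp add: norm_divide)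
  have half_holo: "(\<lambda>z. f (z / 2)) holomorphic_on unit_disk" if "f holomorphic_on unit_disk" for f
  proof -
    have "(\<lambda>z. z / 2) holomorphic_on unit_disk" "(\<lambda>z. z / 2) ` unit_disk \<subseteq> unit_disk"
      using half by (auto intro!: holomorphic_intros)
    from holomorphic_on_compose_gen[OF this(1) that this(2)] show ?thesis by (simp only: o_def)
  qed
  have "compact ((\<lambda>z. phi z * partial_poly y N z) ` cball 0 (1/2))"
    using gh by (intro compact_continuous_image holomorphic_on_imp_continuous_on[OF holomorphic_on_subset]) auto
  then have "\<exists>B. \<forall>z\<in>cball 0 (1/2). cmod (phi z * partial_poly y N z) \<le> B"
    by (auto dest!: compact_imp_bounded simp: bounded_iff)
  then obtain B where B: "\<And>z. z \<in> cball 0 (1/2) \<Longrightarrow> cmod (phi z * partial_poly y N z) \<le> B" by blast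
  have "(\<lambda>n. coef (\<lambda>z. b (z / 2) * u n (z / 2)) k) \<longlonglongrightarrow> coef (\<lambda>z. phi (z / 2) * partial_poly y N (z / 2)) k" for k
  proof (rule H2_bounded_pointwise_limit(1)[where B = B])
    show "(\<lambda>z. b (z / 2) * u n (z / 2)) holomorphic_on unit_disk" for n
      by (rule half_holo[OF hardy_infty_holomorphic[OF b_mult[OF u]]])
    show "(\<lambda>z. phi (z / 2) * partial_poly y N (z / 2)) holomorphic_on unit_disk" by (rule half_holo[OF gh])
    have e: "b (z / 2) * u n (z / 2) = (a (z / 2) * E n (z / 2)) * (phi (z / 2) * partial_poly y N (z / 2))" if "z \<in> unit_disk" for n z
      using a_nonzero[OF half[OF that]] by (simp add: u_def)
    show "cmod (b (z / 2) * u n (z / 2)) \<le> B" if z: "z \<in> unit_disk" for n z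
    proof -
      have "z / 2 \<in> cball 0 (1/2)" using z by (simp add: norm_divide)
      then have "cmod (a (z / 2) * E n (z / 2)) * cmod (phi (z / 2) * partial_poly y N (z / 2)) \<le> 1 * B"
        by (intro mult_mono E half z B) auto
      then show ?thesis unfolding e[OF z] norm_mult by simp
    qed
    show "(\<lambda>n. b (z / 2) * u n (z / 2)) \<longlonglongrightarrow> phi (z / 2) * partial_poly y N (z / 2)" if z: "z \<in> unit_disk" for z
      using tendsto_mult_right[OF E(3)[OF half[OF z]], of "phi (z / 2) * partial_poly y N (z / 2)"] unfolding e[OF z] by simp
  qed
  then have "(\<lambda>n. coef (\<lambda>z. b z * u n z) k / 2 ^ k * 2 ^ k) \<longlonglongrightarrow> coef (\<lambda>z. phi z * partial_poly y N z) k / 2 ^ k * 2 ^ k" for k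
    unfolding coef_dilate_half[OF hardy_infty_holomorphic[OF b_mult[OF u]]] coef_dilate_half[OF gh]
    by (rule tendsto_mult_right)
  then have lim: "(\<lambda>n. coef (\<lambda>z. b z * u n z) k) \<longlonglongrightarrow> coef (\<lambda>z. phi z * partial_poly y N z) k" for k by simp
  have "(\<lambda>n. cmod (\<Sum>j<N. x j * cnj (coef (\<lambda>z. b z * u n z) j))) \<longlonglongrightarrow> cmod (\<Sum>j<N. x j * cnj (coef (\<lambda>z. phi z * partial_poly y N z) j))"
    by (intro tendsto_norm tendsto_sum tendsto_mult_left tendsto_cnj lim)
  then have "cmod (\<Sum>j<N. x j * cnj (coef (\<lambda>z. phi z * partial_poly y N z) j)) \<le> C"
  proof (rule LIMSEQ_le_const2)
    have "cmod (\<Sum>j<N. x j * cnj (coef (\<lambda>z. b z * u n z) j)) \<le> C" for n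
      using C[OF xB u nu] unfolding ip2_partial_poly_left[OF b_mult_H2[OF u]] .
    then show "\<exists>M. \<forall>n\<ge>M. cmod (\<Sum>j<N. x j * cnj (coef (\<lambda>z. b z * u n z) j)) \<le> C" by blast
  qed
  also have "(\<Sum>j<N. x j * cnj (coef (\<lambda>z. phi z * partial_poly y N z) j)) = (\<Sum>j<N. \<Sum>m<N. x j * cnj (y m * phi_shift j m))"
    unfolding coef_mult_partial_poly[OF phi_holomorphic] phi_shift_def cnj_sum sum_distrib_left ..
  finally show ?thesis .
qed

text \<open>
  Let \<open>B \<eta>\<close> be the form evaluated at the two polynomials rotated by \<open>cnj \<eta>\<close>.  The rotation multiplies
  the entry with indices \<open>j\<close> and \<open>m\<close> by the conjugate of \<open>\<eta> ^ (j - m)\<close>, so averaging with the Poisson kernel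
  multiplies it by \<open>r ^ (j - m)\<close>.  This is the effect of dilating \<open>phi\<close>.  Rotations preserve the
  assumptions on \<open>x\<close> and \<open>y\<close>, and the Poisson kernel is a probability density, so the bound persists.
\<close>

lemma dilated_form_bound:
  assumes form: "\<And>x y. (CINT \<zeta>. cmod (partial_poly x N \<zeta>) powr p) \<le> 1 \<Longrightarrow> (CINT \<zeta>. cmod (partial_poly y N \<zeta>) powr 2) \<le> 1 \<Longrightarrow>
      cmod (\<Sum>j<N. \<Sum>m<N. x j * cnj (y m * phi_shift j m)) \<le> C"
    and p: "0 < p" and r: "0 < r" "r < 1"
    and x: "(CINT \<zeta>. cmod (partial_poly x N \<zeta>) powr p) \<le> 1"
    and y: "(CINT \<zeta>. cmod (partial_poly y N \<zeta>) powr 2) \<le> 1"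
  shows "cmod (CINT \<zeta>. partial_poly x N \<zeta> * cnj (phi (of_real r * \<zeta>) * partial_poly y N \<zeta>)) \<le> C"
proof -
  have r0: "0 \<le> r" using r by simp
  note cP = poisson_continuous[OF r0 r(2)]
  define I where "I = (\<Sum>j<N. \<Sum>m<N. (x j * cnj (y m)) * (cnj (phi_shift j m) * of_real r ^ (j - m)))"
  have cphi: "continuous_on (sphere 0 1) (\<lambda>\<zeta>. phi (of_real r * \<zeta>))"
    by (rule continuous_on_dilation_if_holomorphic[OF phi_holomorphic r0 r(2)])
  have "(CINT \<zeta>. partial_poly x N \<zeta> * cnj (phi (of_real r * \<zeta>) * partial_poly y N \<zeta>))
      = (CINT \<zeta>. (\<Sum>j<N. \<Sum>m<N. (x j * cnj (y m)) * (\<zeta> ^ j * cnj (\<zeta> ^ m * phi (of_real r * \<zeta>)))))"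
  proof -
    have "partial_poly x N \<zeta> * cnj (w * partial_poly y N \<zeta>) = (\<Sum>j<N. \<Sum>m<N. (x j * cnj (y m)) * (\<zeta> ^ j * cnj (\<zeta> ^ m * w)))" for w \<zeta>
      unfolding partial_poly_def sum_distrib_left[of w] cnj_sum sum_product
      by (intro sum.cong refl) (simp add: mult_ac)
    then show ?thesis by (simp only:)
  qed
  also have "\<dots> = (\<Sum>j<N. \<Sum>m<N. CINT \<zeta>. (x j * cnj (y m)) * (\<zeta> ^ j * cnj (\<zeta> ^ m * phi (of_real r * \<zeta>))))"
  proof -
    have i: "integrable circle_measure (\<lambda>\<zeta>. (x j * cnj (y m)) * (\<zeta> ^ j * cnj (\<zeta> ^ m * phi (of_real r * \<zeta>))))" for j m
      by (intro circle_integrable_if_continuous continuous_intros cphi)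
    show ?thesis by (simp only: Bochner_Integration.integral_sum Bochner_Integration.integrable_sum i)
  qed
  also have "\<dots> = I"
    unfolding I_def integral_mult_right_zero circle_monomial_integral[OF phi_holomorphic r]
    by (intro sum.cong refl) (simp add: phi_shift_def)
  finally have 1: "(CINT \<zeta>. partial_poly x N \<zeta> * cnj (phi (of_real r * \<zeta>) * partial_poly y N \<zeta>)) = I" .
  define B where "B \<eta> = (\<Sum>j<N. \<Sum>m<N. (x j * cnj \<eta> ^ j) * cnj ((y m * cnj \<eta> ^ m) * phi_shift j m))" for \<eta>
  have cB: "continuous_on (sphere 0 1) B" unfolding B_def by (intro continuous_intros)
  have Bb: "cmod (B \<eta>) \<le> C" if \<eta>: "\<eta> \<in> sphere 0 1" for \<eta>
    unfolding B_def
  proof (rule form)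
    have e: "partial_poly (\<lambda>j. w j * cnj \<eta> ^ j) N \<zeta> = partial_poly w N (\<zeta> * cnj \<eta>)" for w \<zeta>
      by (simp add: partial_poly_def power_mult_distrib mult_ac)
    have \<eta>': "cnj \<eta> \<in> sphere 0 1" using \<eta> by simp
    have rot: "(CINT \<zeta>. cmod (partial_poly w N (\<zeta> * cnj \<eta>)) powr q) = (CINT \<zeta>. cmod (partial_poly w N \<zeta>) powr q)"
      if "0 < q" for w q
      by (rule circle_integral_rotation_real[OF _ \<eta>']) (intro continuous_on_norm_powr partial_poly_continuous that)
    show "(CINT \<zeta>. cmod (partial_poly (\<lambda>j. x j * cnj \<eta> ^ j) N \<zeta>) powr p) \<le> 1" using x p unfolding e by (simp only: rot)
    show "(CINT \<zeta>. cmod (partial_poly (\<lambda>j. y j * cnj \<eta> ^ j) N \<zeta>) powr 2) \<le> 1" using y unfolding e by (simp only: rot zero_less_numeral)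
  qed
  have "I = (CINT \<eta>. of_real (poisson r \<eta>) * B \<eta>)"
  proof -
    have "(CINT \<eta>. of_real (poisson r \<eta>) * B \<eta>)
      = (CINT \<eta>. (\<Sum>j<N. \<Sum>m<N. (x j * cnj (y m) * cnj (phi_shift j m)) * (of_real (poisson r \<eta>) * cnj (\<eta> ^ (j - m)))))"
    proof (intro Bochner_Integration.integral_cong refl)
      fix \<eta> assume "\<eta> \<in> space circle_measure"
      then have un: "cnj \<eta> * \<eta> = 1" by (simp add: space_circle_measure complex_norm_square[symmetric] mult.commute[of "cnj \<eta>"])
      have "(x j * cnj \<eta> ^ j) * cnj ((y m * cnj \<eta> ^ m) * phi_shift j m) = (x j * cnj (y m) * cnj (phi_shift j m)) * cnj (\<eta> ^ (j - m))" for j m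
      proof (cases "m \<le> j")
        case True
        then have "cnj \<eta> ^ j = cnj \<eta> ^ (j - m) * cnj \<eta> ^ m" by (simp flip: power_add)
        moreover have "cnj \<eta> ^ m * \<eta> ^ m = 1" unfolding power_mult_distrib[symmetric] un by simp
        then have "cnj \<eta> ^ (j - m) * cnj \<eta> ^ m * \<eta> ^ m = cnj \<eta> ^ (j - m)" by (simp add: mult.assoc)
        ultimately have "cnj \<eta> ^ j * \<eta> ^ m = cnj \<eta> ^ (j - m)" by simp
        then have "(x j * cnj (y m) * cnj (phi_shift j m)) * (cnj \<eta> ^ j * \<eta> ^ m) = (x j * cnj (y m) * cnj (phi_shift j m)) * cnj \<eta> ^ (j - m)" by simp
        then show ?thesis by (simp add: mult_ac)
      qed (simp add: phi_shift_def)
      then show "of_real (poisson r \<eta>) * B \<eta> = (\<Sum>j<N. \<Sum>m<N. (x j * cnj (y m) * cnj (phi_shift j m)) * (of_real (poisson r \<eta>) * cnj (\<eta> ^ (j - m))))"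
        unfolding B_def sum_distrib_left by (simp only: mult.left_commute)
    qed
    also have "\<dots> = (\<Sum>j<N. \<Sum>m<N. CINT \<eta>. (x j * cnj (y m) * cnj (phi_shift j m)) * (of_real (poisson r \<eta>) * cnj (\<eta> ^ (j - m))))"
    proof -
      have i: "integrable circle_measure (\<lambda>\<eta>. (x j * cnj (y m) * cnj (phi_shift j m)) * (of_real (poisson r \<eta>) * cnj (\<eta> ^ (j - m))))" for j m
        by (intro circle_integrable_if_continuous continuous_intros cP)
      show ?thesis by (simp only: Bochner_Integration.integral_sum Bochner_Integration.integrable_sum i)
    qed
    also have "\<dots> = I"
      unfolding I_def integral_mult_right_zero poisson_moment_cnj[OF r] by (simp only: mult.assoc)
    finally show ?thesis ..
  qed
  also have "cmod \<dots> \<le> (CINT \<eta>. cmod (of_real (poisson r \<eta>) * B \<eta>))" by (rule integral_norm_bound)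
  also have "\<dots> \<le> (CINT \<eta>. poisson r \<eta> * C)"
  proof (rule circle_integral_mono)
    show "cmod (of_real (poisson r \<eta>) * B \<eta>) \<le> poisson r \<eta> * C" if "\<eta> \<in> sphere 0 1" for \<eta>
      unfolding norm_mult norm_of_real using poisson_nonneg[OF r0 r(2), of \<eta>] Bb[OF that] by (simp add: mult_left_mono)
  qed (intro continuous_intros cP cB)+
  also have "\<dots> = C" by (simp add: poisson_integral[OF r])
  finally show ?thesis unfolding 1 .
qed

text \<open>
  The form does not change when both functions are multiplied by the same power of \<open>\<zeta>\<close>.  A high power
  turns two trigonometric polynomials into polynomials, and trigonometric polynomials are uniformly
  dense.  The strict inequalities survive a small perturbation of \<open>F\<close> and \<open>G\<close>.
\<close>

lemma continuous_form_bound: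
  assumes form: "\<And>N x y. (CINT \<zeta>. cmod (partial_poly x N \<zeta>) powr p) \<le> 1 \<Longrightarrow> (CINT \<zeta>. cmod (partial_poly y N \<zeta>) powr 2) \<le> 1 \<Longrightarrow>
      cmod (CINT \<zeta>. partial_poly x N \<zeta> * cnj (h \<zeta> * partial_poly y N \<zeta>)) \<le> C"
    and p: "0 < p" and h: "continuous_on (sphere 0 1) h"
    and F: "continuous_on (sphere 0 1) F" "(CINT \<zeta>. cmod (F \<zeta>) powr p) < 1"
    and G: "continuous_on (sphere 0 1) G" "(CINT \<zeta>. cmod (G \<zeta>) powr 2) < 1"
  shows "cmod (CINT \<zeta>. F \<zeta> * cnj (h \<zeta> * G \<zeta>)) \<le> C"
proof -
  have trig: "cmod (CINT \<zeta>. S \<zeta> * cnj (h \<zeta> * T \<zeta>)) \<le> C"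
    if S: "trig_polynomial S" "(CINT \<zeta>. cmod (S \<zeta>) powr p) \<le> 1"
      and T: "trig_polynomial T" "(CINT \<zeta>. cmod (T \<zeta>) powr 2) \<le> 1" for S T
  proof -
    obtain K P where P: "\<And>\<zeta>. \<zeta> \<in> sphere 0 1 \<Longrightarrow> \<zeta> ^ K * S \<zeta> = poly P \<zeta>" using S(1) unfolding trig_polynomial_def by blast
    obtain L Q where Q: "\<And>\<zeta>. \<zeta> \<in> sphere 0 1 \<Longrightarrow> \<zeta> ^ L * T \<zeta> = poly Q \<zeta>" using T(1) unfolding trig_polynomial_def by blast
    \<comment> \<open>The factors bring both polynomials to the same power of \<open>\<zeta>\<close>, namely \<open>K + L\<close>.\<close>
    define P' Q' where "P' = monom 1 L * P" and "Q' = monom 1 K * Q"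
    define N where "N = Suc (max (degree P') (degree Q'))"
    have eP: "partial_poly (coeff P') N \<zeta> = \<zeta> ^ (K + L) * S \<zeta>" and eQ: "partial_poly (coeff Q') N \<zeta> = \<zeta> ^ (K + L) * T \<zeta>" if \<zeta>: "\<zeta> \<in> sphere 0 1" for \<zeta>
    proof -
      have "partial_poly (coeff P') N \<zeta> = poly P' \<zeta>" by (rule poly_eq_partial_poly[symmetric]) (simp add: N_def)
      then show "partial_poly (coeff P') N \<zeta> = \<zeta> ^ (K + L) * S \<zeta>" using P[OF \<zeta>, symmetric] by (simp add: P'_def poly_monom power_add)
      have "partial_poly (coeff Q') N \<zeta> = poly Q' \<zeta>" by (rule poly_eq_partial_poly[symmetric]) (simp add: N_def)
      then show "partial_poly (coeff Q') N \<zeta> = \<zeta> ^ (K + L) * T \<zeta>" using Q[OF \<zeta>, symmetric] by (simp add: Q'_def poly_monom power_add)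
    qed
    have "(CINT \<zeta>. cmod (partial_poly (coeff P') N \<zeta>) powr p) = (CINT \<zeta>. cmod (S \<zeta>) powr p)"
      by (intro Bochner_Integration.integral_cong refl) (simp add: eP space_circle_measure norm_mult norm_power)
    moreover have "(CINT \<zeta>. cmod (partial_poly (coeff Q') N \<zeta>) powr 2) = (CINT \<zeta>. cmod (T \<zeta>) powr 2)"
      by (intro Bochner_Integration.integral_cong refl) (simp add: eQ space_circle_measure norm_mult norm_power)
    moreover have "(CINT \<zeta>. partial_poly (coeff P') N \<zeta> * cnj (h \<zeta> * partial_poly (coeff Q') N \<zeta>)) = (CINT \<zeta>. S \<zeta> * cnj (h \<zeta> * T \<zeta>))"
    proof (intro Bochner_Integration.integral_cong refl)
      fix \<zeta> assume "\<zeta> \<in> space circle_measure"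
      then have \<zeta>: "\<zeta> \<in> sphere 0 1" by (simp add: space_circle_measure)
      then have un: "\<zeta> ^ (K + L) * cnj (\<zeta> ^ (K + L)) = 1" by (simp add: complex_norm_square[symmetric] norm_power del: complex_cnj_power)
      have "partial_poly (coeff P') N \<zeta> * cnj (h \<zeta> * partial_poly (coeff Q') N \<zeta>) = (\<zeta> ^ (K + L) * cnj (\<zeta> ^ (K + L))) * (S \<zeta> * cnj (h \<zeta> * T \<zeta>))"
        unfolding eP[OF \<zeta>] eQ[OF \<zeta>] complex_cnj_mult by (simp only: mult_ac)
      then show "partial_poly (coeff P') N \<zeta> * cnj (h \<zeta> * partial_poly (coeff Q') N \<zeta>) = S \<zeta> * cnj (h \<zeta> * T \<zeta>)" unfolding un by simp
    qed
    ultimately show ?thesis using form[of "coeff P'" N "coeff Q'"] S(2) T(2) by simp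
  qed
  have "\<forall>n. \<exists>T. trig_polynomial T \<and> continuous_on (sphere 0 1) T \<and> (\<forall>\<zeta>\<in>sphere 0 1. cmod (F \<zeta> - T \<zeta>) < 1 / real (Suc n))"
    by (intro allI trig_polynomial_approx F) simp
  then obtain S where S: "\<And>n. trig_polynomial (S n)" "\<And>n. continuous_on (sphere 0 1) (S n)"
    "\<And>n \<zeta>. \<zeta> \<in> sphere 0 1 \<Longrightarrow> cmod (F \<zeta> - S n \<zeta>) < 1 / real (Suc n)" by metis
  have "\<forall>n. \<exists>T. trig_polynomial T \<and> continuous_on (sphere 0 1) T \<and> (\<forall>\<zeta>\<in>sphere 0 1. cmod (G \<zeta> - T \<zeta>) < 1 / real (Suc n))"
    by (intro allI trig_polynomial_approx G) simp
  then obtain T where T: "\<And>n. trig_polynomial (T n)" "\<And>n. continuous_on (sphere 0 1) (T n)"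
    "\<And>n \<zeta>. \<zeta> \<in> sphere 0 1 \<Longrightarrow> cmod (G \<zeta> - T n \<zeta>) < 1 / real (Suc n)" by metis
  have "\<forall>\<^sub>F n in sequentially. (CINT \<zeta>. cmod (S n \<zeta>) powr p) < 1"
    by (rule order_tendstoD(2)[OF circle_powr_limit[OF F(1) S(2) S(3) p] F(2)])
  moreover have "\<forall>\<^sub>F n in sequentially. (CINT \<zeta>. cmod (T n \<zeta>) powr 2) < 1"
    by (rule order_tendstoD(2)[OF circle_powr_limit[OF G(1) T(2) T(3) zero_less_numeral] G(2)])
  ultimately have ev: "\<forall>\<^sub>F n in sequentially. cmod (CINT \<zeta>. S n \<zeta> * cnj (h \<zeta> * T n \<zeta>)) \<le> C"
    by eventually_elim (intro trig S T less_imp_le)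
  have "(\<lambda>n. cmod (CINT \<zeta>. S n \<zeta> * cnj (h \<zeta> * T n \<zeta>))) \<longlonglongrightarrow> cmod (CINT \<zeta>. F \<zeta> * cnj (h \<zeta> * G \<zeta>))"
    by (intro tendsto_norm circle_sesquilinear_limit F G S T h)
  then show ?thesis using ev by (rule tendsto_upperbound) simp
qed

text \<open>
  Up to normalisation the test functions are \<open>F = \<bar>h\<bar> ^ (q/p)\<close> and \<open>G = cnj h \<bar>h\<bar> ^ (q/2 - 1)\<close> with
  \<open>q = 2 p / (p - 2)\<close>.  Then \<open>\<bar>F\<bar> ^ p = \<bar>G\<bar>\<^sup>2 = \<bar>h\<bar> ^ q\<close>, and \<open>F cnj (h G) = \<bar>h\<bar> ^ q\<close> because
  \<open>q/p + q/2 + 1 = q\<close>.  For the mean \<open>M\<close> of \<open>\<bar>h\<bar> ^ q\<close> this gives \<open>M \<le> C' M ^ (1/p + 1/2)\<close> and hence a bound on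
  \<open>M\<close>, since \<open>1/p + 1/2 < 1\<close>.
\<close>

lemma powr_mean_bound_if_form_bound:
  assumes form: "\<And>F G. continuous_on (sphere 0 1) F \<Longrightarrow> (CINT \<zeta>. cmod (F \<zeta>) powr p) < 1 \<Longrightarrow>
      continuous_on (sphere 0 1) G \<Longrightarrow> (CINT \<zeta>. cmod (G \<zeta>) powr 2) < 1 \<Longrightarrow>
      cmod (CINT \<zeta>. F \<zeta> * cnj (h \<zeta> * G \<zeta>)) \<le> C"
    and p: "2 < p" and h: "continuous_on (sphere 0 1) h"
  shows "(CINT \<zeta>. cmod (h \<zeta>) powr (2 * p / (p - 2))) \<le> (2 * C) powr (2 * p / (p - 2))"
proof -
  define q where "q = 2 * p / (p - 2)"
  have q: "2 < q" using p by (simp add: q_def field_simps)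
  have qp: "q / p + q / 2 + 1 = q" "1 - 1 / p - 1 / 2 = 1 / q" 
  proof -
    have "q / 2 = p / (p - 2)" using p by (simp add: q_def frac_eq_eq algebra_simps)
    moreover have "q / p = 2 / (p - 2)" "1 = (p - 2) / (p - 2)" using p by (simp_all add: q_def)
    ultimately have "q / p + q / 2 + 1 = (2 + p + (p - 2)) / (p - 2)" by (simp only: add_divide_distrib)
    then show "q / p + q / 2 + 1 = q" by (simp add: q_def)
    show "1 - 1 / p - 1 / 2 = 1 / q" using p by (simp add: q_def field_simps)
  qed
  define M where "M = (CINT \<zeta>. cmod (h \<zeta>) powr q)"
  have ch: "continuous_on (sphere 0 1) (\<lambda>\<zeta>. cmod (h \<zeta>) powr e)" if "0 < e" for e
    by (intro continuous_on_norm_powr h that)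
  show ?thesis
  proof (cases "M = 0")
    case True then show ?thesis by (simp add: M_def q_def)
  next
    case False
    have "0 \<le> M" unfolding M_def by simp
    then have M: "0 < M" using False by simp
    \<comment> \<open>The factor \<open>2\<close> makes the normalised means equal to \<open>1/2\<close>, hence strictly below \<open>1\<close>.\<close>
    define A where "A = (2 * M) powr (1 / p)"
    define B where "B = (2 * M) powr (1 / 2)"
    have AB: "0 < A" "0 < B" using M by (auto simp: A_def B_def)
    have Ap: "A powr p = 2 * M" "B powr 2 = 2 * M" using M p by (auto simp: A_def B_def powr_powr)
    define F where "F \<zeta> = complex_of_real (cmod (h \<zeta>) powr (q / p) / A)" for \<zeta>
    define G where "G \<zeta> = cnj (h \<zeta>) * of_real (cmod (h \<zeta>) powr (q / 2 - 1) / B)" for \<zeta>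
    have cF: "continuous_on (sphere 0 1) F" unfolding F_def
      using AB p q by (intro continuous_intros ch) auto
    have cG: "continuous_on (sphere 0 1) G" unfolding G_def
      using AB q by (intro continuous_intros ch h) auto
    have nF: "cmod (F \<zeta>) powr p = cmod (h \<zeta>) powr q / (2 * M)" for \<zeta>
    proof -
      have e: "cmod (F \<zeta>) = cmod (h \<zeta>) powr (q / p) / A" using AB by (simp add: F_def norm_divide)
      show ?thesis unfolding e using AB Ap(1) p by (simp add: powr_divide powr_powr)
    qed
    have nG: "cmod (G \<zeta>) powr 2 = cmod (h \<zeta>) powr q / (2 * M)" for \<zeta>
    proof -
      have "cmod (G \<zeta>) = (cmod (h \<zeta>) * cmod (h \<zeta>) powr (q / 2 - 1)) / B" using AB by (simp add: G_def norm_mult norm_divide)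
      also have "cmod (h \<zeta>) * cmod (h \<zeta>) powr (q / 2 - 1) = cmod (h \<zeta>) powr (q / 2)"
        using q by (cases "h \<zeta> = 0") (simp_all add: powr_mult_base)
      finally have e: "cmod (G \<zeta>) = cmod (h \<zeta>) powr (q / 2) / B" .
      show ?thesis unfolding e using AB Ap(2) by (simp only: powr_divide powr_powr powr_ge_zero less_imp_le) simp
    qed
    have "cmod (CINT \<zeta>. F \<zeta> * cnj (h \<zeta> * G \<zeta>)) \<le> C"
    proof (rule form[OF cF _ cG])
      show "(CINT \<zeta>. cmod (F \<zeta>) powr p) < 1" "(CINT \<zeta>. cmod (G \<zeta>) powr 2) < 1"
        unfolding nF nG using M by (simp_all add: M_def[symmetric])
    qed
    also have "(CINT \<zeta>. F \<zeta> * cnj (h \<zeta> * G \<zeta>)) = of_real (M / (A * B))"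
    proof -
      have "F \<zeta> * cnj (h \<zeta> * G \<zeta>) = of_real (cmod (h \<zeta>) powr q / (A * B))" for \<zeta>
      proof -
        have "F \<zeta> * cnj (h \<zeta> * G \<zeta>) = (h \<zeta> * cnj (h \<zeta>)) * of_real (cmod (h \<zeta>) powr (q / p) / A * (cmod (h \<zeta>) powr (q / 2 - 1) / B))"
          by (simp add: F_def G_def mult_ac)
        also have "\<dots> = of_real ((cmod (h \<zeta>))\<^sup>2 * (cmod (h \<zeta>) powr (q / p) * cmod (h \<zeta>) powr (q / 2 - 1)) / (A * B))"
          unfolding complex_norm_square[symmetric] by simp
        also have "(cmod (h \<zeta>))\<^sup>2 * (cmod (h \<zeta>) powr (q / p) * cmod (h \<zeta>) powr (q / 2 - 1)) = cmod (h \<zeta>) powr q"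
        proof (cases "h \<zeta> = 0")
          case False
          then have "(cmod (h \<zeta>))\<^sup>2 = cmod (h \<zeta>) powr 2" by simp
          then have "(cmod (h \<zeta>))\<^sup>2 * (cmod (h \<zeta>) powr (q / p) * cmod (h \<zeta>) powr (q / 2 - 1)) = cmod (h \<zeta>) powr (2 + (q / p + (q / 2 - 1)))"
            by (simp only: powr_add)
          also have "2 + (q / p + (q / 2 - 1)) = q" using qp(1) by simp
          finally show ?thesis .
        qed (use q in simp)
        finally show ?thesis .
      qed
      then show ?thesis by (simp add: M_def)
    qed
    finally have "M / (A * B) \<le> C" using M AB by (simp add: norm_divide norm_mult)
    moreover have "M / (A * B) = (2 * M) powr (1 / q) / 2"
    proof -
      have "A * B = (2 * M) powr (1 / p + 1 / 2)" by (simp add: A_def B_def powr_add)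
      then have "2 * M / (A * B) = (2 * M) powr 1 / (2 * M) powr (1 / p + 1 / 2)" using M by simp
      also have "\<dots> = (2 * M) powr (1 - (1 / p + 1 / 2))" by (rule powr_diff[symmetric])
      also have "1 - (1 / p + 1 / 2) = 1 / q" using qp(2) by simp
      finally have "2 * M / (A * B) = (2 * M) powr (1 / q)" .
      moreover have "2 * M / (A * B) = 2 * (M / (A * B))" by (rule times_divide_eq_right[symmetric])
      ultimately show ?thesis by linarith
    qed
    ultimately have "(2 * M) powr (1 / q) \<le> 2 * C" by simp
    then have "((2 * M) powr (1 / q)) powr q \<le> (2 * C) powr q" using q by (intro powr_mono2) auto
    then have "2 * M \<le> (2 * C) powr q" using M q by (simp add: powr_powr)
    then have "M \<le> (2 * C) powr q" using M by simp
    then show ?thesis by (simp add: M_def q_def)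
  qed
qed

lemma phi_hardy_if_subset:
  assumes p: "2 < p" and sub: "hardy p \<subseteq> dBR_space b"
  shows "phi \<in> hardy (2 * p / (p - 2))"
proof -
  obtain C where C: "\<And>f u. f \<in> hardy_ball p \<Longrightarrow> u \<in> hardy_infty \<Longrightarrow> H2.nrm (\<lambda>z. a z * u z) \<le> 1 \<Longrightarrow> cmod (ip2 f (\<lambda>z. b z * u z)) \<le> C"
    using uniform_bound_if_hardy_subset[OF assms] by blast
  have p0: "0 < p" using p by simp
  have "(CINT \<zeta>. cmod (phi (of_real r * \<zeta>)) powr (2 * p / (p - 2))) \<le> (2 * C) powr (2 * p / (p - 2))"
    if r: "r \<in> {0<..<1}" for r
  proof -
    have r': "0 < r" "r < 1" using r by auto
    have h: "continuous_on (sphere 0 1) (\<lambda>\<zeta>. phi (of_real r * \<zeta>))"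
      using r' by (intro continuous_on_dilation_if_holomorphic phi_holomorphic) auto
    show ?thesis
      by (rule powr_mean_bound_if_form_bound[OF _ p h], rule continuous_form_bound[OF _ p0 h],
          rule dilated_form_bound[OF _ p0 r'], rule toeplitz_form_bound[OF C p])
  qed
  then have "\<exists>K. \<forall>r\<in>{0<..<1}. (CINT \<zeta>. cmod (phi (of_real r * \<zeta>)) powr (2 * p / (p - 2))) \<le> K" by blast
  then show ?thesis using p phi_holomorphic by (subst hardy_iff) auto
qed

end

theorem theorem1:
  fixes a b :: "complex \<Rightarrow> complex" and p :: real
  assumes "b holomorphic_on unit_disk" and "b ` unit_disk \<subseteq> unit_disk"
    and "nonextreme_in_unit_ball b"
    and "pythagorean_mate b a"
    and "2 < p"
  shows "hardy p \<subseteq> dBR_space b \<longleftrightarrow> (\<lambda>z. b z / a z) \<in> hardy (2 * p / (p - 2))"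
proof -
  interpret pythagorean_pair a b by standard (use assms in auto)
  show ?thesis using phi_hardy_if_subset hardy_subset_dBR_space assms(5) by blast
qed

end
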